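(* Let $(\mathcal{C},\mathbb{E},\mathfrak{s})$ be a small $R$-linear extriangulated category with enough injective morphisms. Then $(\mathbb{E}_{\mathrm{II}}^{\bullet},\delta^\sharp)$ is a (contravariant) $\delta$-functor on $(\mathcal{C},\mathbb{E},\mathfrak{s})$, i.e. for every $\mathfrak{s}$-triangle $A\xrightarrow{x}B\xrightarrow{y}C\overset{\delta}{\dashrightarrow}$ the sequence $$\cdots\xrightarrow{\delta^\sharp}\mathbb{E}_{\mathrm{II}}^{n}(C,-)\xrightarrow{y^*}\mathbb{E}_{\mathrm{II}}^{n}(B,-)\xrightarrow{x^*}\mathbb{E}_{\mathrm{II}}^{n}(A,-)\xrightarrow{\delta^\sharp}\mathbb{E}_{\mathrm{II}}^{n+1}(C,-)\to\cdots\qquad(n\in\mathbb{Z})$$ is exact in $\mathcal{C}\,\mathrm{Mod}$.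
   Context: $R$ is a commutative ring with $1$; $\mathcal{C}$ is an additive $R$-linear category. Extriangulated categories: let $\mathbb{E}\colon\mathcal{C}^{\mathrm{op}}\times\mathcal{C}\to\mathrm{Mod}\,R$ be an $R$-bilinear functor. An element $\delta\in\mathbb{E}(C,A)$ is called an extension; for $a\colon A\to A'$ and $c\colon C'\to C$ put $a_*\delta=\mathbb{E}(C,a)(\delta)$ and $c^*\delta=\mathbb{E}(c,A)(\delta)$. A morphism of extensions from $\delta\in\mathbb{E}(C,A)$ to $\delta'\in\mathbb{E}(C',A')$ is a pair $(a\colon A\to A',\,c\colon C\to C')$ with $a_*\delta=c^*\delta'$. The extension $\delta\oplus\delta'\in\mathbb{E}(C\oplus C',A\oplus A')$ is the one with diagonal components $\delta,\delta'$ and zero off-diagonal components. Sequences $A\xrightarrow{x}B\xrightarrow{y}C$ and $A\xrightarrow{x'}B'\xrightarrow{y'}C$ are equivalent if there is an isomorphism $b\colon B\to B'$ with $bx=x'$, $y'b=y$; the class is written $[A\xrightarrow{x}B\xrightarrow{y}C]$. An additive realization $\mathfrak{s}$ assigns to each $\delta\in\mathbb{E}(C,A)$ such a class $\mathfrak{s}(\delta)=[A\xrightarrow{x}B\xrightarrow{y}C]$ so that: for each morphism $(a,c)\colon\delta\to\delta'$ with $\mathfrak{s}(\delta')=[A'\xrightarrow{x'}B'\xrightarrow{y'}C']$ there is $b\colon B\to B'$ with $bx=x'a$, $y'b=cy$; $\mathfrak{s}(0)=[A\to A\oplus C\to C]$ (canonical maps); and $\mathfrak{s}(\delta\oplus\delta')=\mathfrak{s}(\delta)\oplus\mathfrak{s}(\delta')$.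 The triple $(\mathcal{C},\mathbb{E},\mathfrak{s})$ is an ($R$-linear) extriangulated category if moreover: (ET3) if $\mathfrak{s}(\delta)=[A\xrightarrow{x}B\xrightarrow{y}C]$, $\mathfrak{s}(\delta')=[A'\xrightarrow{x'}B'\xrightarrow{y'}C']$ and $bx=x'a$, then there is $c$ with $cy=y'b$ and $a_*\delta=c^*\delta'$; (ET3)$^{\mathrm{op}}$ the dual; (ET4) if $\delta\in\mathbb{E}(D,A)$ and $\delta'\in\mathbb{E}(F,B)$ are realized by $A\xrightarrow{f}B\xrightarrow{f'}D$ and $B\xrightarrow{g}C\xrightarrow{g'}F$, then there are an object $E$, morphisms $d\colon D\to E$, $e\colon E\to F$, $h=gf$, $h'\colon C\to E$ with $h'g=df'$, $eh'=g'$, and $\delta''\in\mathbb{E}(E,A)$ realized by $A\xrightarrow{h}C\xrightarrow{h'}E$, such that $D\xrightarrow{d}E\xrightarrow{e}F$ realizes $f'_*\delta'$, $d^*\delta''=\delta$ and $f_*\delta''=e^*\delta'$; (ET4)$^{\mathrm{op}}$ the dual. If $\mathfrak{s}(\delta)=[A\xrightarrow{x}B\xrightarrow{y}C]$ one writes $A\xrightarrow{x}B\xrightarrow{y}C\overset{\delta}{\dashrightarrow}$ and calls it an $\mathfrak{s}$-triangle; $x$ is an inflation, $y$ a deflation, $A\to B\to C$ a conflation. A morphism $f$ is injective if $\mathbb{E}(-,f)=0$. There are enough injective morphisms if every object $A$ admits an inflation $A\to I$ which is an injective morphism. $\mathrm{Mod}\,\mathcal{C}$ (resp. $\mathcal{C}\,\mathrm{Mod}$)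 is the category of $R$-linear functors $\mathcal{C}^{\mathrm{op}}\to\mathrm{Mod}\,R$ (resp. $\mathcal{C}\to\mathrm{Mod}\,R$). For $\mathcal{C}$ small, positive extensions are defined by $\mathbb{E}^0=\mathcal{C}(-,-)$, $\mathbb{E}^1=\mathbb{E}$ and inductively by the coend $\mathbb{E}^n(X,Y)=\int^{M\in\mathcal{C}}\mathbb{E}^{n-1}(M,Y)\otimes_R\mathbb{E}(X,M)$; there are natural isomorphisms $\mathbb{E}^{s+t}(X,Y)\cong\int^{M}\mathbb{E}^s(M,Y)\otimes_R\mathbb{E}^t(X,M)$. Write $\rho\cup\lambda\in\mathbb{E}^{s+t}(X,Y)$ for the class of $\rho\otimes\lambda$, $\rho\in\mathbb{E}^s(M,Y)$, $\lambda\in\mathbb{E}^t(X,M)$. For $\delta\in\mathbb{E}(C,A)$ and $n\ge0$, $\delta_\sharp\colon\mathbb{E}^n(-,C)\to\mathbb{E}^{n+1}(-,A)$ is $\lambda\mapsto\delta\cup\lambda$ and $\delta^\sharp\colon\mathbb{E}^n(A,-)\to\mathbb{E}^{n+1}(C,-)$ is $\lambda\mapsto\lambda\cup\delta$; for $n=0$ these are $f\mapsto f^*\delta$ and $f\mapsto f_*\delta$. Negative extensions: for $n\ge0$ put $\mathbb{E}_{\mathrm{II}}^{-n}(C,A)=(\mathrm{Mod}\,\mathcal{C})(\mathbb{E}^n(-,C),\mathcal{C}(-,A))$, an $R$-bilinear functor of $(C,A)$ ($\mathbb{E}_{\mathrm{II}}^0=\mathcal{C}(-,-)$ by Yoneda),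 and $\mathbb{E}_{\mathrm{II}}^{n}=\mathbb{E}^n$ for $n>0$. For $\delta\in\mathbb{E}(C,A)$ and $n\ge0$, $\delta^\sharp\colon\mathbb{E}_{\mathrm{II}}^{-(n+1)}(A,-)\to\mathbb{E}_{\mathrm{II}}^{-n}(C,-)$ is precomposition with $\delta_\sharp\colon\mathbb{E}^n(-,C)\to\mathbb{E}^{n+1}(-,A)$; in non-negative degrees $\delta^\sharp$ is the map $\delta^\sharp$ of $\mathbb{E}^n$. *)

theory Defs
  imports "HOL-Algebra.Module" "HOL-Algebra.AbelCoset" "HOL-Library.FSet"
begin

section \<open>Modules\<close>

definition linear_maps ::
    "('r, 'q) ring_scheme \<Rightarrow> ('r, 'a) module \<Rightarrow> ('r, 'b) module \<Rightarrow> ('a \<Rightarrow> 'b) set" where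
  "linear_maps R M N = {f \<in> carrier M \<rightarrow> carrier N.
     (\<forall>u\<in>carrier M. \<forall>v\<in>carrier M. f (u \<oplus>\<^bsub>M\<^esub> v) = f u \<oplus>\<^bsub>N\<^esub> f v) \<and>
     (\<forall>r\<in>carrier R. \<forall>u\<in>carrier M. f (r \<odot>\<^bsub>M\<^esub> u) = r \<odot>\<^bsub>N\<^esub> f u)}"

definition exact_at ::
    "('r, 'a) module \<Rightarrow> ('r, 'b) module \<Rightarrow> ('r, 'c) module \<Rightarrow> ('a \<Rightarrow> 'b) \<Rightarrow> ('b \<Rightarrow> 'c) \<Rightarrow> bool" where
  "exact_at L M N f g \<longleftrightarrow> f ` carrier L = a_kernel M N g"

text \<open>
  The \<^const>\<open>mult\<close> and \<^const>\<open>one\<close> fields of a module record carry no information; they are left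
  \<^const>\<open>undefined\<close> throughout.
\<close>

definition transport :: "('a \<Rightarrow> 'b) \<Rightarrow> ('r, 'a) module \<Rightarrow> ('r, 'b) module" where
  "transport h M =
    \<lparr>carrier = h ` carrier M, mult = undefined, one = undefined, zero = h \<zero>\<^bsub>M\<^esub>,
     add = (\<lambda>u v. h (inv_into (carrier M) h u \<oplus>\<^bsub>M\<^esub> inv_into (carrier M) h v)),
     smult = (\<lambda>r u. h (r \<odot>\<^bsub>M\<^esub> inv_into (carrier M) h u))\<rparr>"

definition free_module :: "('r, 'q) ring_scheme \<Rightarrow> 'g set \<Rightarrow> ('r, 'g \<Rightarrow> 'r) module" where
  "free_module R S =
    \<lparr>carrier = {\<phi>. \<phi> \<in> S \<rightarrow> carrier R \<and> (\<forall>g. g \<notin> S \<longrightarrow> \<phi> g = \<zero>\<^bsub>R\<^esub>) \<and> finite {g. \<phi> g \<noteq> \<zero>\<^bsub>R\<^esub>}},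
     mult = undefined, one = undefined, zero = (\<lambda>g. \<zero>\<^bsub>R\<^esub>),
     add = (\<lambda>\<phi> \<psi> g. \<phi> g \<oplus>\<^bsub>R\<^esub> \<psi> g),
     smult = (\<lambda>r \<phi> g. r \<otimes>\<^bsub>R\<^esub> \<phi> g)\<rparr>"

definition basis_elt :: "('r, 'q) ring_scheme \<Rightarrow> 'g \<Rightarrow> 'g \<Rightarrow> 'r" where
  "basis_elt R g = (\<lambda>h. if h = g then \<one>\<^bsub>R\<^esub> else \<zero>\<^bsub>R\<^esub>)"

text \<open>The linear extension of the map of generators \<open>h\<close>.\<close>

definition free_map :: "('r, 'q) ring_scheme \<Rightarrow> ('g \<Rightarrow> 'h) \<Rightarrow> ('g \<Rightarrow> 'r) \<Rightarrow> ('h \<Rightarrow> 'r)" where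
  "free_map R h \<phi> = (\<lambda>k. \<Oplus>\<^bsub>R\<^esub> g \<in> {g. \<phi> g \<noteq> \<zero>\<^bsub>R\<^esub> \<and> h g = k}. \<phi> g)"

definition submodule_generated ::
    "('r, 'q) ring_scheme \<Rightarrow> ('r, 'a) module \<Rightarrow> 'a set \<Rightarrow> 'a set" where
  "submodule_generated R M S = \<Inter> {N. submodule N R M \<and> S \<subseteq> N}"

definition quotient_module :: "('r, 'a) module \<Rightarrow> 'a set \<Rightarrow> ('r, 'a set) module" where
  "quotient_module M N =
    \<lparr>carrier = a_rcosets\<^bsub>M\<^esub> N, mult = undefined, one = undefined, zero = N,
     add = (\<lambda>K L. K <+>\<^bsub>M\<^esub> L),
     smult = (\<lambda>r K. \<Union>k\<in>K. N +>\<^bsub>M\<^esub> (r \<odot>\<^bsub>M\<^esub> k))\<rparr>"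


section \<open>Linear and additive categories\<close>

text \<open>
  Objects form a set, so all categories are small.  Composition \<open>g \<cdot> f\<close> (first \<open>f\<close>, then \<open>g\<close>) is one
  function on arrows, as in a category with domain and codomain maps; disjointness of the hom-sets
  is not required.
\<close>

record ('r, 'o, 'm) lincat =
  obj :: "'o set"
  Hom :: "'o \<Rightarrow> 'o \<Rightarrow> ('r, 'm) module"
  cmp :: "'m \<Rightarrow> 'm \<Rightarrow> 'm" (infixl \<open>\<cdot>\<index>\<close> 70)
  idn :: "'o \<Rightarrow> 'm"

abbreviation mor :: "('r, 'o, 'm, 'z) lincat_scheme \<Rightarrow> 'o \<Rightarrow> 'o \<Rightarrow> 'm set" where
  "mor \<C> A B \<equiv> carrier (Hom \<C> A B)"

locale linear_category = cring R
  for R :: "('r, 'q) ring_scheme" +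
  fixes \<C> :: "('r, 'o, 'm, 'z) lincat_scheme"
  assumes Hom_module: "\<lbrakk>A \<in> obj \<C>; B \<in> obj \<C>\<rbrakk> \<Longrightarrow> module R (Hom \<C> A B)"
    and idn_mor: "A \<in> obj \<C> \<Longrightarrow> idn \<C> A \<in> mor \<C> A A"
    and cmp_linear_left:
      "\<lbrakk>A \<in> obj \<C>; B \<in> obj \<C>; D \<in> obj \<C>; f \<in> mor \<C> A B\<rbrakk>
        \<Longrightarrow> (\<lambda>g. g \<cdot>\<^bsub>\<C>\<^esub> f) \<in> linear_maps R (Hom \<C> B D) (Hom \<C> A D)"
    and cmp_linear_right:
      "\<lbrakk>A \<in> obj \<C>; B \<in> obj \<C>; D \<in> obj \<C>; g \<in> mor \<C> B D\<rbrakk>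
        \<Longrightarrow> (\<lambda>f. g \<cdot>\<^bsub>\<C>\<^esub> f) \<in> linear_maps R (Hom \<C> A B) (Hom \<C> A D)"
    and cmp_assoc:
      "\<lbrakk>A \<in> obj \<C>; B \<in> obj \<C>; D \<in> obj \<C>; E \<in> obj \<C>;
        f \<in> mor \<C> A B; g \<in> mor \<C> B D; h \<in> mor \<C> D E\<rbrakk>
        \<Longrightarrow> h \<cdot>\<^bsub>\<C>\<^esub> g \<cdot>\<^bsub>\<C>\<^esub> f = h \<cdot>\<^bsub>\<C>\<^esub> (g \<cdot>\<^bsub>\<C>\<^esub> f)"
    and cmp_idn_left:
      "\<lbrakk>A \<in> obj \<C>; B \<in> obj \<C>; f \<in> mor \<C> A B\<rbrakk> \<Longrightarrow> idn \<C> B \<cdot>\<^bsub>\<C>\<^esub> f = f"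
    and cmp_idn_right:
      "\<lbrakk>A \<in> obj \<C>; B \<in> obj \<C>; f \<in> mor \<C> A B\<rbrakk> \<Longrightarrow> f \<cdot>\<^bsub>\<C>\<^esub> idn \<C> A = f"

definition zero_object :: "('r, 'o, 'm, 'z) lincat_scheme \<Rightarrow> 'o \<Rightarrow> bool" where
  "zero_object \<C> Z \<longleftrightarrow> Z \<in> obj \<C> \<and>
     (\<forall>X\<in>obj \<C>. mor \<C> X Z = {\<zero>\<^bsub>Hom \<C> X Z\<^esub>} \<and> mor \<C> Z X = {\<zero>\<^bsub>Hom \<C> Z X\<^esub>})"

definition biproduct ::
    "('r, 'o, 'm, 'z) lincat_scheme \<Rightarrow> 'o \<Rightarrow> 'o \<Rightarrow> 'o \<Rightarrow> 'm \<Rightarrow> 'm \<Rightarrow> 'm \<Rightarrow> 'm \<Rightarrow> bool" where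
  "biproduct \<C> A A' P i i' p p' \<longleftrightarrow>
     A \<in> obj \<C> \<and> A' \<in> obj \<C> \<and> P \<in> obj \<C> \<and>
     i \<in> mor \<C> A P \<and> i' \<in> mor \<C> A' P \<and> p \<in> mor \<C> P A \<and> p' \<in> mor \<C> P A' \<and>
     p \<cdot>\<^bsub>\<C>\<^esub> i = idn \<C> A \<and> p' \<cdot>\<^bsub>\<C>\<^esub> i' = idn \<C> A' \<and>
     p \<cdot>\<^bsub>\<C>\<^esub> i' = \<zero>\<^bsub>Hom \<C> A' A\<^esub> \<and> p' \<cdot>\<^bsub>\<C>\<^esub> i = \<zero>\<^bsub>Hom \<C> A A'\<^esub> \<and>
     i \<cdot>\<^bsub>\<C>\<^esub> p \<oplus>\<^bsub>Hom \<C> P P\<^esub> i' \<cdot>\<^bsub>\<C>\<^esub> p' = idn \<C> P"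

locale additive_category = linear_category R \<C>
  for R :: "('r, 'q) ring_scheme" and \<C> :: "('r, 'o, 'm, 'z) lincat_scheme" +
  assumes ex_zero_object: "\<exists>Z. zero_object \<C> Z"
    and ex_biproduct:
      "\<lbrakk>A \<in> obj \<C>; A' \<in> obj \<C>\<rbrakk> \<Longrightarrow> \<exists>P i i' p p'. biproduct \<C> A A' P i i' p p'"

text \<open>
  \<open>Fm X X' Y Y' f g\<close> is the map \<open>F f g : F X Y \<rightarrow> F X' Y'\<close> induced by \<open>f : X' \<rightarrow> X\<close> and
  \<open>g : Y \<rightarrow> Y'\<close>, so \<open>F\<close> is contravariant in its first and covariant in its second argument.
\<close>

type_synonym ('r, 'o, 'a) bimod = "'o \<Rightarrow> 'o \<Rightarrow> ('r, 'a) module"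
type_synonym ('o, 'm, 'a) biact = "'o \<Rightarrow> 'o \<Rightarrow> 'o \<Rightarrow> 'o \<Rightarrow> 'm \<Rightarrow> 'm \<Rightarrow> 'a \<Rightarrow> 'a"

locale bilinear_functor = linear_category R \<C>
  for R :: "('r, 'q) ring_scheme" and \<C> :: "('r, 'o, 'm, 'z) lincat_scheme" +
  fixes F :: "('r, 'o, 'a) bimod" and Fm :: "('o, 'm, 'a) biact"
  assumes F_module: "\<lbrakk>X \<in> obj \<C>; Y \<in> obj \<C>\<rbrakk> \<Longrightarrow> module R (F X Y)"
    and Fm_linear:
      "\<lbrakk>X \<in> obj \<C>; X' \<in> obj \<C>; Y \<in> obj \<C>; Y' \<in> obj \<C>; f \<in> mor \<C> X' X; g \<in> mor \<C> Y Y'\<rbrakk>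
        \<Longrightarrow> Fm X X' Y Y' f g \<in> linear_maps R (F X Y) (F X' Y')"
    and Fm_idn:
      "\<lbrakk>X \<in> obj \<C>; Y \<in> obj \<C>; u \<in> carrier (F X Y)\<rbrakk>
        \<Longrightarrow> Fm X X Y Y (idn \<C> X) (idn \<C> Y) u = u"
    and Fm_cmp:
      "\<lbrakk>X \<in> obj \<C>; X' \<in> obj \<C>; X'' \<in> obj \<C>; Y \<in> obj \<C>; Y' \<in> obj \<C>; Y'' \<in> obj \<C>;
        f \<in> mor \<C> X' X; f' \<in> mor \<C> X'' X'; g \<in> mor \<C> Y Y'; g' \<in> mor \<C> Y' Y'';
        u \<in> carrier (F X Y)\<rbrakk>
        \<Longrightarrow> Fm X X'' Y Y'' (f \<cdot>\<^bsub>\<C>\<^esub> f') (g' \<cdot>\<^bsub>\<C>\<^esub> g) u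
            = Fm X' X'' Y' Y'' f' g' (Fm X X' Y Y' f g u)"
    and Fm_bilinear_left:
      "\<lbrakk>X \<in> obj \<C>; X' \<in> obj \<C>; Y \<in> obj \<C>; Y' \<in> obj \<C>; g \<in> mor \<C> Y Y'; u \<in> carrier (F X Y)\<rbrakk>
        \<Longrightarrow> (\<lambda>f. Fm X X' Y Y' f g u) \<in> linear_maps R (Hom \<C> X' X) (F X' Y')"
    and Fm_bilinear_right:
      "\<lbrakk>X \<in> obj \<C>; X' \<in> obj \<C>; Y \<in> obj \<C>; Y' \<in> obj \<C>; f \<in> mor \<C> X' X; u \<in> carrier (F X Y)\<rbrakk>
        \<Longrightarrow> (\<lambda>g. Fm X X' Y Y' f g u) \<in> linear_maps R (Hom \<C> Y Y') (F X' Y')"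

definition cov :: "('r, 'o, 'm, 'z) lincat_scheme \<Rightarrow> ('o, 'm, 'a) biact
    \<Rightarrow> 'o \<Rightarrow> 'o \<Rightarrow> 'o \<Rightarrow> 'm \<Rightarrow> 'a \<Rightarrow> 'a" where
  "cov \<C> Fm X Y Y' g = Fm X X Y Y' (idn \<C> X) g"

definition contrav :: "('r, 'o, 'm, 'z) lincat_scheme \<Rightarrow> ('o, 'm, 'a) biact
    \<Rightarrow> 'o \<Rightarrow> 'o \<Rightarrow> 'o \<Rightarrow> 'm \<Rightarrow> 'a \<Rightarrow> 'a" where
  "contrav \<C> Fm Y X X' f = Fm X X' Y Y f (idn \<C> Y)"

definition Hom_act :: "('r, 'o, 'm, 'z) lincat_scheme \<Rightarrow> ('o, 'm, 'm) biact" where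
  "Hom_act \<C> X X' Y Y' f g = (\<lambda>h. g \<cdot>\<^bsub>\<C>\<^esub> h \<cdot>\<^bsub>\<C>\<^esub> f)"


section \<open>Extriangulated categories\<close>

text \<open>
  \<open>Ext \<C> C A\<close> is \<open>\<bbbE>(C, A)\<close>.  \<open>realize \<C> C A \<delta>\<close> is the equivalence class of sequences
  \<open>A \<rightarrow> B \<rightarrow> C\<close> assigned to \<open>\<delta> \<in> \<bbbE>(C, A)\<close>, as a set of triples \<open>(B, x, y)\<close>.
\<close>

record ('r, 'o, 'm, 'e) excat = "('r, 'o, 'm) lincat" +
  Ext :: "('r, 'o, 'e) bimod"
  ext_map :: "('o, 'm, 'e) biact"
  realize :: "'o \<Rightarrow> 'o \<Rightarrow> 'e \<Rightarrow> ('o \<times> 'm \<times> 'm) set"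

definition push :: "('r, 'o, 'm, 'e, 'z) excat_scheme \<Rightarrow> 'o \<Rightarrow> 'o \<Rightarrow> 'o \<Rightarrow> 'm \<Rightarrow> 'e \<Rightarrow> 'e" where
  "push \<C> C A A' a \<delta> = cov \<C> (ext_map \<C>) C A A' a \<delta>"

definition pull :: "('r, 'o, 'm, 'e, 'z) excat_scheme \<Rightarrow> 'o \<Rightarrow> 'o \<Rightarrow> 'o \<Rightarrow> 'm \<Rightarrow> 'e \<Rightarrow> 'e" where
  "pull \<C> A C C' c \<delta> = contrav \<C> (ext_map \<C>) A C C' c \<delta>"

definition ext_morphism :: "('r, 'o, 'm, 'e, 'z) excat_scheme
    \<Rightarrow> 'o \<Rightarrow> 'o \<Rightarrow> 'e \<Rightarrow> 'o \<Rightarrow> 'o \<Rightarrow> 'e \<Rightarrow> 'm \<Rightarrow> 'm \<Rightarrow> bool" where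
  "ext_morphism \<C> C A \<delta> C' A' \<delta>' a c \<longleftrightarrow>
     A \<in> obj \<C> \<and> C \<in> obj \<C> \<and> A' \<in> obj \<C> \<and> C' \<in> obj \<C> \<and>
     \<delta> \<in> carrier (Ext \<C> C A) \<and> \<delta>' \<in> carrier (Ext \<C> C' A') \<and>
     a \<in> mor \<C> A A' \<and> c \<in> mor \<C> C C' \<and> push \<C> C A A' a \<delta> = pull \<C> A' C' C c \<delta>'"

definition is_iso :: "('r, 'o, 'm, 'z) lincat_scheme \<Rightarrow> 'o \<Rightarrow> 'o \<Rightarrow> 'm \<Rightarrow> bool" where
  "is_iso \<C> B B' b \<longleftrightarrow> b \<in> mor \<C> B B' \<and>
     (\<exists>b'\<in>mor \<C> B' B. b' \<cdot>\<^bsub>\<C>\<^esub> b = idn \<C> B \<and> b \<cdot>\<^bsub>\<C>\<^esub> b' = idn \<C> B')"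

definition is_seq ::
    "('r, 'o, 'm, 'z) lincat_scheme \<Rightarrow> 'o \<Rightarrow> 'o \<Rightarrow> 'o \<Rightarrow> 'm \<Rightarrow> 'm \<Rightarrow> bool" where
  "is_seq \<C> A B C x y \<longleftrightarrow>
     A \<in> obj \<C> \<and> B \<in> obj \<C> \<and> C \<in> obj \<C> \<and> x \<in> mor \<C> A B \<and> y \<in> mor \<C> B C"

definition seq_class ::
    "('r, 'o, 'm, 'z) lincat_scheme \<Rightarrow> 'o \<Rightarrow> 'o \<Rightarrow> 'o \<Rightarrow> 'm \<Rightarrow> 'm \<Rightarrow> ('o \<times> 'm \<times> 'm) set" where
  "seq_class \<C> A B C x y = {(B', x', y'). is_seq \<C> A B' C x' y' \<and>
     (\<exists>b. is_iso \<C> B B' b \<and> b \<cdot>\<^bsub>\<C>\<^esub> x = x' \<and> y' \<cdot>\<^bsub>\<C>\<^esub> b = y)}"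

definition s_triangle :: "('r, 'o, 'm, 'e, 'z) excat_scheme
    \<Rightarrow> 'o \<Rightarrow> 'o \<Rightarrow> 'o \<Rightarrow> 'm \<Rightarrow> 'm \<Rightarrow> 'e \<Rightarrow> bool" where
  "s_triangle \<C> A B C x y \<delta> \<longleftrightarrow> is_seq \<C> A B C x y \<and> \<delta> \<in> carrier (Ext \<C> C A) \<and>
     realize \<C> C A \<delta> = seq_class \<C> A B C x y"

text \<open>
  \<open>ext_sum\<close> says that \<open>\<epsilon> \<in> \<bbbE>(Q, P)\<close> is \<open>\<delta> \<oplus> \<delta>'\<close>, where \<open>P = A \<oplus> A'\<close> has injections \<open>i, i'\<close>
  and projections \<open>p, p'\<close>, and \<open>Q = C \<oplus> C'\<close> has injections \<open>j, j'\<close> and projections \<open>q, q'\<close>.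
\<close>

definition ext_sum :: "('r, 'o, 'm, 'e, 'z) excat_scheme
    \<Rightarrow> 'o \<Rightarrow> 'o \<Rightarrow> 'e \<Rightarrow> 'o \<Rightarrow> 'o \<Rightarrow> 'e
    \<Rightarrow> 'o \<Rightarrow> 'm \<Rightarrow> 'm \<Rightarrow> 'o \<Rightarrow> 'm \<Rightarrow> 'm \<Rightarrow> 'e \<Rightarrow> bool" where
  "ext_sum \<C> C A \<delta> C' A' \<delta>' P p p' Q j j' \<epsilon> \<longleftrightarrow>
     \<epsilon> \<in> carrier (Ext \<C> Q P) \<and>
     ext_map \<C> Q C P A j p \<epsilon> = \<delta> \<and>
     ext_map \<C> Q C' P A' j' p' \<epsilon> = \<delta>' \<and>
     ext_map \<C> Q C' P A j' p \<epsilon> = \<zero>\<^bsub>Ext \<C> C' A\<^esub> \<and>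
     ext_map \<C> Q C P A' j p' \<epsilon> = \<zero>\<^bsub>Ext \<C> C A'\<^esub>"

locale additive_realization =
  additive_category R \<C> + bilinear_functor R \<C> "Ext \<C>" "ext_map \<C>"
  for R :: "('r, 'q) ring_scheme" and \<C> :: "('r, 'o, 'm, 'e, 'z) excat_scheme" +
  assumes realized:
      "\<lbrakk>A \<in> obj \<C>; C \<in> obj \<C>; \<delta> \<in> carrier (Ext \<C> C A)\<rbrakk> \<Longrightarrow> \<exists>B x y. s_triangle \<C> A B C x y \<delta>"
    and realize_morphism:
      "\<lbrakk>s_triangle \<C> A B C x y \<delta>; s_triangle \<C> A' B' C' x' y' \<delta>';
        ext_morphism \<C> C A \<delta> C' A' \<delta>' a c\<rbrakk>
        \<Longrightarrow> \<exists>b\<in>mor \<C> B B'. b \<cdot>\<^bsub>\<C>\<^esub> x = x' \<cdot>\<^bsub>\<C>\<^esub> a \<and> y' \<cdot>\<^bsub>\<C>\<^esub> b = c \<cdot>\<^bsub>\<C>\<^esub> y"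
    and realize_zero:
      "biproduct \<C> A C P i j p q \<Longrightarrow> s_triangle \<C> A P C i q \<zero>\<^bsub>Ext \<C> C A\<^esub>"
    and realize_sum:
      "\<lbrakk>s_triangle \<C> A B C x y \<delta>; s_triangle \<C> A' B' C' x' y' \<delta>';
        biproduct \<C> A A' P i i' p p'; biproduct \<C> C C' Q j j' q q'; biproduct \<C> B B' S k k' r r';
        ext_sum \<C> C A \<delta> C' A' \<delta>' P p p' Q j j' \<epsilon>\<rbrakk>
        \<Longrightarrow> s_triangle \<C> P S Q
              (k \<cdot>\<^bsub>\<C>\<^esub> x \<cdot>\<^bsub>\<C>\<^esub> p \<oplus>\<^bsub>Hom \<C> P S\<^esub> k' \<cdot>\<^bsub>\<C>\<^esub> x' \<cdot>\<^bsub>\<C>\<^esub> p')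
              (j \<cdot>\<^bsub>\<C>\<^esub> y \<cdot>\<^bsub>\<C>\<^esub> r \<oplus>\<^bsub>Hom \<C> S Q\<^esub> j' \<cdot>\<^bsub>\<C>\<^esub> y' \<cdot>\<^bsub>\<C>\<^esub> r') \<epsilon>"

locale extriangulated_category = additive_realization R \<C>
  for R :: "('r, 'q) ring_scheme" and \<C> :: "('r, 'o, 'm, 'e, 'z) excat_scheme" +
  assumes ET3:
      "\<lbrakk>s_triangle \<C> A B C x y \<delta>; s_triangle \<C> A' B' C' x' y' \<delta>';
        a \<in> mor \<C> A A'; b \<in> mor \<C> B B'; b \<cdot>\<^bsub>\<C>\<^esub> x = x' \<cdot>\<^bsub>\<C>\<^esub> a\<rbrakk>
        \<Longrightarrow> \<exists>c. ext_morphism \<C> C A \<delta> C' A' \<delta>' a c \<and> c \<cdot>\<^bsub>\<C>\<^esub> y = y' \<cdot>\<^bsub>\<C>\<^esub> b"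
    and ET3_op:
      "\<lbrakk>s_triangle \<C> A B C x y \<delta>; s_triangle \<C> A' B' C' x' y' \<delta>';
        b \<in> mor \<C> B B'; c \<in> mor \<C> C C'; c \<cdot>\<^bsub>\<C>\<^esub> y = y' \<cdot>\<^bsub>\<C>\<^esub> b\<rbrakk>
        \<Longrightarrow> \<exists>a. ext_morphism \<C> C A \<delta> C' A' \<delta>' a c \<and> b \<cdot>\<^bsub>\<C>\<^esub> x = x' \<cdot>\<^bsub>\<C>\<^esub> a"
    and ET4:
      "\<lbrakk>s_triangle \<C> A B D f f' \<delta>; s_triangle \<C> B C F g g' \<delta>'\<rbrakk>
        \<Longrightarrow> \<exists>E d e h' \<delta>''.
              s_triangle \<C> A C E (g \<cdot>\<^bsub>\<C>\<^esub> f) h' \<delta>'' \<and>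
              s_triangle \<C> D E F d e (push \<C> F B D f' \<delta>') \<and>
              h' \<cdot>\<^bsub>\<C>\<^esub> g = d \<cdot>\<^bsub>\<C>\<^esub> f' \<and> e \<cdot>\<^bsub>\<C>\<^esub> h' = g' \<and>
              pull \<C> A E D d \<delta>'' = \<delta> \<and>
              push \<C> E A B f \<delta>'' = pull \<C> B F E e \<delta>'"
    and ET4_op:
      "\<lbrakk>s_triangle \<C> D B A f' f \<delta>; s_triangle \<C> F C B g' g \<delta>'\<rbrakk>
        \<Longrightarrow> \<exists>E d e h' \<delta>''.
              s_triangle \<C> E C A h' (f \<cdot>\<^bsub>\<C>\<^esub> g) \<delta>'' \<and>
              s_triangle \<C> F E D e d (pull \<C> F B D f' \<delta>') \<and>
              g \<cdot>\<^bsub>\<C>\<^esub> h' = f' \<cdot>\<^bsub>\<C>\<^esub> d \<and> h' \<cdot>\<^bsub>\<C>\<^esub> e = g' \<and>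
              push \<C> A E D d \<delta>'' = \<delta> \<and>
              pull \<C> E A B f \<delta>'' = push \<C> B F E e \<delta>'"

definition inflation :: "('r, 'o, 'm, 'e, 'z) excat_scheme \<Rightarrow> 'o \<Rightarrow> 'o \<Rightarrow> 'm \<Rightarrow> bool" where
  "inflation \<C> A B x \<longleftrightarrow> (\<exists>C y \<delta>. s_triangle \<C> A B C x y \<delta>)"

definition injective_morphism ::
    "('r, 'o, 'm, 'e, 'z) excat_scheme \<Rightarrow> 'o \<Rightarrow> 'o \<Rightarrow> 'm \<Rightarrow> bool" where
  "injective_morphism \<C> A I f \<longleftrightarrow> f \<in> mor \<C> A I \<and>
     (\<forall>X\<in>obj \<C>. \<forall>\<delta>\<in>carrier (Ext \<C> X A). push \<C> X A I f \<delta> = \<zero>\<^bsub>Ext \<C> X I\<^esub>)"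

definition enough_injective_morphisms :: "('r, 'o, 'm, 'e, 'z) excat_scheme \<Rightarrow> bool" where
  "enough_injective_morphisms \<C> \<longleftrightarrow>
     (\<forall>A\<in>obj \<C>. \<exists>I\<in>obj \<C>. \<exists>f. inflation \<C> A I f \<and> injective_morphism \<C> A I f)"


section \<open>Coends\<close>

text \<open>
  For a contravariant functor \<open>P\<close> and a covariant functor \<open>Q\<close> with values in \<open>R\<close>-modules,
  the coend \<open>\<integral>\<^sup>M P M \<otimes>\<^sub>R Q M\<close> is the free module on the triples \<open>(M, u, v)\<close> with
  \<open>u \<in> P M\<close>, \<open>v \<in> Q M\<close>, modulo bilinearity of \<open>\<otimes>\<^sub>R\<close> (on which \<open>\<Oplus>\<^sub>M P M \<otimes>\<^sub>R Q M\<close> rests) and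
  \<open>f\<^sup>* u \<otimes> v = u \<otimes> f\<^sub>* v\<close> for \<open>f : M \<rightarrow> M'\<close>, \<open>u \<in> P M'\<close>, \<open>v \<in> Q M\<close>.  Here
  \<open>Pm M' M f : P M' \<rightarrow> P M\<close> and \<open>Qm M M' f : Q M \<rightarrow> Q M'\<close>.
\<close>

definition coend_gens :: "('r, 'o, 'm, 'z) lincat_scheme
    \<Rightarrow> ('o \<Rightarrow> ('r, 'a) module) \<Rightarrow> ('o \<Rightarrow> ('r, 'b) module) \<Rightarrow> ('o \<times> 'a \<times> 'b) set" where
  "coend_gens \<C> P Q = {(M, u, v). M \<in> obj \<C> \<and> u \<in> carrier (P M) \<and> v \<in> carrier (Q M)}"

definition coend_free :: "('r, 'q) ring_scheme \<Rightarrow> ('r, 'o, 'm, 'z) lincat_scheme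
    \<Rightarrow> ('o \<Rightarrow> ('r, 'a) module) \<Rightarrow> ('o \<Rightarrow> ('r, 'b) module)
    \<Rightarrow> ('r, 'o \<times> 'a \<times> 'b \<Rightarrow> 'r) module" where
  "coend_free R \<C> P Q = free_module R (coend_gens \<C> P Q)"

definition coend_rels :: "('r, 'q) ring_scheme \<Rightarrow> ('r, 'o, 'm, 'z) lincat_scheme
    \<Rightarrow> ('o \<Rightarrow> ('r, 'a) module) \<Rightarrow> ('o \<Rightarrow> 'o \<Rightarrow> 'm \<Rightarrow> 'a \<Rightarrow> 'a)
    \<Rightarrow> ('o \<Rightarrow> ('r, 'b) module) \<Rightarrow> ('o \<Rightarrow> 'o \<Rightarrow> 'm \<Rightarrow> 'b \<Rightarrow> 'b)
    \<Rightarrow> ('o \<times> 'a \<times> 'b \<Rightarrow> 'r) set" where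
  "coend_rels R \<C> P Pm Q Qm = (let L = coend_free R \<C> P Q; b = basis_elt R in
     {b (M, u \<oplus>\<^bsub>P M\<^esub> u', v) \<ominus>\<^bsub>L\<^esub> (b (M, u, v) \<oplus>\<^bsub>L\<^esub> b (M, u', v)) | M u u' v.
        M \<in> obj \<C> \<and> u \<in> carrier (P M) \<and> u' \<in> carrier (P M) \<and> v \<in> carrier (Q M)} \<union>
     {b (M, u, v \<oplus>\<^bsub>Q M\<^esub> v') \<ominus>\<^bsub>L\<^esub> (b (M, u, v) \<oplus>\<^bsub>L\<^esub> b (M, u, v')) | M u v v'.
        M \<in> obj \<C> \<and> u \<in> carrier (P M) \<and> v \<in> carrier (Q M) \<and> v' \<in> carrier (Q M)} \<union>
     {b (M, k \<odot>\<^bsub>P M\<^esub> u, v) \<ominus>\<^bsub>L\<^esub> k \<odot>\<^bsub>L\<^esub> b (M, u, v) | M k u v.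
        M \<in> obj \<C> \<and> k \<in> carrier R \<and> u \<in> carrier (P M) \<and> v \<in> carrier (Q M)} \<union>
     {b (M, u, k \<odot>\<^bsub>Q M\<^esub> v) \<ominus>\<^bsub>L\<^esub> k \<odot>\<^bsub>L\<^esub> b (M, u, v) | M k u v.
        M \<in> obj \<C> \<and> k \<in> carrier R \<and> u \<in> carrier (P M) \<and> v \<in> carrier (Q M)} \<union>
     {b (M, Pm M' M f u, v) \<ominus>\<^bsub>L\<^esub> b (M', u, Qm M M' f v) | M M' f u v.
        M \<in> obj \<C> \<and> M' \<in> obj \<C> \<and> f \<in> mor \<C> M M' \<and> u \<in> carrier (P M') \<and> v \<in> carrier (Q M)})"

definition coend_null :: "('r, 'q) ring_scheme \<Rightarrow> ('r, 'o, 'm, 'z) lincat_scheme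
    \<Rightarrow> ('o \<Rightarrow> ('r, 'a) module) \<Rightarrow> ('o \<Rightarrow> 'o \<Rightarrow> 'm \<Rightarrow> 'a \<Rightarrow> 'a)
    \<Rightarrow> ('o \<Rightarrow> ('r, 'b) module) \<Rightarrow> ('o \<Rightarrow> 'o \<Rightarrow> 'm \<Rightarrow> 'b \<Rightarrow> 'b)
    \<Rightarrow> ('o \<times> 'a \<times> 'b \<Rightarrow> 'r) set" where
  "coend_null R \<C> P Pm Q Qm =
     submodule_generated R (coend_free R \<C> P Q) (coend_rels R \<C> P Pm Q Qm)"

definition coend :: "('r, 'q) ring_scheme \<Rightarrow> ('r, 'o, 'm, 'z) lincat_scheme
    \<Rightarrow> ('o \<Rightarrow> ('r, 'a) module) \<Rightarrow> ('o \<Rightarrow> 'o \<Rightarrow> 'm \<Rightarrow> 'a \<Rightarrow> 'a)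
    \<Rightarrow> ('o \<Rightarrow> ('r, 'b) module) \<Rightarrow> ('o \<Rightarrow> 'o \<Rightarrow> 'm \<Rightarrow> 'b \<Rightarrow> 'b)
    \<Rightarrow> ('r, ('o \<times> 'a \<times> 'b \<Rightarrow> 'r) set) module" where
  "coend R \<C> P Pm Q Qm = quotient_module (coend_free R \<C> P Q) (coend_null R \<C> P Pm Q Qm)"


section \<open>Positive extensions\<close>

text \<open>
  The modules \<open>\<bbbE>\<^sup>n(X, Y)\<close> must have elements of one type for all \<open>n\<close>, whereas the elements of a coend
  are cosets of formal sums whose generators involve elements of \<open>\<bbbE>\<^sup>n\<^sup>-\<^sup>1\<close>.  So each coset is named
  by the graph of a chosen representative (a finitely supported function), which is injective on
  cosets, and the module structure is transported along this naming.
\<close>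

datatype ('r, 'o, 'm, 'e) xelt =
    XHom (un_XHom: 'm)
  | XExt (un_XExt: 'e)
  | XSum "(('o \<times> ('r, 'o, 'm, 'e) xelt \<times> 'e) \<times> 'r) fset"

definition coset_name :: "('r, 'q) ring_scheme
    \<Rightarrow> ('o \<times> ('r, 'o, 'm, 'e) xelt \<times> 'e \<Rightarrow> 'r) set \<Rightarrow> ('r, 'o, 'm, 'e) xelt" where
  "coset_name R K =
     (let \<phi> = (SOME \<phi>. \<phi> \<in> K) in XSum (Abs_fset {(g, \<phi> g) | g. \<phi> g \<noteq> \<zero>\<^bsub>R\<^esub>}))"

text \<open>
  For a bifunctor \<open>F\<close> (meant to be \<open>\<bbbE>\<^sup>n\<close>), \<open>step_coend\<close> is \<open>\<integral>\<^sup>M F M Y \<otimes>\<^sub>R \<bbbE>(X, M)\<close>, and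
  \<open>step_coend_map h\<close> is the map between two such coends that is induced by a map \<open>h\<close> on the generators
  \<open>(M, u, v)\<close>: the union defining it consists of a single coset whenever \<open>h\<close> respects the relations.
\<close>

definition step_null :: "('r, 'q) ring_scheme \<Rightarrow> ('r, 'o, 'm, 'e, 'z) excat_scheme
    \<Rightarrow> ('r, 'o, 'a) bimod \<Rightarrow> ('o, 'm, 'a) biact \<Rightarrow> 'o \<Rightarrow> 'o \<Rightarrow> ('o \<times> 'a \<times> 'e \<Rightarrow> 'r) set" where
  "step_null R \<C> F Fm X Y =
     coend_null R \<C> (\<lambda>M. F M Y) (contrav \<C> Fm Y) (\<lambda>M. Ext \<C> X M) (cov \<C> (ext_map \<C>) X)"

definition step_free :: "('r, 'q) ring_scheme \<Rightarrow> ('r, 'o, 'm, 'e, 'z) excat_scheme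
    \<Rightarrow> ('r, 'o, 'a) bimod \<Rightarrow> 'o \<Rightarrow> 'o \<Rightarrow> ('r, 'o \<times> 'a \<times> 'e \<Rightarrow> 'r) module" where
  "step_free R \<C> F X Y = coend_free R \<C> (\<lambda>M. F M Y) (\<lambda>M. Ext \<C> X M)"

definition step_coend :: "('r, 'q) ring_scheme \<Rightarrow> ('r, 'o, 'm, 'e, 'z) excat_scheme
    \<Rightarrow> ('r, 'o, 'a) bimod \<Rightarrow> ('o, 'm, 'a) biact \<Rightarrow> ('r, 'o, ('o \<times> 'a \<times> 'e \<Rightarrow> 'r) set) bimod" where
  "step_coend R \<C> F Fm X Y =
     coend R \<C> (\<lambda>M. F M Y) (contrav \<C> Fm Y) (\<lambda>M. Ext \<C> X M) (cov \<C> (ext_map \<C>) X)"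

definition step_tensor :: "('r, 'q) ring_scheme \<Rightarrow> ('r, 'o, 'm, 'e, 'z) excat_scheme
    \<Rightarrow> ('r, 'o, 'a) bimod \<Rightarrow> ('o, 'm, 'a) biact \<Rightarrow> 'o \<Rightarrow> 'o
    \<Rightarrow> 'o \<times> 'a \<times> 'e \<Rightarrow> ('o \<times> 'a \<times> 'e \<Rightarrow> 'r) set" where
  "step_tensor R \<C> F Fm X Y g =
     step_null R \<C> F Fm X Y +>\<^bsub>step_free R \<C> F X Y\<^esub> basis_elt R g"

definition step_coend_map :: "('r, 'q) ring_scheme \<Rightarrow> ('r, 'o, 'm, 'e, 'z) excat_scheme
    \<Rightarrow> ('r, 'o, 'a) bimod \<Rightarrow> ('o, 'm, 'a) biact \<Rightarrow> 'o \<Rightarrow> 'o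
    \<Rightarrow> ('o \<times> 'a \<times> 'e \<Rightarrow> 'o \<times> 'a \<times> 'e)
    \<Rightarrow> ('o \<times> 'a \<times> 'e \<Rightarrow> 'r) set \<Rightarrow> ('o \<times> 'a \<times> 'e \<Rightarrow> 'r) set" where
  "step_coend_map R \<C> F Fm X' Y' h K =
     (\<Union>\<phi>\<in>K. step_null R \<C> F Fm X' Y' +>\<^bsub>step_free R \<C> F X' Y'\<^esub> free_map R h \<phi>)"

text \<open>\<open>PExt R \<C> n X Y\<close> is \<open>\<bbbE>\<^sup>n(X, Y)\<close> and \<open>PExt_act R \<C> n\<close> its functorial action.\<close>

fun PExt :: "('r, 'q) ring_scheme \<Rightarrow> ('r, 'o, 'm, 'e, 'z) excat_scheme \<Rightarrow> nat
    \<Rightarrow> ('r, 'o, ('r, 'o, 'm, 'e) xelt) bimod"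
and PExt_act :: "('r, 'q) ring_scheme \<Rightarrow> ('r, 'o, 'm, 'e, 'z) excat_scheme \<Rightarrow> nat
    \<Rightarrow> ('o, 'm, ('r, 'o, 'm, 'e) xelt) biact" where
  "PExt R \<C> 0 = (\<lambda>X Y. transport XHom (Hom \<C> X Y))"
| "PExt R \<C> (Suc 0) = (\<lambda>X Y. transport XExt (Ext \<C> X Y))"
| "PExt R \<C> (Suc (Suc n)) = (\<lambda>X Y.
     transport (coset_name R) (step_coend R \<C> (PExt R \<C> (Suc n)) (PExt_act R \<C> (Suc n)) X Y))"
| "PExt_act R \<C> 0 = (\<lambda>X X' Y Y' f g u. XHom (Hom_act \<C> X X' Y Y' f g (un_XHom u)))"
| "PExt_act R \<C> (Suc 0) = (\<lambda>X X' Y Y' f g u. XExt (ext_map \<C> X X' Y Y' f g (un_XExt u)))"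
| "PExt_act R \<C> (Suc (Suc n)) = (\<lambda>X X' Y Y' f g w.
     let F = PExt R \<C> (Suc n); Fm = PExt_act R \<C> (Suc n) in
     coset_name R (step_coend_map R \<C> F Fm X' Y'
       (\<lambda>(M, u, v). (M, cov \<C> Fm M Y Y' g u, contrav \<C> (ext_map \<C>) M X X' f v))
       (inv_into (carrier (step_coend R \<C> F Fm X Y)) (coset_name R) w)))"

text \<open>
  \<open>cup R \<C> s t X M Y \<rho> \<lambda>\<close> is \<open>\<rho> \<union> \<lambda> \<in> \<bbbE>\<^sup>s\<^sup>+\<^sup>t(X, Y)\<close> for \<open>\<rho> \<in> \<bbbE>\<^sup>s(M, Y)\<close> and \<open>\<lambda> \<in> \<bbbE>\<^sup>t(X, M)\<close>, where
  \<open>\<bbbE>\<^sup>s\<^sup>+\<^sup>t(X, Y) \<cong> \<integral>\<^sup>M \<bbbE>\<^sup>s(M, Y) \<otimes>\<^sub>R \<bbbE>\<^sup>t(X, M)\<close> is given by the (co-)Yoneda isomorphisms when \<open>s = 0\<close> or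
  \<open>t = 0\<close> and by associativity of the coend tensor product otherwise:
  \<open>\<rho> \<union> f = f\<^sup>* \<rho>\<close>, \<open>g \<union> \<delta> = g\<^sub>* \<delta>\<close>, \<open>\<rho> \<union> \<delta> = [\<rho> \<otimes> \<delta>]\<close> and \<open>\<rho> \<union> [u \<otimes> v] = [(\<rho> \<union> u) \<otimes> v]\<close>.
\<close>

fun cup :: "('r, 'q) ring_scheme \<Rightarrow> ('r, 'o, 'm, 'e, 'z) excat_scheme \<Rightarrow> nat \<Rightarrow> nat
    \<Rightarrow> 'o \<Rightarrow> 'o \<Rightarrow> 'o
    \<Rightarrow> ('r, 'o, 'm, 'e) xelt \<Rightarrow> ('r, 'o, 'm, 'e) xelt \<Rightarrow> ('r, 'o, 'm, 'e) xelt" where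
  "cup R \<C> s 0 X M Y \<rho> l = contrav \<C> (PExt_act R \<C> s) Y M X (un_XHom l) \<rho>"
| "cup R \<C> 0 (Suc 0) X M Y \<rho> l = cov \<C> (PExt_act R \<C> 1) X M Y (un_XHom \<rho>) l"
| "cup R \<C> (Suc s) (Suc 0) X M Y \<rho> l =
     coset_name R (step_tensor R \<C> (PExt R \<C> (Suc s)) (PExt_act R \<C> (Suc s)) X Y
       (M, \<rho>, un_XExt l))"
| "cup R \<C> s (Suc (Suc t)) X M Y \<rho> l =
     (let F = PExt R \<C> (Suc t); Fm = PExt_act R \<C> (Suc t);
          G = PExt R \<C> (s + Suc t); Gm = PExt_act R \<C> (s + Suc t) in
      coset_name R (step_coend_map R \<C> G Gm X Y
        (\<lambda>(N, u, v). (N, cup R \<C> s (Suc t) N M Y \<rho> u, v))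
        (inv_into (carrier (step_coend R \<C> F Fm X M)) (coset_name R) l)))"

text \<open>
  For \<open>\<delta> \<in> \<bbbE>(C, A)\<close>, \<open>delta_lower R \<C> n C A \<delta> X\<close> is \<open>\<delta>\<^sub>\<sharp> : \<bbbE>\<^sup>n(X, C) \<rightarrow> \<bbbE>\<^sup>n\<^sup>+\<^sup>1(X, A)\<close> and
  \<open>delta_upper R \<C> n C A \<delta> Y\<close> is \<open>\<delta>\<^sup>\<sharp> : \<bbbE>\<^sup>n(A, Y) \<rightarrow> \<bbbE>\<^sup>n\<^sup>+\<^sup>1(C, Y)\<close>.
\<close>

definition delta_lower :: "('r, 'q) ring_scheme \<Rightarrow> ('r, 'o, 'm, 'e, 'z) excat_scheme \<Rightarrow> nat
    \<Rightarrow> 'o \<Rightarrow> 'o \<Rightarrow> 'e \<Rightarrow> 'o \<Rightarrow> ('r, 'o, 'm, 'e) xelt \<Rightarrow> ('r, 'o, 'm, 'e) xelt" where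
  "delta_lower R \<C> n C A \<delta> X l = cup R \<C> 1 n X C A (XExt \<delta>) l"

definition delta_upper :: "('r, 'q) ring_scheme \<Rightarrow> ('r, 'o, 'm, 'e, 'z) excat_scheme \<Rightarrow> nat
    \<Rightarrow> 'o \<Rightarrow> 'o \<Rightarrow> 'e \<Rightarrow> 'o \<Rightarrow> ('r, 'o, 'm, 'e) xelt \<Rightarrow> ('r, 'o, 'm, 'e) xelt" where
  "delta_upper R \<C> n C A \<delta> Y l = cup R \<C> n 1 C A Y l (XExt \<delta>)"


section \<open>Negative extensions\<close>

text \<open>
  The module \<open>(Mod \<C>)(P, Q)\<close> of natural transformations between contravariant linear functors.
  Components are extensional functions, so that equal transformations are equal as functions.
\<close>

definition nat_trans_module :: "('r, 'q) ring_scheme \<Rightarrow> ('r, 'o, 'm, 'z) lincat_scheme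
    \<Rightarrow> ('o \<Rightarrow> ('r, 'a) module) \<Rightarrow> ('o \<Rightarrow> 'o \<Rightarrow> 'm \<Rightarrow> 'a \<Rightarrow> 'a)
    \<Rightarrow> ('o \<Rightarrow> ('r, 'b) module) \<Rightarrow> ('o \<Rightarrow> 'o \<Rightarrow> 'm \<Rightarrow> 'b \<Rightarrow> 'b)
    \<Rightarrow> ('r, 'o \<Rightarrow> 'a \<Rightarrow> 'b) module" where
  "nat_trans_module R \<C> P Pm Q Qm =
    \<lparr>carrier = {\<tau> \<in> (\<Pi>\<^sub>E W\<in>obj \<C>. linear_maps R (P W) (Q W) \<inter> extensional (carrier (P W))).
       \<forall>W\<in>obj \<C>. \<forall>W'\<in>obj \<C>. \<forall>f\<in>mor \<C> W' W. \<forall>u\<in>carrier (P W).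
         \<tau> W' (Pm W W' f u) = Qm W W' f (\<tau> W u)},
     mult = undefined, one = undefined,
     zero = (\<lambda>W\<in>obj \<C>. \<lambda>u\<in>carrier (P W). \<zero>\<^bsub>Q W\<^esub>),
     add = (\<lambda>\<sigma> \<tau>. \<lambda>W\<in>obj \<C>. \<lambda>u\<in>carrier (P W). \<sigma> W u \<oplus>\<^bsub>Q W\<^esub> \<tau> W u),
     smult = (\<lambda>r \<tau>. \<lambda>W\<in>obj \<C>. \<lambda>u\<in>carrier (P W). r \<odot>\<^bsub>Q W\<^esub> \<tau> W u)\<rparr>"

text \<open>\<open>NExt R \<C> n X Y\<close> is \<open>(Mod \<C>)(\<bbbE>\<^sup>n(-, X), \<C>(-, Y))\<close>.\<close>

definition NExt :: "('r, 'q) ring_scheme \<Rightarrow> ('r, 'o, 'm, 'e, 'z) excat_scheme \<Rightarrow> nat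
    \<Rightarrow> ('r, 'o, 'o \<Rightarrow> ('r, 'o, 'm, 'e) xelt \<Rightarrow> 'm) bimod" where
  "NExt R \<C> n X Y = nat_trans_module R \<C>
     (\<lambda>W. PExt R \<C> n W X) (contrav \<C> (PExt_act R \<C> n) X)
     (\<lambda>W. Hom \<C> W Y) (contrav \<C> (Hom_act \<C>) Y)"

definition NExt_act :: "('r, 'q) ring_scheme \<Rightarrow> ('r, 'o, 'm, 'e, 'z) excat_scheme \<Rightarrow> nat
    \<Rightarrow> ('o, 'm, 'o \<Rightarrow> ('r, 'o, 'm, 'e) xelt \<Rightarrow> 'm) biact" where
  "NExt_act R \<C> n X X' Y Y' f g \<tau> = (\<lambda>W\<in>obj \<C>. \<lambda>u\<in>carrier (PExt R \<C> n W X').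
     g \<cdot>\<^bsub>\<C>\<^esub> \<tau> W (cov \<C> (PExt_act R \<C> n) W X' X f u))"

text \<open>
  \<open>EII R \<C> k X Y\<close> is \<open>\<bbbE>\<^sub>I\<^sub>I\<^sup>k(X, Y)\<close> for \<open>k \<in> \<int>\<close>.  In degree \<open>0\<close> it is \<open>(Mod \<C>)(\<C>(-, X), \<C>(-, Y))\<close>; the
  Yoneda isomorphism \<open>\<tau> \<mapsto> \<tau>\<^sub>X(id\<^sub>X)\<close> to \<open>\<C>(X, Y) = \<bbbE>\<^sup>0(X, Y)\<close> is applied in the connecting map from
  degree \<open>0\<close> to degree \<open>1\<close>.
\<close>

type_synonym ('r, 'o, 'm, 'e) eii_elt =
  "('r, 'o, 'm, 'e) xelt + ('o \<Rightarrow> ('r, 'o, 'm, 'e) xelt \<Rightarrow> 'm)"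

definition EII :: "('r, 'q) ring_scheme \<Rightarrow> ('r, 'o, 'm, 'e, 'z) excat_scheme \<Rightarrow> int
    \<Rightarrow> ('r, 'o, ('r, 'o, 'm, 'e) eii_elt) bimod" where
  "EII R \<C> k X Y =
     (if k > 0 then transport Inl (PExt R \<C> (nat k) X Y)
      else transport Inr (NExt R \<C> (nat (- k)) X Y))"

definition EII_act :: "('r, 'q) ring_scheme \<Rightarrow> ('r, 'o, 'm, 'e, 'z) excat_scheme \<Rightarrow> int
    \<Rightarrow> ('o, 'm, ('r, 'o, 'm, 'e) eii_elt) biact" where
  "EII_act R \<C> k X X' Y Y' f g w =
     (if k > 0 then Inl (PExt_act R \<C> (nat k) X X' Y Y' f g (projl w))
      else Inr (NExt_act R \<C> (nat (- k)) X X' Y Y' f g (projr w)))"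

definition yoneda :: "('r, 'o, 'm, 'e, 'z) excat_scheme \<Rightarrow> 'o
    \<Rightarrow> ('o \<Rightarrow> ('r, 'o, 'm, 'e) xelt \<Rightarrow> 'm) \<Rightarrow> ('r, 'o, 'm, 'e) xelt" where
  "yoneda \<C> X \<tau> = XHom (\<tau> X (XHom (idn \<C> X)))"

text \<open>
  For \<open>\<delta> \<in> \<bbbE>(C, A)\<close>, \<open>EII_delta R \<C> k C A \<delta> Y\<close> is \<open>\<delta>\<^sup>\<sharp> : \<bbbE>\<^sub>I\<^sub>I\<^sup>k(A, Y) \<rightarrow> \<bbbE>\<^sub>I\<^sub>I\<^sup>k\<^sup>+\<^sup>1(C, Y)\<close>.
\<close>

definition EII_delta :: "('r, 'q) ring_scheme \<Rightarrow> ('r, 'o, 'm, 'e, 'z) excat_scheme \<Rightarrow> int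
    \<Rightarrow> 'o \<Rightarrow> 'o \<Rightarrow> 'e \<Rightarrow> 'o \<Rightarrow> ('r, 'o, 'm, 'e) eii_elt \<Rightarrow> ('r, 'o, 'm, 'e) eii_elt" where
  "EII_delta R \<C> k C A \<delta> Y w =
     (if k > 0 then Inl (delta_upper R \<C> (nat k) C A \<delta> Y (projl w))
      else if k = 0 then Inl (delta_upper R \<C> 0 C A \<delta> Y (yoneda \<C> A (projr w)))
      else let n = nat (- (k + 1)) in
        Inr (\<lambda>W\<in>obj \<C>. \<lambda>u\<in>carrier (PExt R \<C> n W C). projr w W (delta_lower R \<C> n C A \<delta> W u)))"


section \<open>Delta-functors\<close>

text \<open>
  \<open>F k X Y\<close> is read as the value at \<open>Y\<close> of \<open>F\<^sup>k(X, -) \<in> \<C> Mod\<close>, and \<open>conn k C A \<delta> Y\<close> as the component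
  at \<open>Y\<close> of \<open>\<delta>\<^sup>\<sharp> : F\<^sup>k(A, -) \<rightarrow> F\<^sup>k\<^sup>+\<^sup>1(C, -)\<close>.  Exactness in the functor category \<open>\<C> Mod\<close> is
  exactness at every object \<open>Y\<close>.
\<close>

locale contravariant_connected_sequence = linear_category R \<C>
  for R :: "('r, 'q) ring_scheme" and \<C> :: "('r, 'o, 'm, 'e, 'z) excat_scheme" +
  fixes F :: "int \<Rightarrow> ('r, 'o, 'a) bimod" and Fm :: "int \<Rightarrow> ('o, 'm, 'a) biact"
    and conn :: "int \<Rightarrow> 'o \<Rightarrow> 'o \<Rightarrow> 'e \<Rightarrow> 'o \<Rightarrow> 'a \<Rightarrow> 'a"
  assumes F_bilinear_functor: "bilinear_functor R \<C> (F k) (Fm k)"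
    and conn_linear:
      "\<lbrakk>A \<in> obj \<C>; C \<in> obj \<C>; \<delta> \<in> carrier (Ext \<C> C A); Y \<in> obj \<C>\<rbrakk>
        \<Longrightarrow> conn k C A \<delta> Y \<in> linear_maps R (F k A Y) (F (k + 1) C Y)"
    and conn_natural:
      "\<lbrakk>A \<in> obj \<C>; C \<in> obj \<C>; \<delta> \<in> carrier (Ext \<C> C A);
        Y \<in> obj \<C>; Y' \<in> obj \<C>; g \<in> mor \<C> Y Y'; u \<in> carrier (F k A Y)\<rbrakk>
        \<Longrightarrow> conn k C A \<delta> Y' (cov \<C> (Fm k) A Y Y' g u)
            = cov \<C> (Fm (k + 1)) C Y Y' g (conn k C A \<delta> Y u)"
    and conn_ext_morphism:
      "\<lbrakk>ext_morphism \<C> C A \<delta> C' A' \<delta>' a c; Y \<in> obj \<C>; u \<in> carrier (F k A' Y)\<rbrakk>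
        \<Longrightarrow> conn k C A \<delta> Y (contrav \<C> (Fm k) Y A' A a u)
            = contrav \<C> (Fm (k + 1)) Y C' C c (conn k C' A' \<delta>' Y u)"

locale contravariant_delta_functor = contravariant_connected_sequence R \<C> F Fm conn
  for R :: "('r, 'q) ring_scheme" and \<C> :: "('r, 'o, 'm, 'e, 'z) excat_scheme"
    and F :: "int \<Rightarrow> ('r, 'o, 'a) bimod" and Fm :: "int \<Rightarrow> ('o, 'm, 'a) biact"
    and conn :: "int \<Rightarrow> 'o \<Rightarrow> 'o \<Rightarrow> 'e \<Rightarrow> 'o \<Rightarrow> 'a \<Rightarrow> 'a" +
  assumes exact_middle:
      "\<lbrakk>s_triangle \<C> A B C x y \<delta>; Y \<in> obj \<C>\<rbrakk>
        \<Longrightarrow> exact_at (F k C Y) (F k B Y) (F k A Y)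
              (contrav \<C> (Fm k) Y C B y) (contrav \<C> (Fm k) Y B A x)"
    and exact_left:
      "\<lbrakk>s_triangle \<C> A B C x y \<delta>; Y \<in> obj \<C>\<rbrakk>
        \<Longrightarrow> exact_at (F k B Y) (F k A Y) (F (k + 1) C Y)
              (contrav \<C> (Fm k) Y B A x) (conn k C A \<delta> Y)"
    and exact_right:
      "\<lbrakk>s_triangle \<C> A B C x y \<delta>; Y \<in> obj \<C>\<rbrakk>
        \<Longrightarrow> exact_at (F k A Y) (F (k + 1) C Y) (F (k + 1) B Y)
              (conn k C A \<delta> Y) (contrav \<C> (Fm (k + 1)) Y C B y)"

end

theory Submission
  imports Defs
begin

text \<open>
  The proof is dimension shifting along injective inflations.  Let \<open>A \<rightarrow> J \<rightarrow> B\<close> be a triangle with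
  extension \<open>\<epsilon>\<close> whose inflation \<open>A \<rightarrow> J\<close> is an injective morphism.  Then
  \<open>\<bbbE>\<^sup>n(-, J) \<rightarrow> \<bbbE>\<^sup>n(-, B) \<rightarrow> \<bbbE>\<^sup>n\<^sup>+\<^sup>1(-, A) \<rightarrow> 0\<close> is exact for all \<open>n \<ge> 0\<close>: this is elementary for \<open>n = 0\<close>, and it
  propagates because coends are right exact (\<open>inj_dl_surj\<close>, \<open>inj_dl_kernel\<close>).  Applying the left exact
  functor of natural transformations to \<open>\<C>(-, Y)\<close> presents \<open>\<bbbE>\<^sub>I\<^sub>I(A, Y)\<close> in degree \<open>-(n + 1)\<close> as the
  kernel of \<open>\<bbbE>\<^sub>I\<^sub>I(B, Y) \<rightarrow> \<bbbE>\<^sub>I\<^sub>I(J, Y)\<close> in degree \<open>-n\<close> (\<open>nconn_inj\<close>, \<open>nconn_lift\<close>).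

  For a triangle \<open>A \<rightarrow> B \<rightarrow> C\<close> and an injective inflation \<open>B \<rightarrow> J\<close> with cone \<open>B'\<close>, the axiom (ET4) shows
  that \<open>A \<rightarrow> J\<close> is an injective inflation as well, and that its cone \<open>D\<close> fits into a triangle
  \<open>C \<rightarrow> D \<rightarrow> B'\<close> (\<open>rotation\<close>).  So an exactness statement about \<open>A \<rightarrow> B \<rightarrow> C\<close> in one degree becomes a
  statement about \<open>C \<rightarrow> D \<rightarrow> B'\<close> one degree closer to zero.  Three diagram chases use this principle
  or the shift itself:

  \<^item> \<open>cov_exact\<close>, the long exact sequence of \<open>\<bbbE>\<^sup>n(X, -)\<close>.  Its role is the consequence that \<open>\<bbbE>\<^sup>n(-, J) \<rightarrow> \<bbbE>\<^sup>n(-, B)\<close> is injective for \<open>n > 0\<close> (\<open>inj_cov_injective\<close>), as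
    \<open>\<bbbE>\<^sup>n(-, A) \<rightarrow> \<bbbE>\<^sup>n(-, J)\<close> is zero.
  \<^item> \<open>con_exact\<close>, the long exact sequence of \<open>\<bbbE>\<^sup>n(-, Y)\<close>, by shifting the second argument \<open>Y\<close>.
  \<^item> \<open>shift_right\<close>, \<open>shift_left\<close> and \<open>shift_middle\<close>, which carry exactness of a connected sequence of
    functors from degree \<open>k + 1\<close> down to degree \<open>k\<close>, given the description of degree \<open>k\<close> as a kernel.

  The induction starts in degree zero, where exactness follows from (ET3) and its dual by comparison
  with the triangles \<open>0 \<rightarrow> X \<rightarrow> X\<close> and \<open>X \<rightarrow> X \<rightarrow> 0\<close>.  The first half of the text provides what makes
  the chases possible: the universal property of the coend, from which the functoriality of
  \<open>\<bbbE>\<^sup>n\<close> and the interplay of \<open>\<delta>\<^sub>\<sharp>\<close> and \<open>\<delta>\<^sup>\<sharp>\<close> follow by checking them on generators.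
\<close>

section \<open>Linear maps, quotients and free modules\<close>

context cring
begin

lemma module_abelian_group: "module R M \<Longrightarrow> abelian_group M"
  by (rule module.axioms(2))

lemma mzero_closed: "module R M \<Longrightarrow> \<zero>\<^bsub>M\<^esub> \<in> carrier M"
  by (meson abelian_monoid.zero_closed abelian_group.axioms(1) module_abelian_group)

lemma madd_closed: "\<lbrakk>module R M; u \<in> carrier M; v \<in> carrier M\<rbrakk> \<Longrightarrow> u \<oplus>\<^bsub>M\<^esub> v \<in> carrier M"
  by (meson abelian_monoid.a_closed abelian_group.axioms(1) module_abelian_group)

lemma mminus_closed: "\<lbrakk>module R M; u \<in> carrier M; v \<in> carrier M\<rbrakk> \<Longrightarrow> u \<ominus>\<^bsub>M\<^esub> v \<in> carrier M"
  by (meson abelian_group.minus_closed module_abelian_group)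

lemma mneg_closed: "\<lbrakk>module R M; u \<in> carrier M\<rbrakk> \<Longrightarrow> \<ominus>\<^bsub>M\<^esub> u \<in> carrier M"
  by (meson abelian_group.a_inv_closed module_abelian_group)

lemma msmult_closed: "\<lbrakk>module R M; r \<in> carrier R; u \<in> carrier M\<rbrakk> \<Longrightarrow> r \<odot>\<^bsub>M\<^esub> u \<in> carrier M"
  by (rule module.smult_closed)

lemma mminus_eq_zero:
  "\<lbrakk>module R M; u \<in> carrier M; v \<in> carrier M\<rbrakk> \<Longrightarrow> u \<ominus>\<^bsub>M\<^esub> v = \<zero>\<^bsub>M\<^esub> \<longleftrightarrow> u = v"
  by (metis abelian_group.r_neg abelian_group.minus_equality abelian_group.minus_minus
      abelian_group.a_inv_closed module_abelian_group a_minus_def)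

lemma mminus_self: "\<lbrakk>module R M; u \<in> carrier M\<rbrakk> \<Longrightarrow> u \<ominus>\<^bsub>M\<^esub> u = \<zero>\<^bsub>M\<^esub>"
  by (simp add: mminus_eq_zero)

lemma mminus_add_cancel:
  assumes "module R M" "u \<in> carrier M" "v \<in> carrier M"
  shows "(u \<ominus>\<^bsub>M\<^esub> v) \<oplus>\<^bsub>M\<^esub> v = u"
proof -
  interpret M: abelian_group M by (rule module_abelian_group) fact
  show ?thesis using assms(2-) by (simp add: a_minus_def M.a_assoc M.l_neg)
qed

lemma mminus_zero:
  assumes "module R M" "u \<in> carrier M"
  shows "u \<ominus>\<^bsub>M\<^esub> \<zero>\<^bsub>M\<^esub> = u"
proof -
  interpret M: abelian_group M by (rule module_abelian_group) fact
  show ?thesis using assms(2-) by (simp add: a_minus_def)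
qed

lemma madd_zero:
  assumes "module R M" "u \<in> carrier M"
  shows "u \<oplus>\<^bsub>M\<^esub> \<zero>\<^bsub>M\<^esub> = u" "\<zero>\<^bsub>M\<^esub> \<oplus>\<^bsub>M\<^esub> u = u"
proof -
  interpret M: abelian_group M by (rule module_abelian_group) fact
  show "u \<oplus>\<^bsub>M\<^esub> \<zero>\<^bsub>M\<^esub> = u" "\<zero>\<^bsub>M\<^esub> \<oplus>\<^bsub>M\<^esub> u = u" using assms(2-) by simp_all
qed

lemma linearI:
  assumes "\<And>u. u \<in> carrier M \<Longrightarrow> f u \<in> carrier N"
    and "\<And>u v. \<lbrakk>u \<in> carrier M; v \<in> carrier M\<rbrakk> \<Longrightarrow> f (u \<oplus>\<^bsub>M\<^esub> v) = f u \<oplus>\<^bsub>N\<^esub> f v"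
    and "\<And>r u. \<lbrakk>r \<in> carrier R; u \<in> carrier M\<rbrakk> \<Longrightarrow> f (r \<odot>\<^bsub>M\<^esub> u) = r \<odot>\<^bsub>N\<^esub> f u"
  shows "f \<in> linear_maps R M N"
  using assms by (auto simp: linear_maps_def)

lemma linear_closed: "\<lbrakk>f \<in> linear_maps R M N; u \<in> carrier M\<rbrakk> \<Longrightarrow> f u \<in> carrier N"
  by (auto simp: linear_maps_def)

lemma linear_add:
  "\<lbrakk>f \<in> linear_maps R M N; u \<in> carrier M; v \<in> carrier M\<rbrakk> \<Longrightarrow> f (u \<oplus>\<^bsub>M\<^esub> v) = f u \<oplus>\<^bsub>N\<^esub> f v"
  by (auto simp: linear_maps_def)

lemma linear_smult:
  "\<lbrakk>f \<in> linear_maps R M N; r \<in> carrier R; u \<in> carrier M\<rbrakk> \<Longrightarrow> f (r \<odot>\<^bsub>M\<^esub> u) = r \<odot>\<^bsub>N\<^esub> f u"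
  by (auto simp: linear_maps_def)

lemma linear_zero:
  assumes "module R M" "module R N" "f \<in> linear_maps R M N"
  shows "f \<zero>\<^bsub>M\<^esub> = \<zero>\<^bsub>N\<^esub>"
proof -
  interpret M: module R M by fact
  interpret N: module R N by fact
  have "f (\<zero> \<odot>\<^bsub>M\<^esub> \<zero>\<^bsub>M\<^esub>) = \<zero> \<odot>\<^bsub>N\<^esub> f \<zero>\<^bsub>M\<^esub>"
    by (rule linear_smult[OF assms(3)]) auto
  then show ?thesis using linear_closed[OF assms(3), of "\<zero>\<^bsub>M\<^esub>"] by simp
qed

lemma linear_neg:
  assumes "module R M" "module R N" "f \<in> linear_maps R M N" "u \<in> carrier M"
  shows "f (\<ominus>\<^bsub>M\<^esub> u) = \<ominus>\<^bsub>N\<^esub> f u"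
proof -
  interpret M: module R M by fact
  interpret N: module R N by fact
  have "f ((\<ominus> \<one>) \<odot>\<^bsub>M\<^esub> u) = (\<ominus> \<one>) \<odot>\<^bsub>N\<^esub> f u"
    by (rule linear_smult[OF assms(3)]) (auto simp: assms)
  then show ?thesis
    using assms(4) linear_closed[OF assms(3)] by (simp add: M.smult_l_minus N.smult_l_minus)
qed

lemma linear_minus:
  assumes "module R M" "module R N" "f \<in> linear_maps R M N" "u \<in> carrier M" "v \<in> carrier M"
  shows "f (u \<ominus>\<^bsub>M\<^esub> v) = f u \<ominus>\<^bsub>N\<^esub> f v"
  unfolding a_minus_def using assms
  by (simp add: linear_add linear_neg mneg_closed)

lemma linear_minus_eq_zero:
  assumes "module R M" "module R N" "f \<in> linear_maps R M N" "u \<in> carrier M" "v \<in> carrier M" "f u = f v"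
  shows "f (u \<ominus>\<^bsub>M\<^esub> v) = \<zero>\<^bsub>N\<^esub>"
  using linear_minus[OF assms(1-5)] assms(6) mminus_self[OF assms(2) linear_closed[OF assms(3,5)]] by simp

lemma linear_zero_map: "module R N \<Longrightarrow> (\<lambda>u. \<zero>\<^bsub>N\<^esub>) \<in> linear_maps R M N"
  by (intro linearI) (simp_all add: mzero_closed madd_zero module.smult_r_null)

lemma linear_comp:
  "\<lbrakk>f \<in> linear_maps R L M; g \<in> linear_maps R M N\<rbrakk> \<Longrightarrow> (\<lambda>u. g (f u)) \<in> linear_maps R L N"
  by (auto simp: linear_maps_def Pi_iff)

lemma linear_cong:
  assumes "f \<in> linear_maps R M N" "module R M" "\<And>u. u \<in> carrier M \<Longrightarrow> g u = f u"
  shows "g \<in> linear_maps R M N"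
  using assms(1,3) assms(2)
  by (auto simp: linear_maps_def Pi_iff madd_closed msmult_closed)

lemma linear_kernel_submodule:
  assumes "module R M" "module R N" "f \<in> linear_maps R M N"
  shows "submodule {u \<in> carrier M. f u = \<zero>\<^bsub>N\<^esub>} R M"
proof -
  interpret M: module R M by fact
  interpret N: module R N by fact
  show ?thesis
    by (rule M.submoduleI)
      (auto simp: linear_zero[OF assms] linear_neg[OF assms] linear_add[OF assms(3)]
        linear_smult[OF assms(3)])
qed

lemma linear_image_submodule:
  assumes "module R M" "module R N" "f \<in> linear_maps R M N"
  shows "submodule (f ` carrier M) R N"
proof -
  interpret M: module R M by fact
  interpret N: module R N by fact
  show ?thesis
  proof (rule N.submoduleI)
    show "f ` carrier M \<subseteq> carrier N" using linear_closed[OF assms(3)] by auto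
    show "\<zero>\<^bsub>N\<^esub> \<in> f ` carrier M" using linear_zero[OF assms] M.zero_closed by (metis imageI)
    show "\<ominus>\<^bsub>N\<^esub> a \<in> f ` carrier M" if "a \<in> f ` carrier M" for a
      using that linear_neg[OF assms] by (metis (no_types, lifting) M.a_inv_closed imageE imageI)
    show "a \<oplus>\<^bsub>N\<^esub> b \<in> f ` carrier M" if "a \<in> f ` carrier M" "b \<in> f ` carrier M" for a b
      using that linear_add[OF assms(3)] by (metis (no_types, lifting) M.a_closed imageE imageI)
    show "a \<odot>\<^bsub>N\<^esub> b \<in> f ` carrier M" if "a \<in> carrier R" "b \<in> f ` carrier M" for a b
      using that linear_smult[OF assms(3)] by (metis (no_types, lifting) M.smult_closed imageE imageI)
  qed
qed

lemma a_kernel_eq: "a_kernel M N f = {u \<in> carrier M. f u = \<zero>\<^bsub>N\<^esub>}"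
  by (simp add: a_kernel_def')

lemma exact_atI:
  assumes "\<And>u. u \<in> carrier L \<Longrightarrow> f u \<in> carrier M"
    and "\<And>u. u \<in> carrier L \<Longrightarrow> g (f u) = \<zero>\<^bsub>N\<^esub>"
    and "\<And>v. \<lbrakk>v \<in> carrier M; g v = \<zero>\<^bsub>N\<^esub>\<rbrakk> \<Longrightarrow> \<exists>u\<in>carrier L. f u = v"
  shows "exact_at L M N f g"
  using assms unfolding exact_at_def a_kernel_eq by blast

subsection \<open>Transport of structure\<close>

lemma transport_simps:
  assumes "inj_on h (carrier M)"
  shows "carrier (transport h M) = h ` carrier M"
    and "\<zero>\<^bsub>transport h M\<^esub> = h \<zero>\<^bsub>M\<^esub>"
    and "\<lbrakk>u \<in> carrier M; v \<in> carrier M\<rbrakk> \<Longrightarrow> h u \<oplus>\<^bsub>transport h M\<^esub> h v = h (u \<oplus>\<^bsub>M\<^esub> v)"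
    and "u \<in> carrier M \<Longrightarrow> r \<odot>\<^bsub>transport h M\<^esub> h u = h (r \<odot>\<^bsub>M\<^esub> u)"
  using assms by (simp_all add: transport_def inv_into_f_f)

lemma transport_module:
  assumes "module R M" "inj_on h (carrier M)"
  shows "module R (transport h M)"
proof -
  interpret M: module R M by fact
  note s = transport_simps[OF assms(2)]
  show ?thesis
  proof (rule moduleI)
    show "cring R" by unfold_locales
    show "abelian_group (transport h M)"
    proof (rule abelian_groupI)
      fix x assume "x \<in> carrier (transport h M)"
      then obtain u where "u \<in> carrier M" "x = h u" by (auto simp: s)
      then show "\<exists>y\<in>carrier (transport h M). y \<oplus>\<^bsub>transport h M\<^esub> x = \<zero>\<^bsub>transport h M\<^esub>"
        by (intro bexI[of _ "h (\<ominus>\<^bsub>M\<^esub> u)"]) (auto simp: s M.l_neg)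
    qed (auto simp: s M.a_ac)
  qed (auto simp: s M.smult_l_distr M.smult_r_distr M.smult_assoc1)
qed

lemma transport_linear:
  assumes "inj_on h (carrier M)"
  shows "h \<in> linear_maps R M (transport h M)"
  using transport_simps[OF assms] by (intro linearI) auto

lemma transport_inv_linear:
  assumes "module R M" "inj_on h (carrier M)"
  shows "inv_into (carrier M) h \<in> linear_maps R (transport h M) M"
  using assms
  by (intro linearI)
    (auto simp: transport_simps[OF assms(2)] inv_into_f_f madd_closed msmult_closed)


subsection \<open>Quotient modules\<close>

lemma submodule_abelian_subgroup:
  assumes "module R M" "submodule H R M"
  shows "abelian_subgroup H M"
  using assms by (intro abelian_subgroupI3) (auto simp: additive_subgroup_def submodule_def
      intro: module_abelian_group)

lemma quotient_simps:
  assumes "module R M" "submodule H R M"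
  shows "carrier (quotient_module M H) = (\<lambda>u. H +>\<^bsub>M\<^esub> u) ` carrier M"
    and "\<zero>\<^bsub>quotient_module M H\<^esub> = H +>\<^bsub>M\<^esub> \<zero>\<^bsub>M\<^esub>"
    and "\<lbrakk>u \<in> carrier M; v \<in> carrier M\<rbrakk>
      \<Longrightarrow> (H +>\<^bsub>M\<^esub> u) \<oplus>\<^bsub>quotient_module M H\<^esub> (H +>\<^bsub>M\<^esub> v) = H +>\<^bsub>M\<^esub> (u \<oplus>\<^bsub>M\<^esub> v)"
    and "\<lbrakk>r \<in> carrier R; u \<in> carrier M\<rbrakk>
      \<Longrightarrow> r \<odot>\<^bsub>quotient_module M H\<^esub> (H +>\<^bsub>M\<^esub> u) = H +>\<^bsub>M\<^esub> (r \<odot>\<^bsub>M\<^esub> u)"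
    and "\<lbrakk>u \<in> carrier M; v \<in> carrier M\<rbrakk> \<Longrightarrow> H +>\<^bsub>M\<^esub> u = H +>\<^bsub>M\<^esub> v \<longleftrightarrow> u \<ominus>\<^bsub>M\<^esub> v \<in> H"
    and "u \<in> carrier M \<Longrightarrow> u \<in> H +>\<^bsub>M\<^esub> u"
    and "u \<in> carrier M \<Longrightarrow> H +>\<^bsub>M\<^esub> u \<subseteq> carrier M"
proof -
  interpret M: module R M by fact
  interpret H: abelian_subgroup H M by (rule submodule_abelian_subgroup[OF assms])
  interpret S: submodule H R M by fact
  show "carrier (quotient_module M H) = (\<lambda>u. H +>\<^bsub>M\<^esub> u) ` carrier M"
    by (auto simp: quotient_module_def A_RCOSETS_def')
  show "\<zero>\<^bsub>quotient_module M H\<^esub> = H +>\<^bsub>M\<^esub> \<zero>\<^bsub>M\<^esub>"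
    by (simp add: quotient_module_def H.a_subset)
  show "(H +>\<^bsub>M\<^esub> u) \<oplus>\<^bsub>quotient_module M H\<^esub> (H +>\<^bsub>M\<^esub> v) = H +>\<^bsub>M\<^esub> (u \<oplus>\<^bsub>M\<^esub> v)"
    if "u \<in> carrier M" "v \<in> carrier M"
    using that by (simp add: quotient_module_def H.a_rcos_sum)
  show self: "u \<in> H +>\<^bsub>M\<^esub> u" if "u \<in> carrier M" for u
    using that by (rule H.a_rcos_self)
  show sub: "H +>\<^bsub>M\<^esub> u \<subseteq> carrier M" if "u \<in> carrier M" for u
    using that by (rule M.a_r_coset_subset_G[OF H.a_subset])
  show eq: "H +>\<^bsub>M\<^esub> u = H +>\<^bsub>M\<^esub> v \<longleftrightarrow> u \<ominus>\<^bsub>M\<^esub> v \<in> H"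
    if "u \<in> carrier M" "v \<in> carrier M" for u v
  proof -
    have "H +>\<^bsub>M\<^esub> u = H +>\<^bsub>M\<^esub> v \<longleftrightarrow> u \<in> H +>\<^bsub>M\<^esub> v"
      using self[OF that(1)] M.a_repr_independence[OF _ that(2) H.a_subgroup, of u] by metis
    then show ?thesis using H.a_rcos_module[OF that(2,1)] by (simp add: a_minus_def)
  qed
  show "r \<odot>\<^bsub>quotient_module M H\<^esub> (H +>\<^bsub>M\<^esub> u) = H +>\<^bsub>M\<^esub> (r \<odot>\<^bsub>M\<^esub> u)"
    if r: "r \<in> carrier R" and u: "u \<in> carrier M"
  proof -
    have "H +>\<^bsub>M\<^esub> (r \<odot>\<^bsub>M\<^esub> k) = H +>\<^bsub>M\<^esub> (r \<odot>\<^bsub>M\<^esub> u)" if k: "k \<in> H +>\<^bsub>M\<^esub> u" for k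
    proof -
      have kc: "k \<in> carrier M" using sub[OF u] k by auto
      have "k \<ominus>\<^bsub>M\<^esub> u \<in> H" using H.a_rcos_module[OF u kc] k by (simp add: a_minus_def)
      then have "r \<odot>\<^bsub>M\<^esub> (k \<ominus>\<^bsub>M\<^esub> u) \<in> H" using r by simp
      then show ?thesis using eq[of "r \<odot>\<^bsub>M\<^esub> k" "r \<odot>\<^bsub>M\<^esub> u"] r u kc
        by (simp add: a_minus_def M.smult_r_distr M.smult_r_minus)
    qed
    then have "(\<Union>k\<in>H +>\<^bsub>M\<^esub> u. H +>\<^bsub>M\<^esub> (r \<odot>\<^bsub>M\<^esub> k)) = (\<Union>k\<in>H +>\<^bsub>M\<^esub> u. H +>\<^bsub>M\<^esub> (r \<odot>\<^bsub>M\<^esub> u))"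
      by (rule SUP_cong[OF refl])
    also have "\<dots> = H +>\<^bsub>M\<^esub> (r \<odot>\<^bsub>M\<^esub> u)"
      using self[OF u] by (metis UN_constant empty_iff)
    finally show ?thesis by (simp add: quotient_module_def)
  qed
qed

lemma quotient_is_module:
  assumes "module R M" "submodule H R M"
  shows "module R (quotient_module M H)"
proof -
  interpret M: module R M by fact
  note s = quotient_simps(1-4)[OF assms]
  show ?thesis
  proof (rule moduleI)
    show "cring R" by unfold_locales
    show "abelian_group (quotient_module M H)"
    proof (rule abelian_groupI)
      fix x assume "x \<in> carrier (quotient_module M H)"
      then obtain u where "u \<in> carrier M" "x = H +>\<^bsub>M\<^esub> u" by (auto simp: s)
      then show "\<exists>y\<in>carrier (quotient_module M H).
          y \<oplus>\<^bsub>quotient_module M H\<^esub> x = \<zero>\<^bsub>quotient_module M H\<^esub>"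
        by (intro bexI[of _ "H +>\<^bsub>M\<^esub> (\<ominus>\<^bsub>M\<^esub> u)"])
          (auto simp: s M.l_neg simp del: M.a_coset_add_zero)
    qed (auto simp: s M.a_ac simp del: M.a_coset_add_zero)
  qed (auto simp: s M.smult_l_distr M.smult_r_distr M.smult_assoc1)
qed

lemma quotient_proj_linear:
  assumes "module R M" "submodule H R M"
  shows "(\<lambda>u. H +>\<^bsub>M\<^esub> u) \<in> linear_maps R M (quotient_module M H)"
  by (intro linearI) (simp_all add: quotient_simps[OF assms])

lemma quotient_proj_zero:
  assumes "module R M" "submodule H R M" "u \<in> carrier M"
  shows "H +>\<^bsub>M\<^esub> u = \<zero>\<^bsub>quotient_module M H\<^esub> \<longleftrightarrow> u \<in> H"
  using quotient_simps(2,5)[OF assms(1,2)] mminus_zero[OF assms(1,3)] mzero_closed[OF assms(1)] assms(3)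
  by simp

lemma quotient_lift:
  assumes M: "module R M" and N: "module R N" and H: "submodule H R M"
    and f: "f \<in> linear_maps R M N" and f0: "\<And>u. u \<in> H \<Longrightarrow> f u = \<zero>\<^bsub>N\<^esub>"
  obtains F where "F \<in> linear_maps R (quotient_module M H) N"
    and "\<And>u. u \<in> carrier M \<Longrightarrow> F (H +>\<^bsub>M\<^esub> u) = f u"
proof
  let ?F = "\<lambda>K. f (SOME u. u \<in> carrier M \<and> K = H +>\<^bsub>M\<^esub> u)"
  show F: "?F (H +>\<^bsub>M\<^esub> u) = f u" if u: "u \<in> carrier M" for u
  proof -
    let ?v = "SOME v. v \<in> carrier M \<and> H +>\<^bsub>M\<^esub> u = H +>\<^bsub>M\<^esub> v"
    have v: "?v \<in> carrier M \<and> H +>\<^bsub>M\<^esub> u = H +>\<^bsub>M\<^esub> ?v" by (rule someI[of _ u]) (simp add: u)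
    then have "u \<ominus>\<^bsub>M\<^esub> ?v \<in> H" using u quotient_simps(5)[OF M H] by blast
    then have "f u \<ominus>\<^bsub>N\<^esub> f ?v = \<zero>\<^bsub>N\<^esub>"
      using f0 linear_minus[OF M N f u conjunct1[OF v]] by simp
    then show ?thesis
      using mminus_eq_zero[OF N linear_closed[OF f u] linear_closed[OF f conjunct1[OF v]]] by simp
  qed
  show "?F \<in> linear_maps R (quotient_module M H) N"
    using F by (intro linearI)
      (auto simp: quotient_simps[OF M H] linear_closed[OF f] linear_add[OF f] linear_smult[OF f]
        madd_closed[OF M] msmult_closed[OF M])
qed


subsection \<open>Free modules\<close>

lemma free_simps:
  "\<phi> \<in> carrier (free_module R S) \<longleftrightarrow>
     \<phi> \<in> S \<rightarrow> carrier R \<and> (\<forall>g. g \<notin> S \<longrightarrow> \<phi> g = \<zero>) \<and> finite {g. \<phi> g \<noteq> \<zero>}"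
  "\<zero>\<^bsub>free_module R S\<^esub> = (\<lambda>g. \<zero>)"
  "\<phi> \<oplus>\<^bsub>free_module R S\<^esub> \<psi> = (\<lambda>g. \<phi> g \<oplus> \<psi> g)"
  "r \<odot>\<^bsub>free_module R S\<^esub> \<phi> = (\<lambda>g. r \<otimes> \<phi> g)"
  by (simp_all add: free_module_def)

lemma free_val: "\<phi> \<in> carrier (free_module R S) \<Longrightarrow> \<phi> g \<in> carrier R"
  by (cases "g \<in> S") (auto simp: free_simps)

lemma free_fin: "\<phi> \<in> carrier (free_module R S) \<Longrightarrow> finite {g. \<phi> g \<noteq> \<zero>}"
  by (auto simp: free_simps)

lemma free_is_module: "module R (free_module R S)"
proof -
  have z: "(\<lambda>g. \<zero>) \<in> carrier (free_module R S)"
    by (simp add: free_simps)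
  have add: "(\<lambda>g. \<phi> g \<oplus> \<psi> g) \<in> carrier (free_module R S)"
    if "\<phi> \<in> carrier (free_module R S)" "\<psi> \<in> carrier (free_module R S)" for \<phi> \<psi>
  proof -
    have "finite {g. \<phi> g \<oplus> \<psi> g \<noteq> \<zero>}"
      by (rule finite_subset[of _ "{g. \<phi> g \<noteq> \<zero>} \<union> {g. \<psi> g \<noteq> \<zero>}"])
        (use that free_fin in auto)
    then show ?thesis using that by (auto simp: free_simps)
  qed
  have sm: "(\<lambda>g. r \<otimes> \<phi> g) \<in> carrier (free_module R S)"
    if "r \<in> carrier R" "\<phi> \<in> carrier (free_module R S)" for r \<phi>
  proof -
    have "finite {g. r \<otimes> \<phi> g \<noteq> \<zero>}"
      by (rule finite_subset[of _ "{g. \<phi> g \<noteq> \<zero>}"]) (use that free_fin in auto)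
    then show ?thesis using that by (auto simp: free_simps)
  qed
  show ?thesis
  proof (rule moduleI)
    show "cring R" by unfold_locales
    show "abelian_group (free_module R S)"
    proof (rule abelian_groupI)
      fix x assume "x \<in> carrier (free_module R S)"
      then show "\<exists>y\<in>carrier (free_module R S). y \<oplus>\<^bsub>free_module R S\<^esub> x = \<zero>\<^bsub>free_module R S\<^esub>"
        using free_val[of x S]
        by (intro bexI[of _ "\<lambda>g. \<ominus> \<one> \<otimes> x g"] sm) (auto simp: free_simps(2,3) l_minus l_neg)
    qed (auto simp: free_simps(2-) z add a_ac free_val)
  qed (auto simp: free_simps(2-) sm free_val l_distr r_distr m_assoc)
qed

lemma basis_closed: "g \<in> S \<Longrightarrow> basis_elt R g \<in> carrier (free_module R S)"
  by (auto simp: free_simps basis_elt_def)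

lemma free_induct [consumes 1, case_names zero add]:
  assumes "\<phi> \<in> carrier (free_module R S)"
    and "Q \<zero>\<^bsub>free_module R S\<^esub>"
    and "\<And>\<phi> g r. \<lbrakk>\<phi> \<in> carrier (free_module R S); g \<in> S; r \<in> carrier R; Q \<phi>\<rbrakk>
      \<Longrightarrow> Q (\<phi> \<oplus>\<^bsub>free_module R S\<^esub> r \<odot>\<^bsub>free_module R S\<^esub> basis_elt R g)"
  shows "Q \<phi>"
proof -
  have "Q \<phi>" if "finite T" "\<phi> \<in> carrier (free_module R S)" "{g. \<phi> g \<noteq> \<zero>} = T" for T \<phi>
    using that
  proof (induction T arbitrary: \<phi> rule: finite_induct)
    case empty
    then have "\<phi> = (\<lambda>g. \<zero>)" by auto
    then show ?case using assms(2) by (simp add: free_simps)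
  next
    case (insert g T)
    let ?\<psi> = "\<phi>(g := \<zero>)"
    have g: "g \<in> S" using insert.prems by (auto simp: free_simps)
    have supp: "{h. ?\<psi> h \<noteq> \<zero>} = T" using insert.prems insert.hyps by auto
    have \<psi>: "?\<psi> \<in> carrier (free_module R S)"
      using insert.prems(1) insert.hyps(1) supp by (auto simp: free_simps)
    have "\<phi> = ?\<psi> \<oplus>\<^bsub>free_module R S\<^esub> \<phi> g \<odot>\<^bsub>free_module R S\<^esub> basis_elt R g"
      using free_val[OF insert.prems(1)] by (auto simp: free_simps basis_elt_def)
    then show ?case
      using assms(3)[OF \<psi> g free_val[OF insert.prems(1)] insert.IH[OF \<psi> supp]] by metis
  qed
  then show ?thesis using assms(1) free_fin by blast
qed

lemma free_linear_eq:
  assumes N: "module R N" and f: "f \<in> linear_maps R (free_module R S) N"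
    and g: "g \<in> linear_maps R (free_module R S) N"
    and eq: "\<And>s. s \<in> S \<Longrightarrow> f (basis_elt R s) = g (basis_elt R s)"
    and \<phi>: "\<phi> \<in> carrier (free_module R S)"
  shows "f \<phi> = g \<phi>"
  using \<phi>
proof (induction rule: free_induct)
  case zero
  show ?case by (simp add: linear_zero[OF free_is_module N f] linear_zero[OF free_is_module N g])
next
  case (add \<phi> s r)
  then show ?case
    by (simp add: linear_add[OF f] linear_add[OF g] linear_smult[OF f] linear_smult[OF g]
        basis_closed msmult_closed[OF free_is_module] eq)
qed


end

section \<open>The universal property of the coend\<close>

definition free_lift ::
    "('r, 'q) ring_scheme \<Rightarrow> ('r, 'b) module \<Rightarrow> ('g \<Rightarrow> 'b) \<Rightarrow> ('g \<Rightarrow> 'r) \<Rightarrow> 'b" where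
  "free_lift R N h \<phi> = (\<Oplus>\<^bsub>N\<^esub> g \<in> {g. \<phi> g \<noteq> \<zero>\<^bsub>R\<^esub>}. \<phi> g \<odot>\<^bsub>N\<^esub> h g)"

context cring
begin

lemma free_lift_superset:
  assumes N: "module R N" and h: "h \<in> S \<rightarrow> carrier N" and \<phi>: "\<phi> \<in> carrier (free_module R S)"
    and T: "finite T" "{g. \<phi> g \<noteq> \<zero>} \<subseteq> T" "T \<subseteq> S"
  shows "free_lift R N h \<phi> = (\<Oplus>\<^bsub>N\<^esub> g \<in> T. \<phi> g \<odot>\<^bsub>N\<^esub> h g)"
proof -
  interpret N: module R N by fact
  have "h g \<in> carrier N" if "g \<in> T" for g using that h T(3) by auto
  then show ?thesis unfolding free_lift_def
    by (intro N.add.finprod_mono_neutral_cong_left[OF T(1,2)]) (auto simp: free_val[OF \<phi>])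
qed

lemma free_supp_subset: "\<phi> \<in> carrier (free_module R S) \<Longrightarrow> {g. \<phi> g \<noteq> \<zero>} \<subseteq> S"
  by (auto simp: free_simps)

lemma free_lift_linear:
  assumes N: "module R N" and h: "h \<in> S \<rightarrow> carrier N"
  shows "free_lift R N h \<in> linear_maps R (free_module R S) N"
proof -
  interpret N: module R N by fact
  interpret L: module R "free_module R S" by (rule free_is_module)
  note sup = free_lift_superset[OF N h]
  have hc: "h g \<in> carrier N" if "g \<in> S" for g using that h by auto
  show ?thesis
  proof (rule linearI)
    fix \<phi> assume \<phi>: "\<phi> \<in> carrier (free_module R S)"
    have "\<phi> g \<odot>\<^bsub>N\<^esub> h g \<in> carrier N" if "\<phi> g \<noteq> \<zero>" for g
      using that free_supp_subset[OF \<phi>] by (auto simp: free_val[OF \<phi>] hc)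
    then show "free_lift R N h \<phi> \<in> carrier N"
      unfolding free_lift_def by (intro N.finsum_closed) auto
  next
    fix \<phi> \<psi> assume \<phi>: "\<phi> \<in> carrier (free_module R S)" and \<psi>: "\<psi> \<in> carrier (free_module R S)"
    let ?s = "\<phi> \<oplus>\<^bsub>free_module R S\<^esub> \<psi>"
    let ?T = "{g. \<phi> g \<noteq> \<zero>} \<union> {g. \<psi> g \<noteq> \<zero>}"
    have T: "finite ?T" "?T \<subseteq> S"
      using free_fin[OF \<phi>] free_fin[OF \<psi>] free_supp_subset[OF \<phi>] free_supp_subset[OF \<psi>] by auto
    have s: "?s \<in> carrier (free_module R S)" using \<phi> \<psi> by simp
    have "free_lift R N h ?s = (\<Oplus>\<^bsub>N\<^esub> g \<in> ?T. ?s g \<odot>\<^bsub>N\<^esub> h g)"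
      by (rule sup[OF s T(1) _ T(2)]) (auto simp: free_simps)
    also have "\<dots> = (\<Oplus>\<^bsub>N\<^esub> g \<in> ?T. \<phi> g \<odot>\<^bsub>N\<^esub> h g \<oplus>\<^bsub>N\<^esub> \<psi> g \<odot>\<^bsub>N\<^esub> h g)"
    proof (rule N.finsum_cong')
      show "(\<lambda>g. \<phi> g \<odot>\<^bsub>N\<^esub> h g \<oplus>\<^bsub>N\<^esub> \<psi> g \<odot>\<^bsub>N\<^esub> h g) \<in> ?T \<rightarrow> carrier N"
        using T(2) by (auto simp: hc free_val[OF \<phi>] free_val[OF \<psi>] subset_iff)
      show "?s g \<odot>\<^bsub>N\<^esub> h g = \<phi> g \<odot>\<^bsub>N\<^esub> h g \<oplus>\<^bsub>N\<^esub> \<psi> g \<odot>\<^bsub>N\<^esub> h g" if "g \<in> ?T" for g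
        using hc[of g] T(2) that
        by (auto simp: free_simps(3) free_val[OF \<phi>] free_val[OF \<psi>] N.smult_l_distr subset_iff)
    qed simp
    also have "\<dots> = (\<Oplus>\<^bsub>N\<^esub> g \<in> ?T. \<phi> g \<odot>\<^bsub>N\<^esub> h g) \<oplus>\<^bsub>N\<^esub> (\<Oplus>\<^bsub>N\<^esub> g \<in> ?T. \<psi> g \<odot>\<^bsub>N\<^esub> h g)"
      by (rule N.finsum_addf) (use T(2) in \<open>auto simp: hc free_val[OF \<phi>] free_val[OF \<psi>] subset_iff\<close>)
    also have "\<dots> = free_lift R N h \<phi> \<oplus>\<^bsub>N\<^esub> free_lift R N h \<psi>"
      using sup[OF \<phi> T(1) _ T(2)] sup[OF \<psi> T(1) _ T(2)] by auto
    finally show "free_lift R N h ?s = free_lift R N h \<phi> \<oplus>\<^bsub>N\<^esub> free_lift R N h \<psi>" .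
  next
    fix r \<phi> assume r: "r \<in> carrier R" and \<phi>: "\<phi> \<in> carrier (free_module R S)"
    let ?s = "r \<odot>\<^bsub>free_module R S\<^esub> \<phi>"
    let ?T = "{g. \<phi> g \<noteq> \<zero>}"
    note T = free_fin[OF \<phi>] free_supp_subset[OF \<phi>]
    have s: "?s \<in> carrier (free_module R S)" using r \<phi> by simp
    have "free_lift R N h ?s = (\<Oplus>\<^bsub>N\<^esub> g \<in> ?T. ?s g \<odot>\<^bsub>N\<^esub> h g)"
      by (rule sup[OF s T(1) _ T(2)]) (auto simp: free_simps r)
    also have "\<dots> = (\<Oplus>\<^bsub>N\<^esub> g \<in> ?T. r \<odot>\<^bsub>N\<^esub> (\<phi> g \<odot>\<^bsub>N\<^esub> h g))"
    proof (rule N.finsum_cong')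
      show "(\<lambda>g. r \<odot>\<^bsub>N\<^esub> (\<phi> g \<odot>\<^bsub>N\<^esub> h g)) \<in> ?T \<rightarrow> carrier N"
        using T(2) r by (auto simp: hc free_val[OF \<phi>] subset_iff)
      show "?s g \<odot>\<^bsub>N\<^esub> h g = r \<odot>\<^bsub>N\<^esub> (\<phi> g \<odot>\<^bsub>N\<^esub> h g)" if "g \<in> ?T" for g
        using hc[of g] T(2) that r
        by (auto simp: free_simps(4) free_val[OF \<phi>] N.smult_assoc1 subset_iff)
    qed simp
    also have "\<dots> = r \<odot>\<^bsub>N\<^esub> free_lift R N h \<phi>"
      unfolding free_lift_def using T hc r
      by (subst N.finsum_smult_ldistr) (auto simp: free_val[OF \<phi>] subset_iff)
    finally show "free_lift R N h ?s = r \<odot>\<^bsub>N\<^esub> free_lift R N h \<phi>" .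
  qed
qed

lemma free_lift_basis:
  assumes N: "module R N" and h: "h \<in> S \<rightarrow> carrier N" and g: "g \<in> S"
  shows "free_lift R N h (basis_elt R g) = h g"
proof -
  interpret N: module R N by fact
  have "free_lift R N h (basis_elt R g) = (\<Oplus>\<^bsub>N\<^esub> x \<in> {g}. basis_elt R g x \<odot>\<^bsub>N\<^esub> h x)"
    by (rule free_lift_superset[OF N h basis_closed[OF g]]) (use g in \<open>auto simp: basis_elt_def\<close>)
  also have "\<dots> = h g"
    using funcset_mem[OF h g] by (subst N.finsum_insert) (auto simp: basis_elt_def)
  finally show ?thesis .
qed

lemma free_finsum_val:
  assumes "finite T" "f \<in> T \<rightarrow> carrier (free_module R S)"
  shows "finsum (free_module R S) f T k = (\<Oplus> g \<in> T. f g k)"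
proof -
  interpret L: module R "free_module R S" by (rule free_is_module)
  show ?thesis using assms
  proof (induction T rule: finite_induct)
    case empty
    show ?case by (simp add: free_simps(2))
  next
    case (insert g T)
    then have "f i k \<in> carrier R" if "i \<in> insert g T" for i
      using that by (intro free_val[of "f i" S]) auto
    with insert show ?case by (simp add: free_simps(3) Pi_iff)
  qed
qed

text \<open>
  This brings the coefficientwise formula for \<^const>\<open>free_map\<close> under the universal property of the
  free module.
\<close>

lemma free_map_eq_lift:
  assumes h: "h \<in> S \<rightarrow> S'" and \<phi>: "\<phi> \<in> carrier (free_module R S)"
  shows "free_map R h \<phi> = free_lift R (free_module R S') (\<lambda>g. basis_elt R (h g)) \<phi>"
proof
  fix k
  interpret L: module R "free_module R S'" by (rule free_is_module)
  let ?T = "{g. \<phi> g \<noteq> \<zero>}"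
  note T = free_fin[OF \<phi>] free_supp_subset[OF \<phi>]
  have b: "basis_elt R (h g) \<in> carrier (free_module R S')" if "g \<in> ?T" for g
    using that T h by (auto intro!: basis_closed)
  have "free_lift R (free_module R S') (\<lambda>g. basis_elt R (h g)) \<phi> k
      = (\<Oplus> g \<in> ?T. (\<phi> g \<odot>\<^bsub>free_module R S'\<^esub> basis_elt R (h g)) k)"
    unfolding free_lift_def by (rule free_finsum_val[OF T(1)]) (use b in \<open>auto simp: free_val[OF \<phi>]\<close>)
  also have "\<dots> = (\<Oplus> g \<in> {g. \<phi> g \<noteq> \<zero> \<and> h g = k}. \<phi> g)"
    by (rule add.finprod_mono_neutral_cong_left[symmetric, OF T(1)])
      (auto simp: free_simps(4) basis_elt_def free_val[OF \<phi>])
  finally show "free_map R h \<phi> k = free_lift R (free_module R S') (\<lambda>g. basis_elt R (h g)) \<phi> k"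
    by (simp add: free_map_def)
qed

lemma free_map_linear:
  assumes "h \<in> S \<rightarrow> S'"
  shows "free_map R h \<in> linear_maps R (free_module R S) (free_module R S')"
proof (rule linear_cong[OF free_lift_linear[OF free_is_module] free_is_module free_map_eq_lift[OF assms]])
  show "(\<lambda>g. basis_elt R (h g)) \<in> S \<rightarrow> carrier (free_module R S')"
    using assms by (auto intro!: basis_closed)
qed

lemma free_map_basis:
  assumes "h \<in> S \<rightarrow> S'" "g \<in> S"
  shows "free_map R h (basis_elt R g) = basis_elt R (h g)"
  unfolding free_map_eq_lift[OF assms(1) basis_closed[OF assms(2)]]
  by (rule free_lift_basis[OF free_is_module _ assms(2)]) (use assms in \<open>auto intro!: basis_closed\<close>)

end

text \<open>
  The maps out of the set of generators that respect the relations of the coend: a dinatural family of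
  bilinear maps \<open>P M \<times> Q M \<rightarrow> N\<close>, written as one function of the triple \<open>(M, u, v)\<close>.
\<close>

locale balanced_map =
  fixes R :: "('r, 'q) ring_scheme" and \<C> :: "('r, 'o, 'm, 'z) lincat_scheme"
    and P :: "'o \<Rightarrow> ('r, 'a) module" and Pm :: "'o \<Rightarrow> 'o \<Rightarrow> 'm \<Rightarrow> 'a \<Rightarrow> 'a"
    and Q :: "'o \<Rightarrow> ('r, 'b) module" and Qm :: "'o \<Rightarrow> 'o \<Rightarrow> 'm \<Rightarrow> 'b \<Rightarrow> 'b"
    and N :: "('r, 'c) module" and h :: "'o \<times> 'a \<times> 'b \<Rightarrow> 'c"
  assumes closed: "\<lbrakk>M \<in> obj \<C>; u \<in> carrier (P M); v \<in> carrier (Q M)\<rbrakk> \<Longrightarrow> h (M, u, v) \<in> carrier N"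
    and add_left: "\<lbrakk>M \<in> obj \<C>; u \<in> carrier (P M); u' \<in> carrier (P M); v \<in> carrier (Q M)\<rbrakk>
      \<Longrightarrow> h (M, u \<oplus>\<^bsub>P M\<^esub> u', v) = h (M, u, v) \<oplus>\<^bsub>N\<^esub> h (M, u', v)"
    and add_right: "\<lbrakk>M \<in> obj \<C>; u \<in> carrier (P M); v \<in> carrier (Q M); v' \<in> carrier (Q M)\<rbrakk>
      \<Longrightarrow> h (M, u, v \<oplus>\<^bsub>Q M\<^esub> v') = h (M, u, v) \<oplus>\<^bsub>N\<^esub> h (M, u, v')"
    and smult_left: "\<lbrakk>M \<in> obj \<C>; r \<in> carrier R; u \<in> carrier (P M); v \<in> carrier (Q M)\<rbrakk>
      \<Longrightarrow> h (M, r \<odot>\<^bsub>P M\<^esub> u, v) = r \<odot>\<^bsub>N\<^esub> h (M, u, v)"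
    and smult_right: "\<lbrakk>M \<in> obj \<C>; r \<in> carrier R; u \<in> carrier (P M); v \<in> carrier (Q M)\<rbrakk>
      \<Longrightarrow> h (M, u, r \<odot>\<^bsub>Q M\<^esub> v) = r \<odot>\<^bsub>N\<^esub> h (M, u, v)"
    and dinatural: "\<lbrakk>M \<in> obj \<C>; M' \<in> obj \<C>; f \<in> mor \<C> M M'; u \<in> carrier (P M'); v \<in> carrier (Q M)\<rbrakk>
      \<Longrightarrow> h (M, Pm M' M f u, v) = h (M', u, Qm M M' f v)"

locale coend_data = linear_category R \<C>
  for R :: "('r, 'q) ring_scheme" and \<C> :: "('r, 'o, 'm, 'z) lincat_scheme" +
  fixes P :: "'o \<Rightarrow> ('r, 'a) module" and Pm :: "'o \<Rightarrow> 'o \<Rightarrow> 'm \<Rightarrow> 'a \<Rightarrow> 'a"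
    and Q :: "'o \<Rightarrow> ('r, 'b) module" and Qm :: "'o \<Rightarrow> 'o \<Rightarrow> 'm \<Rightarrow> 'b \<Rightarrow> 'b"
  assumes P_module: "M \<in> obj \<C> \<Longrightarrow> module R (P M)"
    and Q_module: "M \<in> obj \<C> \<Longrightarrow> module R (Q M)"
    and Pm_closed: "\<lbrakk>M \<in> obj \<C>; M' \<in> obj \<C>; f \<in> mor \<C> M M'; u \<in> carrier (P M')\<rbrakk>
      \<Longrightarrow> Pm M' M f u \<in> carrier (P M)"
    and Qm_closed: "\<lbrakk>M \<in> obj \<C>; M' \<in> obj \<C>; f \<in> mor \<C> M M'; v \<in> carrier (Q M)\<rbrakk>
      \<Longrightarrow> Qm M M' f v \<in> carrier (Q M')"
begin

abbreviation "L \<equiv> coend_free R \<C> P Q"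
abbreviation "Null \<equiv> coend_null R \<C> P Pm Q Qm"
abbreviation "Co \<equiv> coend R \<C> P Pm Q Qm"
abbreviation "bas \<equiv> basis_elt R"
abbreviation "ten g \<equiv> Null +>\<^bsub>L\<^esub> bas g"

lemma L_module: "module R L"
  by (simp add: coend_free_def free_is_module)

lemma L_eq: "L = free_module R (coend_gens \<C> P Q)"
  by (simp add: coend_free_def)

lemma bas_closed:
  "\<lbrakk>M \<in> obj \<C>; u \<in> carrier (P M); v \<in> carrier (Q M)\<rbrakk> \<Longrightarrow> bas (M, u, v) \<in> carrier L"
  unfolding coend_free_def by (rule basis_closed) (simp add: coend_gens_def)

lemmas PQ_closed = madd_closed[OF P_module] madd_closed[OF Q_module] msmult_closed[OF P_module]
  msmult_closed[OF Q_module] madd_closed[OF L_module] msmult_closed[OF L_module]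
  mminus_closed[OF L_module]

lemma rels_closed: "coend_rels R \<C> P Pm Q Qm \<subseteq> carrier L"
  unfolding coend_rels_def Let_def
  by (auto intro!: PQ_closed bas_closed Pm_closed Qm_closed)

lemma Null_submodule: "submodule Null R L"
proof -
  interpret L: module R L by (rule L_module)
  let ?\<N> = "{N. submodule N R L \<and> coend_rels R \<C> P Pm Q Qm \<subseteq> N}"
  have "carrier L \<in> ?\<N>" using L.carrier_is_submodule rels_closed by simp
  then have "\<Inter> ?\<N> \<subseteq> carrier L" by (rule Inter_lower)
  moreover have "\<zero>\<^bsub>L\<^esub> \<in> N" if "submodule N R L" for N
    using subgroup.one_closed[OF submodule.axioms(1)[OF that]] by simp
  ultimately show ?thesis
    unfolding coend_null_def submodule_generated_def
    by (intro L.submoduleI InterI) (auto intro: L.submoduleE(3-5))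
qed

lemma rels_Null: "coend_rels R \<C> P Pm Q Qm \<subseteq> Null"
  by (auto simp: coend_null_def submodule_generated_def)

lemma Co_eq: "Co = quotient_module L Null"
  by (simp add: coend_def)

lemma Co_module: "module R Co"
  unfolding Co_eq by (rule quotient_is_module[OF L_module Null_submodule])

lemma proj_linear: "(\<lambda>\<phi>. Null +>\<^bsub>L\<^esub> \<phi>) \<in> linear_maps R L Co"
  unfolding Co_eq by (rule quotient_proj_linear[OF L_module Null_submodule])

lemma Co_carrier: "carrier Co = (\<lambda>\<phi>. Null +>\<^bsub>L\<^esub> \<phi>) ` carrier L"
  unfolding Co_eq by (rule quotient_simps(1)[OF L_module Null_submodule])

lemma proj_eqI:
  assumes "\<phi> \<in> carrier L" "\<psi> \<in> carrier L" "\<phi> \<ominus>\<^bsub>L\<^esub> \<psi> \<in> coend_rels R \<C> P Pm Q Qm"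
  shows "Null +>\<^bsub>L\<^esub> \<phi> = Null +>\<^bsub>L\<^esub> \<psi>"
  using quotient_simps(5)[OF L_module Null_submodule assms(1,2)] assms(3) rels_Null by blast

lemma ten_closed:
  "\<lbrakk>M \<in> obj \<C>; u \<in> carrier (P M); v \<in> carrier (Q M)\<rbrakk> \<Longrightarrow> ten (M, u, v) \<in> carrier Co"
  by (rule linear_closed[OF proj_linear bas_closed])

lemma ten_balanced: "balanced_map R \<C> P Pm Q Qm Co ten"
proof (rule balanced_map.intro, goal_cases)
  case (1 M u v)
  then show ?case by (rule ten_closed)
next
  case (2 M u u' v)
  then have "ten (M, u \<oplus>\<^bsub>P M\<^esub> u', v) = Null +>\<^bsub>L\<^esub> (bas (M, u, v) \<oplus>\<^bsub>L\<^esub> bas (M, u', v))"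
    by (intro proj_eqI PQ_closed bas_closed) (auto simp: coend_rels_def Let_def)
  then show ?case using 2 by (simp add: linear_add[OF proj_linear] bas_closed)
next
  case (3 M u v v')
  then have "ten (M, u, v \<oplus>\<^bsub>Q M\<^esub> v') = Null +>\<^bsub>L\<^esub> (bas (M, u, v) \<oplus>\<^bsub>L\<^esub> bas (M, u, v'))"
    by (intro proj_eqI PQ_closed bas_closed) (auto simp: coend_rels_def Let_def)
  then show ?case using 3 by (simp add: linear_add[OF proj_linear] bas_closed)
next
  case (4 M r u v)
  then have "ten (M, r \<odot>\<^bsub>P M\<^esub> u, v) = Null +>\<^bsub>L\<^esub> (r \<odot>\<^bsub>L\<^esub> bas (M, u, v))"
    by (intro proj_eqI PQ_closed bas_closed) (auto simp: coend_rels_def Let_def)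
  then show ?case using 4 by (simp add: linear_smult[OF proj_linear] bas_closed)
next
  case (5 M r u v)
  then have "ten (M, u, r \<odot>\<^bsub>Q M\<^esub> v) = Null +>\<^bsub>L\<^esub> (r \<odot>\<^bsub>L\<^esub> bas (M, u, v))"
    by (intro proj_eqI PQ_closed bas_closed) (auto simp: coend_rels_def Let_def)
  then show ?case using 5 by (simp add: linear_smult[OF proj_linear] bas_closed)
next
  case (6 M M' f u v)
  then show ?case
    by (intro proj_eqI bas_closed Pm_closed Qm_closed) (auto simp: coend_rels_def Let_def)
qed

text \<open>
  The kernel of the linear extension is a submodule that contains the defining relations, hence
  the submodule that they generate.
\<close>

lemma free_lift_Null:
  assumes N: "module R N" and h: "balanced_map R \<C> P Pm Q Qm N h" and \<phi>: "\<phi> \<in> Null"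
  shows "free_lift R N h \<phi> = \<zero>\<^bsub>N\<^esub>"
proof -
  have hg: "h \<in> coend_gens \<C> P Q \<rightarrow> carrier N"
    using balanced_map.closed[OF h] by (auto simp: coend_gens_def)
  note lin = free_lift_linear[OF N hg, folded L_eq]
  have bas: "free_lift R N h (bas (M, u, v)) = h (M, u, v)"
    if "M \<in> obj \<C>" "u \<in> carrier (P M)" "v \<in> carrier (Q M)" for M u v
    by (rule free_lift_basis[OF N hg]) (use that in \<open>simp add: coend_gens_def\<close>)
  let ?K = "{\<phi> \<in> carrier L. free_lift R N h \<phi> = \<zero>\<^bsub>N\<^esub>}"
  note simps = linear_minus[OF L_module N lin] linear_add[OF lin] linear_smult[OF lin] bas
    PQ_closed bas_closed Pm_closed Qm_closed balanced_map.closed[OF h] balanced_map.add_left[OF h]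
    balanced_map.add_right[OF h] balanced_map.smult_left[OF h] balanced_map.smult_right[OF h]
    balanced_map.dinatural[OF h] mminus_self[OF N] madd_closed[OF N] msmult_closed[OF N]
  have "submodule ?K R L" by (rule linear_kernel_submodule[OF L_module N lin])
  moreover have "coend_rels R \<C> P Pm Q Qm \<subseteq> ?K"
    unfolding coend_rels_def Let_def by (auto simp: simps)
  ultimately show ?thesis
    using \<phi> by (auto simp: coend_null_def submodule_generated_def)
qed

lemma balanced_map_linear:
  assumes h: "balanced_map R \<C> P Pm Q Qm N h" and f: "f \<in> linear_maps R N N'"
  shows "balanced_map R \<C> P Pm Q Qm N' (\<lambda>g. f (h g))"
proof (rule balanced_map.intro, goal_cases)
  case (1 M u v)
  then show ?case by (intro linear_closed[OF f] balanced_map.closed[OF h])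
next
  case (2 M u u' v)
  then show ?case
    by (simp add: balanced_map.add_left[OF h] balanced_map.closed[OF h] linear_add[OF f])
next
  case (3 M u v v')
  then show ?case
    by (simp add: balanced_map.add_right[OF h] balanced_map.closed[OF h] linear_add[OF f])
next
  case (4 M r u v)
  then show ?case
    by (simp add: balanced_map.smult_left[OF h] balanced_map.closed[OF h] linear_smult[OF f])
next
  case (5 M r u v)
  then show ?case
    by (simp add: balanced_map.smult_right[OF h] balanced_map.closed[OF h] linear_smult[OF f])
next
  case (6 M M' f u v)
  then show ?case by (simp add: balanced_map.dinatural[OF h])
qed

lemma balanced_map_cong:
  assumes h: "balanced_map R \<C> P Pm Q Qm N h"
    and eq: "\<And>M u v. \<lbrakk>M \<in> obj \<C>; u \<in> carrier (P M); v \<in> carrier (Q M)\<rbrakk>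
      \<Longrightarrow> h' (M, u, v) = h (M, u, v)"
  shows "balanced_map R \<C> P Pm Q Qm N h'"
proof (rule balanced_map.intro, goal_cases)
  case (1 M u v)
  then show ?case by (simp add: eq balanced_map.closed[OF h])
next
  case (2 M u u' v)
  then show ?case by (simp add: eq PQ_closed balanced_map.add_left[OF h])
next
  case (3 M u v v')
  then show ?case by (simp add: eq PQ_closed balanced_map.add_right[OF h])
next
  case (4 M r u v)
  then show ?case by (simp add: eq PQ_closed balanced_map.smult_left[OF h])
next
  case (5 M r u v)
  then show ?case by (simp add: eq PQ_closed balanced_map.smult_right[OF h])
next
  case (6 M M' f u v)
  then show ?case by (simp add: eq Pm_closed Qm_closed balanced_map.dinatural[OF h])
qed

text \<open>Existence in the universal property: the linear extension kills the relations.\<close>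

lemma coend_lift:
  assumes N: "module R N" and h: "balanced_map R \<C> P Pm Q Qm N h"
  obtains H where "H \<in> linear_maps R Co N"
    and "\<And>\<phi>. \<phi> \<in> carrier L \<Longrightarrow> H (Null +>\<^bsub>L\<^esub> \<phi>) = free_lift R N h \<phi>"
    and "\<And>M u v. \<lbrakk>M \<in> obj \<C>; u \<in> carrier (P M); v \<in> carrier (Q M)\<rbrakk>
      \<Longrightarrow> H (ten (M, u, v)) = h (M, u, v)"
proof -
  have hg: "h \<in> coend_gens \<C> P Q \<rightarrow> carrier N"
    using balanced_map.closed[OF h] by (auto simp: coend_gens_def)
  note lin = free_lift_linear[OF N hg, folded L_eq]
  obtain H where H: "H \<in> linear_maps R Co N"
    and eq: "\<And>\<phi>. \<phi> \<in> carrier L \<Longrightarrow> H (Null +>\<^bsub>L\<^esub> \<phi>) = free_lift R N h \<phi>"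
    using quotient_lift[OF L_module N Null_submodule lin free_lift_Null[OF N h]] unfolding Co_eq
    by blast
  have "H (ten (M, u, v)) = h (M, u, v)"
    if "M \<in> obj \<C>" "u \<in> carrier (P M)" "v \<in> carrier (Q M)" for M u v
    unfolding eq[OF bas_closed[OF that]]
    by (rule free_lift_basis[OF N hg]) (use that in \<open>simp add: coend_gens_def\<close>)
  then show ?thesis using H eq that by blast
qed

text \<open>
  Multiples of generators are generators, as the scalar can be moved into the first factor; so the
  induction has no case for scalars.
\<close>

lemma coend_induct [consumes 1, case_names zero tensor add]:
  assumes K: "K \<in> carrier Co"
    and zero: "W \<zero>\<^bsub>Co\<^esub>"
    and tensor: "\<And>M u v. \<lbrakk>M \<in> obj \<C>; u \<in> carrier (P M); v \<in> carrier (Q M)\<rbrakk> \<Longrightarrow> W (ten (M, u, v))"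
    and add: "\<And>K K'. \<lbrakk>K \<in> carrier Co; K' \<in> carrier Co; W K; W K'\<rbrakk> \<Longrightarrow> W (K \<oplus>\<^bsub>Co\<^esub> K')"
  shows "W K"
proof -
  obtain \<phi> where \<phi>: "\<phi> \<in> carrier (free_module R (coend_gens \<C> P Q))" "K = Null +>\<^bsub>L\<^esub> \<phi>"
    using K unfolding Co_carrier L_eq by blast
  have "W (Null +>\<^bsub>L\<^esub> \<phi>)"
    using \<phi>(1)
  proof (induction rule: free_induct)
    case zero
    show ?case using linear_zero[OF L_module Co_module proj_linear] assms(2) by (simp add: L_eq)
  next
    case (add \<phi> g r)
    obtain M u v where g: "g = (M, u, v)" "M \<in> obj \<C>" "u \<in> carrier (P M)" "v \<in> carrier (Q M)"
      using add.hyps(2) by (auto simp: coend_gens_def)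
    note \<phi> = add.hyps(1)[folded L_eq]
    note b = bas_closed[OF g(2-4)]
    have "Null +>\<^bsub>L\<^esub> (\<phi> \<oplus>\<^bsub>L\<^esub> r \<odot>\<^bsub>L\<^esub> bas g) = (Null +>\<^bsub>L\<^esub> \<phi>) \<oplus>\<^bsub>Co\<^esub> ten (M, r \<odot>\<^bsub>P M\<^esub> u, v)"
      using \<phi> add.hyps(3) b g balanced_map.smult_left[OF ten_balanced g(2) add.hyps(3) g(3,4)]
      by (simp add: linear_add[OF proj_linear] linear_smult[OF proj_linear] PQ_closed)
    then show ?case
      using assms(4)[OF linear_closed[OF proj_linear \<phi>] ten_closed[of M "r \<odot>\<^bsub>P M\<^esub> u" v]]
        tensor[of M "r \<odot>\<^bsub>P M\<^esub> u" v] add.IH g add.hyps(3) by (simp add: PQ_closed L_eq)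
  qed
  then show ?thesis using \<phi>(2) by simp
qed

end

text \<open>
  The union consists of one coset: \<^const>\<open>free_map\<close> followed by the projection is the linear extension of
  a balanced map, so its value depends only on the coset of the argument.
\<close>

lemma coend_map_lift:
  assumes co: "coend_data R \<C> P Pm Q Qm" "coend_data R \<C> P' Pm' Q' Qm'"
    and h: "h \<in> coend_gens \<C> P Q \<rightarrow> coend_gens \<C> P' Q'"
    and bal: "balanced_map R \<C> P Pm Q Qm (coend R \<C> P' Pm' Q' Qm')
      (\<lambda>g. coend_null R \<C> P' Pm' Q' Qm' +>\<^bsub>coend_free R \<C> P' Q'\<^esub> basis_elt R (h g))"
  defines "H \<equiv> \<lambda>K. (\<Union>\<phi>\<in>K. coend_null R \<C> P' Pm' Q' Qm' +>\<^bsub>coend_free R \<C> P' Q'\<^esub> free_map R h \<phi>)"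
  shows "H \<in> linear_maps R (coend R \<C> P Pm Q Qm) (coend R \<C> P' Pm' Q' Qm')"
    and "\<lbrakk>M \<in> obj \<C>; u \<in> carrier (P M); v \<in> carrier (Q M)\<rbrakk>
      \<Longrightarrow> H (coend_null R \<C> P Pm Q Qm +>\<^bsub>coend_free R \<C> P Q\<^esub> basis_elt R (M, u, v))
        = coend_null R \<C> P' Pm' Q' Qm' +>\<^bsub>coend_free R \<C> P' Q'\<^esub> basis_elt R (h (M, u, v))"
proof -
  interpret A: coend_data R \<C> P Pm Q Qm by fact
  interpret B: coend_data R \<C> P' Pm' Q' Qm' by fact
  obtain T where T: "T \<in> linear_maps R A.Co B.Co"
    and Tfl: "\<And>\<phi>. \<phi> \<in> carrier A.L \<Longrightarrow> T (A.Null +>\<^bsub>A.L\<^esub> \<phi>) = free_lift R B.Co (\<lambda>g. B.ten (h g)) \<phi>"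
    and Tten: "\<And>M u v. \<lbrakk>M \<in> obj \<C>; u \<in> carrier (P M); v \<in> carrier (Q M)\<rbrakk>
      \<Longrightarrow> T (A.ten (M, u, v)) = B.ten (h (M, u, v))"
    using A.coend_lift[OF B.Co_module bal] by blast
  have hg: "(\<lambda>g. B.ten (h g)) \<in> coend_gens \<C> P Q \<rightarrow> carrier B.Co"
    using balanced_map.closed[OF bal] by (auto simp: coend_gens_def)
  have fl: "B.Null +>\<^bsub>B.L\<^esub> free_map R h \<phi> = free_lift R B.Co (\<lambda>g. B.ten (h g)) \<phi>"
    if "\<phi> \<in> carrier A.L" for \<phi>
  proof (rule A.free_linear_eq[OF B.Co_module, where f = "\<lambda>\<phi>. B.Null +>\<^bsub>B.L\<^esub> free_map R h \<phi>"])
    show "(\<lambda>\<phi>. B.Null +>\<^bsub>B.L\<^esub> free_map R h \<phi>)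
        \<in> linear_maps R (free_module R (coend_gens \<C> P Q)) B.Co"
      using A.linear_comp[OF A.free_map_linear[OF h] B.proj_linear[unfolded B.L_eq]]
      by (simp add: B.L_eq)
    show "free_lift R B.Co (\<lambda>g. B.ten (h g)) \<in> linear_maps R (free_module R (coend_gens \<C> P Q)) B.Co"
      by (rule A.free_lift_linear[OF B.Co_module hg])
    show "B.Null +>\<^bsub>B.L\<^esub> free_map R h (basis_elt R s) = free_lift R B.Co (\<lambda>g. B.ten (h g)) (basis_elt R s)"
      if "s \<in> coend_gens \<C> P Q" for s
      by (simp add: A.free_lift_basis[OF B.Co_module hg that] A.free_map_basis[OF h that])
    show "\<phi> \<in> carrier (free_module R (coend_gens \<C> P Q))" using that by (simp add: A.L_eq)
  qed
  have HT: "H K = T K" if K: "K \<in> carrier A.Co" for K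
  proof -
    note q = A.quotient_simps[OF A.L_module A.Null_submodule]
    obtain \<psi> where \<psi>: "\<psi> \<in> carrier A.L" "K = A.Null +>\<^bsub>A.L\<^esub> \<psi>" using K A.Co_carrier by auto
    have c: "B.Null +>\<^bsub>B.L\<^esub> free_map R h \<phi> = T K" if "\<phi> \<in> K" for \<phi>
    proof -
      have "\<phi> \<in> carrier A.L" using q(7)[OF \<psi>(1)] that \<psi>(2) by auto
      moreover have "A.Null +>\<^bsub>A.L\<^esub> \<phi> = K"
        using abelian_group.a_repr_independence[OF A.module_abelian_group[OF A.L_module] _ \<psi>(1)
            submodule.axioms(1)[OF A.Null_submodule], of \<phi>] that \<psi>(2) by simp
      ultimately show ?thesis using fl[of \<phi>] Tfl[of \<phi>] by metis
    qed
    have "\<psi> \<in> K" using q(6)[OF \<psi>(1)] \<psi>(2) by simp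
    then show ?thesis unfolding H_def using c by blast
  qed
  show "H \<in> linear_maps R A.Co B.Co" by (rule A.linear_cong[OF T A.Co_module HT])
  show "H (A.ten (M, u, v)) = B.ten (h (M, u, v))"
    if "M \<in> obj \<C>" "u \<in> carrier (P M)" "v \<in> carrier (Q M)"
    using HT[OF A.ten_closed[OF that]] Tten[OF that] by simp
qed


section \<open>Bilinear functors\<close>

context bilinear_functor
begin

lemma cov_linear:
  "\<lbrakk>X \<in> obj \<C>; Y \<in> obj \<C>; Y' \<in> obj \<C>; g \<in> mor \<C> Y Y'\<rbrakk>
    \<Longrightarrow> cov \<C> Fm X Y Y' g \<in> linear_maps R (F X Y) (F X Y')"
  unfolding cov_def by (rule Fm_linear) (auto intro: idn_mor)

lemma contrav_linear:
  "\<lbrakk>X \<in> obj \<C>; X' \<in> obj \<C>; Y \<in> obj \<C>; f \<in> mor \<C> X' X\<rbrakk>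
    \<Longrightarrow> contrav \<C> Fm Y X X' f \<in> linear_maps R (F X Y) (F X' Y)"
  unfolding contrav_def by (rule Fm_linear) (auto intro: idn_mor)

lemma cov_closed:
  "\<lbrakk>X \<in> obj \<C>; Y \<in> obj \<C>; Y' \<in> obj \<C>; g \<in> mor \<C> Y Y'; u \<in> carrier (F X Y)\<rbrakk>
    \<Longrightarrow> cov \<C> Fm X Y Y' g u \<in> carrier (F X Y')"
  by (rule linear_closed[OF cov_linear])

lemma contrav_closed:
  "\<lbrakk>X \<in> obj \<C>; X' \<in> obj \<C>; Y \<in> obj \<C>; f \<in> mor \<C> X' X; u \<in> carrier (F X Y)\<rbrakk>
    \<Longrightarrow> contrav \<C> Fm Y X X' f u \<in> carrier (F X' Y)"
  by (rule linear_closed[OF contrav_linear])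

lemma cmp_closed:
  "\<lbrakk>X \<in> obj \<C>; Y \<in> obj \<C>; Z \<in> obj \<C>; f \<in> mor \<C> X Y; g \<in> mor \<C> Y Z\<rbrakk> \<Longrightarrow> g \<cdot>\<^bsub>\<C>\<^esub> f \<in> mor \<C> X Z"
  by (rule linear_closed[OF cmp_linear_left[of X Y Z f]])

lemma cov_idn: "\<lbrakk>X \<in> obj \<C>; Y \<in> obj \<C>; u \<in> carrier (F X Y)\<rbrakk> \<Longrightarrow> cov \<C> Fm X Y Y (idn \<C> Y) u = u"
  by (simp add: cov_def Fm_idn)

lemma contrav_idn:
  "\<lbrakk>X \<in> obj \<C>; Y \<in> obj \<C>; u \<in> carrier (F X Y)\<rbrakk> \<Longrightarrow> contrav \<C> Fm Y X X (idn \<C> X) u = u"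
  by (simp add: contrav_def Fm_idn)

lemma cov_cmp:
  assumes "X \<in> obj \<C>" "Y \<in> obj \<C>" "Y' \<in> obj \<C>" "Y'' \<in> obj \<C>"
    "g \<in> mor \<C> Y Y'" "g' \<in> mor \<C> Y' Y''" "u \<in> carrier (F X Y)"
  shows "cov \<C> Fm X Y' Y'' g' (cov \<C> Fm X Y Y' g u) = cov \<C> Fm X Y Y'' (g' \<cdot>\<^bsub>\<C>\<^esub> g) u"
  unfolding cov_def
  using Fm_cmp[of X X X Y Y' Y'' "idn \<C> X" "idn \<C> X" g g' u] assms
  by (simp add: idn_mor cmp_idn_left[of X X])

lemma contrav_cmp:
  assumes "X \<in> obj \<C>" "X' \<in> obj \<C>" "X'' \<in> obj \<C>" "Y \<in> obj \<C>"
    "f \<in> mor \<C> X' X" "f' \<in> mor \<C> X'' X'" "u \<in> carrier (F X Y)"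
  shows "contrav \<C> Fm Y X' X'' f' (contrav \<C> Fm Y X X' f u) = contrav \<C> Fm Y X X'' (f \<cdot>\<^bsub>\<C>\<^esub> f') u"
  unfolding contrav_def
  using Fm_cmp[of X X' X'' Y Y Y f f' "idn \<C> Y" "idn \<C> Y" u] assms
  by (simp add: idn_mor cmp_idn_left[of Y Y])

lemma Fm_cov_contrav:
  assumes "X \<in> obj \<C>" "X' \<in> obj \<C>" "Y \<in> obj \<C>" "Y' \<in> obj \<C>"
    "f \<in> mor \<C> X' X" "g \<in> mor \<C> Y Y'" "u \<in> carrier (F X Y)"
  shows "Fm X X' Y Y' f g u = cov \<C> Fm X' Y Y' g (contrav \<C> Fm Y X X' f u)"
    and "Fm X X' Y Y' f g u = contrav \<C> Fm Y' X X' f (cov \<C> Fm X Y Y' g u)"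
  unfolding contrav_def cov_def
  using Fm_cmp[of X X' X' Y Y Y' f "idn \<C> X'" "idn \<C> Y" g u]
    Fm_cmp[of X X X' Y Y' Y' "idn \<C> X" f g "idn \<C> Y'" u] assms
  by (simp_all add: idn_mor cmp_idn_left cmp_idn_right)

lemma cov_contrav:
  assumes "X \<in> obj \<C>" "X' \<in> obj \<C>" "Y \<in> obj \<C>" "Y' \<in> obj \<C>"
    "f \<in> mor \<C> X' X" "g \<in> mor \<C> Y Y'" "u \<in> carrier (F X Y)"
  shows "cov \<C> Fm X' Y Y' g (contrav \<C> Fm Y X X' f u) = contrav \<C> Fm Y' X X' f (cov \<C> Fm X Y Y' g u)"
  using Fm_cov_contrav[OF assms] by simp

lemma cov_zero:
  assumes "X \<in> obj \<C>" "Y \<in> obj \<C>" "Y' \<in> obj \<C>" "u \<in> carrier (F X Y)"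
  shows "cov \<C> Fm X Y Y' \<zero>\<^bsub>Hom \<C> Y Y'\<^esub> u = \<zero>\<^bsub>F X Y'\<^esub>"
  unfolding cov_def
  by (rule linear_zero[OF Hom_module F_module Fm_bilinear_right]) (use assms in \<open>auto intro: idn_mor\<close>)

lemma contrav_zero:
  assumes "X \<in> obj \<C>" "X' \<in> obj \<C>" "Y \<in> obj \<C>" "u \<in> carrier (F X Y)"
  shows "contrav \<C> Fm Y X X' \<zero>\<^bsub>Hom \<C> X' X\<^esub> u = \<zero>\<^bsub>F X' Y\<^esub>"
  unfolding contrav_def
  by (rule linear_zero[OF Hom_module F_module Fm_bilinear_left]) (use assms in \<open>auto intro: idn_mor\<close>)

text \<open>
  The injections \<open>j\<close> of interest are \<^const>\<open>XHom\<close>, \<^const>\<open>XExt\<close>, \<^const>\<open>Inl\<close> and \<^const>\<open>Inr\<close>.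
\<close>

lemma transport_bilinear_functor:
  assumes j: "\<And>u. un (j u) = u"
  shows "bilinear_functor R \<C> (\<lambda>X Y. transport j (F X Y))
    (\<lambda>X X' Y Y' f g u. j (Fm X X' Y Y' f g (un u)))"
proof -
  have inj: "inj_on j (carrier (F X Y))" for X Y by (metis inj_onI j)
  note t = transport_simps[OF inj]
  show ?thesis
  proof (rule bilinear_functor.intro, rule linear_category_axioms, rule bilinear_functor_axioms.intro)
    fix X Y assume "X \<in> obj \<C>" "Y \<in> obj \<C>"
    then show "module R (transport j (F X Y))" by (intro transport_module F_module inj)
  next
    fix X X' Y Y' f g
    assume a: "X \<in> obj \<C>" "X' \<in> obj \<C>" "Y \<in> obj \<C>" "Y' \<in> obj \<C>" "f \<in> mor \<C> X' X" "g \<in> mor \<C> Y Y'"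
    note l = Fm_linear[OF a] and m = F_module[OF a(1,3)]
    show "(\<lambda>u. j (Fm X X' Y Y' f g (un u))) \<in> linear_maps R (transport j (F X Y)) (transport j (F X' Y'))"
      by (rule linearI) (auto simp: t j linear_closed[OF l] linear_add[OF l] linear_smult[OF l])
  next
    fix X X' Y Y' g u
    assume a: "X \<in> obj \<C>" "X' \<in> obj \<C>" "Y \<in> obj \<C>" "Y' \<in> obj \<C>" "g \<in> mor \<C> Y Y'"
      "u \<in> carrier (transport j (F X Y))"
    then have "un u \<in> carrier (F X Y)" by (auto simp: t j)
    note l = Fm_bilinear_left[OF a(1-5) this]
    show "(\<lambda>f. j (Fm X X' Y Y' f g (un u))) \<in> linear_maps R (Hom \<C> X' X) (transport j (F X' Y'))"
      by (rule linearI) (auto simp: t j linear_closed[OF l] linear_add[OF l] linear_smult[OF l])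
  next
    fix X X' Y Y' f u
    assume a: "X \<in> obj \<C>" "X' \<in> obj \<C>" "Y \<in> obj \<C>" "Y' \<in> obj \<C>" "f \<in> mor \<C> X' X"
      "u \<in> carrier (transport j (F X Y))"
    then have "un u \<in> carrier (F X Y)" by (auto simp: t j)
    note l = Fm_bilinear_right[OF a(1-5) this]
    show "(\<lambda>g. j (Fm X X' Y Y' f g (un u))) \<in> linear_maps R (Hom \<C> Y Y') (transport j (F X' Y'))"
      by (rule linearI) (auto simp: t j linear_closed[OF l] linear_add[OF l] linear_smult[OF l])
  qed (auto simp: t j Fm_idn Fm_cmp)
qed

end

lemma (in linear_category) Hom_bilinear_functor: "bilinear_functor R \<C> (Hom \<C>) (Hom_act \<C>)"
proof (rule bilinear_functor.intro, rule linear_category_axioms, rule bilinear_functor_axioms.intro)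
  have cc: "g \<cdot>\<^bsub>\<C>\<^esub> f \<in> mor \<C> X Z"
    if "X \<in> obj \<C>" "Y \<in> obj \<C>" "Z \<in> obj \<C>" "f \<in> mor \<C> X Y" "g \<in> mor \<C> Y Z" for X Y Z f g
    using linear_closed[OF cmp_linear_left[of X Y Z f]] that by blast
  { fix X Y assume "X \<in> obj \<C>" "Y \<in> obj \<C>"
    then show "module R (Hom \<C> X Y)" by (rule Hom_module) }
  { fix X X' Y Y' f g
    assume a: "X \<in> obj \<C>" "X' \<in> obj \<C>" "Y \<in> obj \<C>" "Y' \<in> obj \<C>" "f \<in> mor \<C> X' X" "g \<in> mor \<C> Y Y'"
    show "Hom_act \<C> X X' Y Y' f g \<in> linear_maps R (Hom \<C> X Y) (Hom \<C> X' Y')"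
      unfolding Hom_act_def
      by (rule linear_comp[OF cmp_linear_right cmp_linear_left]) (use a in auto) }
  { fix X Y u assume "X \<in> obj \<C>" "Y \<in> obj \<C>" "u \<in> mor \<C> X Y"
    then show "Hom_act \<C> X X Y Y (idn \<C> X) (idn \<C> Y) u = u"
      by (simp add: Hom_act_def cmp_idn_left cmp_idn_right) }
  { fix X X' X'' Y Y' Y'' f f' g g' u
    assume a: "X \<in> obj \<C>" "X' \<in> obj \<C>" "X'' \<in> obj \<C>" "Y \<in> obj \<C>" "Y' \<in> obj \<C>" "Y'' \<in> obj \<C>"
      "f \<in> mor \<C> X' X" "f' \<in> mor \<C> X'' X'" "g \<in> mor \<C> Y Y'" "g' \<in> mor \<C> Y' Y''" "u \<in> mor \<C> X Y"
    have "g' \<cdot>\<^bsub>\<C>\<^esub> g \<cdot>\<^bsub>\<C>\<^esub> u \<cdot>\<^bsub>\<C>\<^esub> (f \<cdot>\<^bsub>\<C>\<^esub> f') = (g' \<cdot>\<^bsub>\<C>\<^esub> (g \<cdot>\<^bsub>\<C>\<^esub> u)) \<cdot>\<^bsub>\<C>\<^esub> (f \<cdot>\<^bsub>\<C>\<^esub> f')"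
      using cmp_assoc[of X Y Y' Y'' u g g'] a by simp
    also have "\<dots> = g' \<cdot>\<^bsub>\<C>\<^esub> (g \<cdot>\<^bsub>\<C>\<^esub> u) \<cdot>\<^bsub>\<C>\<^esub> f \<cdot>\<^bsub>\<C>\<^esub> f'"
      using cmp_assoc[of X'' X' X Y'' f' f "g' \<cdot>\<^bsub>\<C>\<^esub> (g \<cdot>\<^bsub>\<C>\<^esub> u)"] a
        cc[of X Y Y' u g] cc[of X Y' Y'' "g \<cdot>\<^bsub>\<C>\<^esub> u" g'] by simp
    also have "g' \<cdot>\<^bsub>\<C>\<^esub> (g \<cdot>\<^bsub>\<C>\<^esub> u) \<cdot>\<^bsub>\<C>\<^esub> f = g' \<cdot>\<^bsub>\<C>\<^esub> (g \<cdot>\<^bsub>\<C>\<^esub> u \<cdot>\<^bsub>\<C>\<^esub> f)"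
      using cmp_assoc[of X' X Y' Y'' f "g \<cdot>\<^bsub>\<C>\<^esub> u" g'] a cc[of X Y Y' u g] by simp
    finally show "Hom_act \<C> X X'' Y Y'' (f \<cdot>\<^bsub>\<C>\<^esub> f') (g' \<cdot>\<^bsub>\<C>\<^esub> g) u
        = Hom_act \<C> X' X'' Y' Y'' f' g' (Hom_act \<C> X X' Y Y' f g u)"
      by (simp add: Hom_act_def) }
  { fix X X' Y Y' g u
    assume a: "X \<in> obj \<C>" "X' \<in> obj \<C>" "Y \<in> obj \<C>" "Y' \<in> obj \<C>" "g \<in> mor \<C> Y Y'" "u \<in> mor \<C> X Y"
    show "(\<lambda>f. Hom_act \<C> X X' Y Y' f g u) \<in> linear_maps R (Hom \<C> X' X) (Hom \<C> X' Y')"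
      unfolding Hom_act_def by (rule cmp_linear_right) (use a cc in auto) }
  { fix X X' Y Y' f u
    assume a: "X \<in> obj \<C>" "X' \<in> obj \<C>" "Y \<in> obj \<C>" "Y' \<in> obj \<C>" "f \<in> mor \<C> X' X" "u \<in> mor \<C> X Y"
    show "(\<lambda>g. Hom_act \<C> X X' Y Y' f g u) \<in> linear_maps R (Hom \<C> Y Y') (Hom \<C> X' Y')"
      unfolding Hom_act_def
      by (rule linear_comp[OF cmp_linear_left cmp_linear_left]) (use a in auto) }
qed

text \<open>
  A finitely supported function is determined by the part of its graph off zero, and a coset by any of
  its elements.
\<close>

lemma (in cring) coset_name_inj:
  assumes H: "submodule H R (free_module R S)"
  shows "inj_on (coset_name R) (carrier (quotient_module (free_module R S) H))"
proof (rule inj_onI)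
  let ?L = "free_module R S"
  note q = quotient_simps[OF free_is_module H]
  fix K K'
  assume K: "K \<in> carrier (quotient_module ?L H)" and K': "K' \<in> carrier (quotient_module ?L H)"
    and eq: "coset_name R K = coset_name R K'"
  have rep: "(SOME \<phi>. \<phi> \<in> J) \<in> carrier ?L \<and> J = H +>\<^bsub>?L\<^esub> (SOME \<phi>. \<phi> \<in> J)"
    if "J \<in> carrier (quotient_module ?L H)" for J
  proof -
    obtain \<psi> where \<psi>: "\<psi> \<in> carrier ?L" "J = H +>\<^bsub>?L\<^esub> \<psi>" using \<open>J \<in> _\<close> q(1) by auto
    have s: "(SOME \<phi>. \<phi> \<in> J) \<in> J" by (rule someI[of _ \<psi>]) (simp add: \<psi> q(6))
    moreover have "(SOME \<phi>. \<phi> \<in> J) \<in> carrier ?L" using s q(7)[OF \<psi>(1)] \<psi>(2) by blast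
    ultimately show ?thesis
      using abelian_group.a_repr_independence[OF module_abelian_group[OF free_is_module] _ \<psi>(1)
          submodule.axioms(1)[OF H]] \<psi>(2) by metis
  qed
  let ?\<phi> = "SOME \<phi>. \<phi> \<in> K" and ?\<psi> = "SOME \<phi>. \<phi> \<in> K'"
  have fin: "finite {(g, \<phi> g) |g. \<phi> g \<noteq> \<zero>}" if "\<phi> \<in> carrier ?L" for \<phi>
  proof -
    have "{(g, \<phi> g) |g. \<phi> g \<noteq> \<zero>} = (\<lambda>g. (g, \<phi> g)) ` {g. \<phi> g \<noteq> \<zero>}" by auto
    then show ?thesis using free_fin[OF that] by simp
  qed
  have "{(g, ?\<phi> g) |g. ?\<phi> g \<noteq> \<zero>} = {(g, ?\<psi> g) |g. ?\<psi> g \<noteq> \<zero>}"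
    using eq fin rep[OF K] rep[OF K'] by (simp add: coset_name_def Let_def Abs_fset_inject)
  then have "(g, r) \<in> {(g, ?\<phi> g) |g. ?\<phi> g \<noteq> \<zero>} \<longleftrightarrow> (g, r) \<in> {(g, ?\<psi> g) |g. ?\<psi> g \<noteq> \<zero>}" for g r
    by (rule arg_cong[where f = "\<lambda>A. (g, r) \<in> A"])
  then have "r = ?\<phi> g \<and> ?\<phi> g \<noteq> \<zero> \<longleftrightarrow> r = ?\<psi> g \<and> ?\<psi> g \<noteq> \<zero>" for g r
    by (simp del: split_paired_Ex)
  then have "?\<phi> g = ?\<psi> g" for g by metis
  then have "?\<phi> = ?\<psi>" ..
  then show "K = K'" using rep[OF K] rep[OF K'] by metis
qed


section \<open>One step of the tower of positive extensions\<close>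

locale extension_step =
  Ext?: bilinear_functor R \<C> "Ext \<C>" "ext_map \<C>" + Fun: bilinear_functor R \<C> F Fm
  for R :: "('r, 'q) ring_scheme" and \<C> :: "('r, 'o, 'm, 'e, 'z) excat_scheme"
    and F :: "('r, 'o, ('r, 'o, 'm, 'e) xelt) bimod" and Fm :: "('o, 'm, ('r, 'o, 'm, 'e) xelt) biact"
begin

definition ext :: "('r, 'o, ('r, 'o, 'm, 'e) xelt) bimod" where
  "ext X Y = transport (coset_name R) (step_coend R \<C> F Fm X Y)"

definition tens :: "'o \<Rightarrow> 'o \<Rightarrow> 'o \<times> ('r, 'o, 'm, 'e) xelt \<times> 'e \<Rightarrow> ('r, 'o, 'm, 'e) xelt" where
  "tens X Y g = coset_name R (step_tensor R \<C> F Fm X Y g)"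

abbreviation balanced where
  "balanced X Y N h \<equiv> balanced_map R \<C> (\<lambda>M. F M Y) (contrav \<C> Fm Y) (\<lambda>M. Ext \<C> X M)
     (cov \<C> (ext_map \<C>) X) N h"

lemma coend_data:
  assumes "X \<in> obj \<C>" "Y \<in> obj \<C>"
  shows "coend_data R \<C> (\<lambda>M. F M Y) (contrav \<C> Fm Y) (\<lambda>M. Ext \<C> X M) (cov \<C> (ext_map \<C>) X)"
  by (rule coend_data.intro, rule Ext.linear_category_axioms, rule coend_data_axioms.intro)
    (use assms in \<open>simp_all add: Ext.F_module Fun.F_module Fun.contrav_closed Ext.cov_closed\<close>)

lemma step_inj:
  assumes "X \<in> obj \<C>" "Y \<in> obj \<C>"
  shows "inj_on (coset_name R) (carrier (step_coend R \<C> F Fm X Y))"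
proof -
  interpret coend_data R \<C> "\<lambda>M. F M Y" "contrav \<C> Fm Y" "\<lambda>M. Ext \<C> X M" "cov \<C> (ext_map \<C>) X"
    by (rule coend_data[OF assms])
  show ?thesis unfolding step_coend_def Co_eq
    using coset_name_inj[OF Null_submodule[unfolded L_eq]] by (simp add: L_eq)
qed

lemma step_module:
  assumes "X \<in> obj \<C>" "Y \<in> obj \<C>"
  shows "module R (step_coend R \<C> F Fm X Y)"
  unfolding step_coend_def by (rule coend_data.Co_module[OF coend_data[OF assms]])

lemma ext_module: "\<lbrakk>X \<in> obj \<C>; Y \<in> obj \<C>\<rbrakk> \<Longrightarrow> module R (ext X Y)"
  unfolding ext_def by (rule Ext.transport_module[OF step_module step_inj])

lemma tens_balanced:
  assumes "X \<in> obj \<C>" "Y \<in> obj \<C>"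
  shows "balanced X Y (ext X Y) (tens X Y)"
proof -
  interpret coend_data R \<C> "\<lambda>M. F M Y" "contrav \<C> Fm Y" "\<lambda>M. Ext \<C> X M" "cov \<C> (ext_map \<C>) X"
    by (rule coend_data[OF assms])
  note j = transport_linear[OF step_inj[OF assms], folded ext_def, unfolded step_coend_def]
  show ?thesis
    unfolding tens_def[abs_def] step_tensor_def step_null_def step_free_def
    by (rule balanced_map_linear[OF ten_balanced j])
qed

lemma ext_lift:
  assumes XY: "X \<in> obj \<C>" "Y \<in> obj \<C>" and N: "module R N" and h: "balanced X Y N h"
  obtains H where "H \<in> linear_maps R (ext X Y) N"
    and "\<And>M u v. \<lbrakk>M \<in> obj \<C>; u \<in> carrier (F M Y); v \<in> carrier (Ext \<C> X M)\<rbrakk>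
      \<Longrightarrow> H (tens X Y (M, u, v)) = h (M, u, v)"
proof -
  interpret coend_data R \<C> "\<lambda>M. F M Y" "contrav \<C> Fm Y" "\<lambda>M. Ext \<C> X M" "cov \<C> (ext_map \<C>) X"
    by (rule coend_data[OF XY])
  obtain H where H: "H \<in> linear_maps R Co N"
    and eq: "\<And>M u v. \<lbrakk>M \<in> obj \<C>; u \<in> carrier (F M Y); v \<in> carrier (Ext \<C> X M)\<rbrakk>
      \<Longrightarrow> H (ten (M, u, v)) = h (M, u, v)"
    by (rule coend_lift[OF N h], rule that)
  note inj = step_inj[OF XY, unfolded step_coend_def]
  note inv = transport_inv_linear[OF Co_module inj]
  show ?thesis
  proof
    show "(\<lambda>w. H (inv_into (carrier Co) (coset_name R) w)) \<in> linear_maps R (ext X Y) N"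
      unfolding ext_def step_coend_def by (rule linear_comp[OF inv H])
    show "H (inv_into (carrier Co) (coset_name R) (tens X Y (M, u, v))) = h (M, u, v)"
      if "M \<in> obj \<C>" "u \<in> carrier (F M Y)" "v \<in> carrier (Ext \<C> X M)" for M u v
      using eq[OF that] inv_into_f_f[OF inj ten_closed[OF that]]
      by (simp add: tens_def step_tensor_def step_null_def step_free_def)
  qed
qed

lemma ext_induct [consumes 3, case_names zero tensor add]:
  assumes XY: "X \<in> obj \<C>" "Y \<in> obj \<C>" and w: "w \<in> carrier (ext X Y)"
    and zero: "W \<zero>\<^bsub>ext X Y\<^esub>"
    and tensor: "\<And>M u v. \<lbrakk>M \<in> obj \<C>; u \<in> carrier (F M Y); v \<in> carrier (Ext \<C> X M)\<rbrakk>
      \<Longrightarrow> W (tens X Y (M, u, v))"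
    and add: "\<And>w w'. \<lbrakk>w \<in> carrier (ext X Y); w' \<in> carrier (ext X Y); W w; W w'\<rbrakk>
      \<Longrightarrow> W (w \<oplus>\<^bsub>ext X Y\<^esub> w')"
  shows "W w"
proof -
  interpret coend_data R \<C> "\<lambda>M. F M Y" "contrav \<C> Fm Y" "\<lambda>M. Ext \<C> X M" "cov \<C> (ext_map \<C>) X"
    by (rule coend_data[OF XY])
  note t = transport_simps[OF step_inj[OF XY], folded ext_def, unfolded step_coend_def]
  obtain K where K: "K \<in> carrier Co" "w = coset_name R K" using w by (auto simp: t)
  from K(1) have "W (coset_name R K)"
  proof (induction rule: coend_induct)
    case zero
    show ?case using assms(4) by (simp add: t)
  next
    case (tensor M u v)
    then show ?case using assms(5)[of M u v]
      by (simp add: tens_def step_tensor_def step_null_def step_free_def)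
  next
    case (add K K')
    then show ?case using assms(6)[of "coset_name R K" "coset_name R K'"] by (simp add: t)
  qed
  then show ?thesis using K(2) by simp
qed

lemma ext_linear_eq:
  assumes XY: "X \<in> obj \<C>" "Y \<in> obj \<C>" and N: "module R N"
    and f: "f \<in> linear_maps R (ext X Y) N" and g: "g \<in> linear_maps R (ext X Y) N"
    and eq: "\<And>M u v. \<lbrakk>M \<in> obj \<C>; u \<in> carrier (F M Y); v \<in> carrier (Ext \<C> X M)\<rbrakk>
      \<Longrightarrow> f (tens X Y (M, u, v)) = g (tens X Y (M, u, v))"
    and w: "w \<in> carrier (ext X Y)"
  shows "f w = g w"
  using XY w
proof (induction rule: ext_induct)
  case zero
  show ?case by (simp add: Ext.linear_zero[OF ext_module[OF XY] N f] Ext.linear_zero[OF ext_module[OF XY] N g])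
qed (simp_all add: eq Ext.linear_add[OF f] Ext.linear_add[OF g])

end

lemma step_map_lift:
  fixes F G :: "('r, 'o, ('r, 'o, 'm, 'e) xelt) bimod" and \<C> :: "('r, 'o, 'm, 'e, 'z) excat_scheme"
  assumes F: "extension_step R \<C> F Fm" and G: "extension_step R \<C> G Gm"
    and XY: "X \<in> obj \<C>" "Y \<in> obj \<C>" "X' \<in> obj \<C>" "Y' \<in> obj \<C>"
    and h: "h \<in> coend_gens \<C> (\<lambda>M. F M Y) (\<lambda>M. Ext \<C> X M) \<rightarrow> coend_gens \<C> (\<lambda>M. G M Y') (\<lambda>M. Ext \<C> X' M)"
    and bal: "balanced_map R \<C> (\<lambda>M. F M Y) (contrav \<C> Fm Y) (\<lambda>M. Ext \<C> X M)
      (cov \<C> (ext_map \<C>) X) (extension_step.ext R \<C> G Gm X' Y')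
      (\<lambda>g. extension_step.tens R \<C> G Gm X' Y' (h g))"
  defines "H \<equiv> \<lambda>w. coset_name R (step_coend_map R \<C> G Gm X' Y' h
       (inv_into (carrier (step_coend R \<C> F Fm X Y)) (coset_name R) w))"
  shows "H \<in> linear_maps R (extension_step.ext R \<C> F Fm X Y) (extension_step.ext R \<C> G Gm X' Y')"
    and "\<lbrakk>M \<in> obj \<C>; u \<in> carrier (F M Y); v \<in> carrier (Ext \<C> X M)\<rbrakk>
      \<Longrightarrow> H (extension_step.tens R \<C> F Fm X Y (M, u, v)) = extension_step.tens R \<C> G Gm X' Y' (h (M, u, v))"
proof -
  interpret F: extension_step R \<C> F Fm by fact
  interpret G: extension_step R \<C> G Gm by fact
  interpret A: coend_data R \<C> "\<lambda>M. F M Y" "contrav \<C> Fm Y" "\<lambda>M. Ext \<C> X M" "cov \<C> (ext_map \<C>) X"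
    by (rule F.coend_data[OF XY(1,2)])
  interpret B: coend_data R \<C> "\<lambda>M. G M Y'" "contrav \<C> Gm Y'" "\<lambda>M. Ext \<C> X' M" "cov \<C> (ext_map \<C>) X'"
    by (rule G.coend_data[OF XY(3,4)])
  note injA = F.step_inj[OF XY(1,2)] and injB = G.step_inj[OF XY(3,4)]
  note tB = F.transport_simps[OF injB, folded G.ext_def, unfolded step_coend_def]
  have cl: "B.ten (h (M, u, v)) \<in> carrier B.Co"
    if "M \<in> obj \<C>" "u \<in> carrier (F M Y)" "v \<in> carrier (Ext \<C> X M)" for M u v
  proof -
    have "h (M, u, v) \<in> coend_gens \<C> (\<lambda>M. G M Y') (\<lambda>M. Ext \<C> X' M)"
      using h that by (auto simp: coend_gens_def Pi_iff)
    then show ?thesis using B.ten_closed by (auto simp: coend_gens_def)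
  qed
  have bal': "balanced_map R \<C> (\<lambda>M. F M Y) (contrav \<C> Fm Y) (\<lambda>M. Ext \<C> X M)
      (cov \<C> (ext_map \<C>) X) B.Co (\<lambda>g. B.ten (h g))"
  proof -
    have inv: "inv_into (carrier B.Co) (coset_name R) \<in> linear_maps R (G.ext X' Y') B.Co"
      unfolding G.ext_def step_coend_def
      by (rule F.transport_inv_linear[OF B.Co_module injB[unfolded step_coend_def]])
    have eq: "inv_into (carrier B.Co) (coset_name R) (G.tens X' Y' (h (M, u, v))) = B.ten (h (M, u, v))"
      if "M \<in> obj \<C>" "u \<in> carrier (F M Y)" "v \<in> carrier (Ext \<C> X M)" for M u v
      using inv_into_f_f[OF injB[unfolded step_coend_def] cl[OF that]]
      by (simp add: G.tens_def step_tensor_def step_null_def step_free_def)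
    show ?thesis
      by (rule A.balanced_map_cong[OF A.balanced_map_linear[OF bal inv]]) (simp add: eq)
  qed
  note m = coend_map_lift[OF A.coend_data_axioms B.coend_data_axioms h bal']
  have j: "coset_name R \<in> linear_maps R B.Co (G.ext X' Y')"
    unfolding G.ext_def step_coend_def by (rule F.transport_linear[OF injB[unfolded step_coend_def]])
  have inv: "inv_into (carrier A.Co) (coset_name R) \<in> linear_maps R (F.ext X Y) A.Co"
    unfolding F.ext_def step_coend_def
    by (rule F.transport_inv_linear[OF A.Co_module injA[unfolded step_coend_def]])
  show "H \<in> linear_maps R (F.ext X Y) (G.ext X' Y')"
    unfolding H_def step_coend_map_def step_null_def step_free_def step_coend_def
    by (rule F.linear_comp[OF F.linear_comp[OF inv m(1)] j])
  show "H (F.tens X Y (M, u, v)) = G.tens X' Y' (h (M, u, v))"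
    if "M \<in> obj \<C>" "u \<in> carrier (F M Y)" "v \<in> carrier (Ext \<C> X M)"
    using m(2)[OF that] inv_into_f_f[OF injA[unfolded step_coend_def] A.ten_closed[OF that]]
    by (simp add: H_def step_coend_map_def step_null_def step_free_def step_coend_def F.tens_def
        G.tens_def step_tensor_def)
qed


context extension_step
begin

text \<open>
  Bilinearity of the action is seen on generators; additivity in the extension carries it to sums.
\<close>

lemma ext_linear_in_parameter:
  assumes XY: "X \<in> obj \<C>" "Y \<in> obj \<C>" and N: "module R N" and H: "module R H"
    and G: "\<And>f. f \<in> carrier H \<Longrightarrow> G f \<in> linear_maps R (ext X Y) N"
    and tensor: "\<And>M u v. \<lbrakk>M \<in> obj \<C>; u \<in> carrier (F M Y); v \<in> carrier (Ext \<C> X M)\<rbrakk>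
      \<Longrightarrow> (\<lambda>f. G f (tens X Y (M, u, v))) \<in> linear_maps R H N"
    and w: "w \<in> carrier (ext X Y)"
  shows "(\<lambda>f. G f w) \<in> linear_maps R H N"
proof -
  interpret N: module R N by fact
  note XM = ext_module[OF XY]
  from XY w show ?thesis
  proof (induction rule: ext_induct)
    case zero
    show ?case
      using linear_zero[OF XM N G]
      by (intro linearI) (auto simp: madd_closed[OF H] msmult_closed[OF H])
  next
    case (tensor M u v)
    then show ?case by (rule assms(6))
  next
    case (add w w')
    have G_add: "G f (w \<oplus>\<^bsub>ext X Y\<^esub> w') = G f w \<oplus>\<^bsub>N\<^esub> G f w'" if "f \<in> carrier H" for f
      by (rule linear_add[OF G[OF that] add.hyps])
    note h = add.IH
    show ?case
      by (intro linearI)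
        (auto simp: G_add linear_closed[OF h(1)] linear_closed[OF h(2)] linear_add[OF h(1)] linear_add[OF h(2)]
          linear_smult[OF h(1)] linear_smult[OF h(2)] madd_closed[OF H] msmult_closed[OF H]
          N.a_ac N.smult_r_distr)
  qed
qed

definition act :: "('o, 'm, ('r, 'o, 'm, 'e) xelt) biact" where
  "act X X' Y Y' f g w = coset_name R (step_coend_map R \<C> F Fm X' Y'
       (\<lambda>(M, u, v). (M, cov \<C> Fm M Y Y' g u, contrav \<C> (ext_map \<C>) M X X' f v))
       (inv_into (carrier (step_coend R \<C> F Fm X Y)) (coset_name R) w))"

lemmas tens_closed = balanced_map.closed[OF tens_balanced]

lemma act_balanced:
  assumes XY: "X \<in> obj \<C>" "X' \<in> obj \<C>" "Y \<in> obj \<C>" "Y' \<in> obj \<C>" "f \<in> mor \<C> X' X" "g \<in> mor \<C> Y Y'"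
  shows "balanced X Y (ext X' Y')
    (\<lambda>s. tens X' Y' ((\<lambda>(M, u, v). (M, cov \<C> Fm M Y Y' g u, contrav \<C> (ext_map \<C>) M X X' f v)) s))"
proof -
  note t = tens_balanced[OF XY(2,4)]
  have l: "cov \<C> Fm M Y Y' g \<in> linear_maps R (F M Y) (F M Y')" if "M \<in> obj \<C>" for M
    by (rule Fun.cov_linear) (use XY that in auto)
  have r: "contrav \<C> (ext_map \<C>) M X X' f \<in> linear_maps R (Ext \<C> X M) (Ext \<C> X' M)" if "M \<in> obj \<C>" for M
    by (rule Ext.contrav_linear) (use XY that in auto)
  note cl = linear_closed[OF l] linear_closed[OF r]
  show ?thesis
  proof (rule balanced_map.intro, goal_cases)
    case (1 M u v)
    then show ?case by (simp add: cl balanced_map.closed[OF t])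
  next
    case (2 M u u' v)
    then show ?case by (simp add: cl linear_add[OF l] balanced_map.add_left[OF t])
  next
    case (3 M u v v')
    then show ?case by (simp add: cl linear_add[OF r] balanced_map.add_right[OF t])
  next
    case (4 M k u v)
    then show ?case by (simp add: cl linear_smult[OF l] balanced_map.smult_left[OF t])
  next
    case (5 M k u v)
    then show ?case by (simp add: cl linear_smult[OF r] balanced_map.smult_right[OF t])
  next
    case (6 M M' k u v)
    then show ?case
      using XY balanced_map.dinatural[OF t 6(1-3), of "cov \<C> Fm M' Y Y' g u" "contrav \<C> (ext_map \<C>) M X X' f v"]
      by (simp add: cl Fun.cov_contrav Ext.cov_contrav)
  qed
qed

lemma act_gens:
  assumes XY: "X \<in> obj \<C>" "X' \<in> obj \<C>" "Y \<in> obj \<C>" "Y' \<in> obj \<C>" "f \<in> mor \<C> X' X" "g \<in> mor \<C> Y Y'"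
  shows "(\<lambda>(M, u, v). (M, cov \<C> Fm M Y Y' g u, contrav \<C> (ext_map \<C>) M X X' f v))
    \<in> coend_gens \<C> (\<lambda>M. F M Y) (\<lambda>M. Ext \<C> X M) \<rightarrow> coend_gens \<C> (\<lambda>M. F M Y') (\<lambda>M. Ext \<C> X' M)"
  using XY by (auto simp: coend_gens_def intro!: Fun.cov_closed Ext.contrav_closed)

lemma act_linear:
  assumes "X \<in> obj \<C>" "X' \<in> obj \<C>" "Y \<in> obj \<C>" "Y' \<in> obj \<C>" "f \<in> mor \<C> X' X" "g \<in> mor \<C> Y Y'"
  shows "act X X' Y Y' f g \<in> linear_maps R (ext X Y) (ext X' Y')"
  unfolding act_def[abs_def]
  by (rule step_map_lift(1)[OF extension_step_axioms extension_step_axioms _ _ _ _ act_gens act_balanced])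
    (use assms in auto)

lemma act_tens:
  assumes "X \<in> obj \<C>" "X' \<in> obj \<C>" "Y \<in> obj \<C>" "Y' \<in> obj \<C>" "f \<in> mor \<C> X' X" "g \<in> mor \<C> Y Y'"
    "M \<in> obj \<C>" "u \<in> carrier (F M Y)" "v \<in> carrier (Ext \<C> X M)"
  shows "act X X' Y Y' f g (tens X Y (M, u, v))
    = tens X' Y' (M, cov \<C> Fm M Y Y' g u, contrav \<C> (ext_map \<C>) M X X' f v)"
  unfolding act_def
  using step_map_lift(2)[OF extension_step_axioms extension_step_axioms _ _ _ _ act_gens act_balanced] assms
  by simp

lemma act_bilinear: "bilinear_functor R \<C> ext act"
proof (rule bilinear_functor.intro, rule linear_category_axioms, rule bilinear_functor_axioms.intro)
  { fix X Y assume "X \<in> obj \<C>" "Y \<in> obj \<C>"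
    then show "module R (ext X Y)" by (rule ext_module) }
  { fix X X' Y Y' f g
    assume a: "X \<in> obj \<C>" "X' \<in> obj \<C>" "Y \<in> obj \<C>" "Y' \<in> obj \<C>" "f \<in> mor \<C> X' X" "g \<in> mor \<C> Y Y'"
    then show "act X X' Y Y' f g \<in> linear_maps R (ext X Y) (ext X' Y')" by (rule act_linear) }
  note act_linear [intro]
  { fix X Y w assume a: "X \<in> obj \<C>" "Y \<in> obj \<C>" "w \<in> carrier (ext X Y)"
    show "act X X Y Y (idn \<C> X) (idn \<C> Y) w = w"
    proof (rule ext_linear_eq[OF a(1,2) ext_module[OF a(1,2)] act_linear _ _ a(3)])
      show "(\<lambda>w. w) \<in> linear_maps R (ext X Y) (ext X Y)" by (intro linearI) auto
    qed (use a in \<open>auto simp: act_tens idn_mor Fun.cov_idn Ext.contrav_idn\<close>) }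
  { fix X X' X'' Y Y' Y'' f f' g g' w
    assume a: "X \<in> obj \<C>" "X' \<in> obj \<C>" "X'' \<in> obj \<C>" "Y \<in> obj \<C>" "Y' \<in> obj \<C>" "Y'' \<in> obj \<C>"
      "f \<in> mor \<C> X' X" "f' \<in> mor \<C> X'' X'" "g \<in> mor \<C> Y Y'" "g' \<in> mor \<C> Y' Y''" "w \<in> carrier (ext X Y)"
    have fg: "f \<cdot>\<^bsub>\<C>\<^esub> f' \<in> mor \<C> X'' X" "g' \<cdot>\<^bsub>\<C>\<^esub> g \<in> mor \<C> Y Y''"
      using a cmp_closed by blast+
    show "act X X'' Y Y'' (f \<cdot>\<^bsub>\<C>\<^esub> f') (g' \<cdot>\<^bsub>\<C>\<^esub> g) w = act X' X'' Y' Y'' f' g' (act X X' Y Y' f g w)"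
    proof (rule ext_linear_eq[OF a(1,4) ext_module[OF a(3,6)] act_linear linear_comp[OF act_linear act_linear] _ a(11)])
      fix M u v
      assume m: "M \<in> obj \<C>" "u \<in> carrier (F M Y)" "v \<in> carrier (Ext \<C> X M)"
      show "act X X'' Y Y'' (f \<cdot>\<^bsub>\<C>\<^esub> f') (g' \<cdot>\<^bsub>\<C>\<^esub> g) (tens X Y (M, u, v))
          = act X' X'' Y' Y'' f' g' (act X X' Y Y' f g (tens X Y (M, u, v)))"
        using a m fg
        by (simp add: act_tens Fun.cov_closed Ext.contrav_closed Fun.cov_cmp Ext.contrav_cmp)
    qed (use a fg in auto) }
  note tc = tens_closed balanced_map.add_left[OF tens_balanced] balanced_map.add_right[OF tens_balanced]
    balanced_map.smult_left[OF tens_balanced] balanced_map.smult_right[OF tens_balanced]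
    madd_closed[OF Hom_module] msmult_closed[OF Hom_module]
  { fix X X' Y Y' g w
    assume a: "X \<in> obj \<C>" "X' \<in> obj \<C>" "Y \<in> obj \<C>" "Y' \<in> obj \<C>" "g \<in> mor \<C> Y Y'" "w \<in> carrier (ext X Y)"
    show "(\<lambda>f. act X X' Y Y' f g w) \<in> linear_maps R (Hom \<C> X' X) (ext X' Y')"
    proof (rule ext_linear_in_parameter[OF a(1,3) ext_module[OF a(2,4)] Hom_module[OF a(2,1)]
          act_linear[OF a(1-4) _ a(5)] _ a(6)])
      fix M u v
      assume m: "M \<in> obj \<C>" "u \<in> carrier (F M Y)" "v \<in> carrier (Ext \<C> X M)"
      have l: "(\<lambda>f. contrav \<C> (ext_map \<C>) M X X' f v) \<in> linear_maps R (Hom \<C> X' X) (Ext \<C> X' M)"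
        unfolding contrav_def by (rule Fm_bilinear_left) (use a m idn_mor in auto)
      show "(\<lambda>f. act X X' Y Y' f g (tens X Y (M, u, v))) \<in> linear_maps R (Hom \<C> X' X) (ext X' Y')"
        using a m
        by (intro linearI)
          (auto simp: act_tens Fun.cov_closed linear_closed[OF l] linear_add[OF l] linear_smult[OF l] tc)
    qed }
  { fix X X' Y Y' f w
    assume a: "X \<in> obj \<C>" "X' \<in> obj \<C>" "Y \<in> obj \<C>" "Y' \<in> obj \<C>" "f \<in> mor \<C> X' X" "w \<in> carrier (ext X Y)"
    show "(\<lambda>g. act X X' Y Y' f g w) \<in> linear_maps R (Hom \<C> Y Y') (ext X' Y')"
    proof (rule ext_linear_in_parameter[OF a(1,3) ext_module[OF a(2,4)] Hom_module[OF a(3,4)]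
          act_linear[OF a(1-5)] _ a(6)])
      fix M u v
      assume m: "M \<in> obj \<C>" "u \<in> carrier (F M Y)" "v \<in> carrier (Ext \<C> X M)"
      have l: "(\<lambda>g. cov \<C> Fm M Y Y' g u) \<in> linear_maps R (Hom \<C> Y Y') (F M Y')"
        unfolding cov_def by (rule Fun.Fm_bilinear_right) (use a m idn_mor in auto)
      show "(\<lambda>g. act X X' Y Y' f g (tens X Y (M, u, v))) \<in> linear_maps R (Hom \<C> Y Y') (ext X' Y')"
        using a m
        by (intro linearI)
          (auto simp: act_tens contrav_closed linear_closed[OF l] linear_add[OF l] linear_smult[OF l] tc)
    qed }
qed

end


section \<open>Positive extensions and cup products\<close>

locale extension_tower = bilinear_functor R \<C> "Ext \<C>" "ext_map \<C>"
  for R :: "('r, 'q) ring_scheme" and \<C> :: "('r, 'o, 'm, 'e, 'z) excat_scheme"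
begin

abbreviation "E \<equiv> PExt R \<C>"
abbreviation "Em \<equiv> PExt_act R \<C>"

lemma E_step:
  assumes "bilinear_functor R \<C> (E (Suc n)) (Em (Suc n))"
  shows "extension_step R \<C> (E (Suc n)) (Em (Suc n))"
    and "E (Suc (Suc n)) = extension_step.ext R \<C> (E (Suc n)) (Em (Suc n))"
    and "Em (Suc (Suc n)) = extension_step.act R \<C> (E (Suc n)) (Em (Suc n))"
proof -
  show *: "extension_step R \<C> (E (Suc n)) (Em (Suc n))"
    by (rule extension_step.intro[OF bilinear_functor_axioms assms])
  show "E (Suc (Suc n)) = extension_step.ext R \<C> (E (Suc n)) (Em (Suc n))"
    by (intro ext) (simp add: extension_step.ext_def[OF *])
  show "Em (Suc (Suc n)) = extension_step.act R \<C> (E (Suc n)) (Em (Suc n))"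
    by (intro ext) (simp add: extension_step.act_def[OF *] Let_def)
qed

lemma E_bilinear: "bilinear_functor R \<C> (E n) (Em n)"
proof (induction n rule: induct_nat_012)
  case 0
  show ?case using bilinear_functor.transport_bilinear_functor[OF Hom_bilinear_functor, of un_XHom XHom]
    by simp
next
  case 1
  show ?case using transport_bilinear_functor[of un_XExt XExt] by simp
next
  case (ge2 n)
  show ?case
    unfolding E_step(2,3)[OF ge2(2)] by (rule extension_step.act_bilinear[OF E_step(1)[OF ge2(2)]])
qed

lemmas E_module = bilinear_functor.F_module[OF E_bilinear]
lemmas Step = E_step[OF E_bilinear]

lemma E0_simps:
  assumes "X \<in> obj \<C>" "Y \<in> obj \<C>"
  shows "carrier (E 0 X Y) = XHom ` mor \<C> X Y"
    and "\<zero>\<^bsub>E 0 X Y\<^esub> = XHom \<zero>\<^bsub>Hom \<C> X Y\<^esub>"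
    and "\<lbrakk>u \<in> mor \<C> X Y; v \<in> mor \<C> X Y\<rbrakk> \<Longrightarrow> XHom u \<oplus>\<^bsub>E 0 X Y\<^esub> XHom v = XHom (u \<oplus>\<^bsub>Hom \<C> X Y\<^esub> v)"
    and "u \<in> mor \<C> X Y \<Longrightarrow> r \<odot>\<^bsub>E 0 X Y\<^esub> XHom u = XHom (r \<odot>\<^bsub>Hom \<C> X Y\<^esub> u)"
  using transport_simps[of XHom "Hom \<C> X Y"] by (auto simp: inj_on_def)

lemma E1_simps:
  assumes "X \<in> obj \<C>" "Y \<in> obj \<C>"
  shows "carrier (E (Suc 0) X Y) = XExt ` carrier (Ext \<C> X Y)"
    and "\<zero>\<^bsub>E (Suc 0) X Y\<^esub> = XExt \<zero>\<^bsub>Ext \<C> X Y\<^esub>"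
    and "\<lbrakk>u \<in> carrier (Ext \<C> X Y); v \<in> carrier (Ext \<C> X Y)\<rbrakk>
      \<Longrightarrow> XExt u \<oplus>\<^bsub>E (Suc 0) X Y\<^esub> XExt v = XExt (u \<oplus>\<^bsub>Ext \<C> X Y\<^esub> v)"
    and "u \<in> carrier (Ext \<C> X Y) \<Longrightarrow> r \<odot>\<^bsub>E (Suc 0) X Y\<^esub> XExt u = XExt (r \<odot>\<^bsub>Ext \<C> X Y\<^esub> u)"
  using transport_simps[of XExt "Ext \<C> X Y"] by (auto simp: inj_on_def)

text \<open>
  The element \<open>du n X M v Y u\<close> is \<open>u \<union> v\<close>.  So \<open>\<delta>\<^sup>\<sharp>\<close> has two roles: as a function of \<open>u\<close> it is the
  connecting map of \<open>v\<close>, and as a function of the triple \<open>(M, u, v)\<close> it is the universal balanced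
  map into \<open>\<bbbE>\<^sup>n\<^sup>+\<^sup>1(X, Y) = \<integral>\<^sup>M \<bbbE>\<^sup>n(M, Y) \<otimes> \<bbbE>(X, M)\<close>, also for \<open>n = 0\<close>.
\<close>

abbreviation "ecov n \<equiv> cov \<C> (Em n)"
abbreviation "econ n \<equiv> contrav \<C> (Em n)"
abbreviation "xcov \<equiv> cov \<C> (ext_map \<C>)"
abbreviation "xcon \<equiv> contrav \<C> (ext_map \<C>)"
abbreviation "du n X M v Y u \<equiv> delta_upper R \<C> n X M v Y u"
abbreviation "dl n C A d X u \<equiv> delta_lower R \<C> n C A d X u"

lemma ecov_0: "\<lbrakk>X \<in> obj \<C>; Y \<in> obj \<C>; Y' \<in> obj \<C>; f \<in> mor \<C> X Y; g \<in> mor \<C> Y Y'\<rbrakk>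
    \<Longrightarrow> ecov 0 X Y Y' g (XHom f) = XHom (g \<cdot>\<^bsub>\<C>\<^esub> f)"
  using cmp_closed[of X Y Y' f g] by (simp add: cov_def Hom_act_def cmp_idn_right)

lemma econ_0:
  assumes "X \<in> obj \<C>" "X' \<in> obj \<C>" "Y \<in> obj \<C>" "f \<in> mor \<C> X Y" "g \<in> mor \<C> X' X"
  shows "econ 0 Y X X' g (XHom f) = XHom (f \<cdot>\<^bsub>\<C>\<^esub> g)"
  using assms by (simp add: contrav_def Hom_act_def cmp_idn_left)

lemma ecov_1: "ecov (Suc 0) X Y Y' g (XExt d) = XExt (xcov X Y Y' g d)"
  by (simp add: cov_def)

lemma econ_1: "econ (Suc 0) Y X X' f (XExt d) = XExt (xcon Y X X' f d)"
  by (simp add: contrav_def)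

lemma du_0: "du 0 X M v Y (XHom u) = XExt (xcov X M Y u v)"
  by (simp add: delta_upper_def cov_def)

declare PExt.simps [simp del] PExt_act.simps [simp del]

lemma du_Suc: "du (Suc n) X M v Y u = extension_step.tens R \<C> (E (Suc n)) (Em (Suc n)) X Y (M, u, v)"
  by (simp add: delta_upper_def extension_step.tens_def[OF Step(1)])

abbreviation balanced where
  "balanced n X Y N h \<equiv> balanced_map R \<C> (\<lambda>M. E n M Y) (econ n Y) (\<lambda>M. Ext \<C> X M) (xcov X) N h"

lemma du_balanced:
  assumes XY: "X \<in> obj \<C>" "Y \<in> obj \<C>"
  shows "balanced n X Y (E (Suc n) X Y) (\<lambda>(M, u, v). du n X M v Y u)"
proof (cases n)
  case 0
  show ?thesis unfolding 0
  proof (rule balanced_map.intro, goal_cases)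
    case (1 M u v)
    then show ?case using XY by (auto simp: du_0 E0_simps E1_simps cov_closed)
  next
    case (2 M u u' v)
    have l: "(\<lambda>f. xcov X M Y f v) \<in> linear_maps R (Hom \<C> M Y) (Ext \<C> X Y)"
      unfolding cov_def by (rule Fm_bilinear_right) (use 2 XY idn_mor in auto)
    show ?case using 2 XY
      by (auto simp: du_0 E0_simps E1_simps cov_closed linear_add[OF l])
  next
    case (3 M u v v')
    then show ?case using XY by (auto simp: du_0 E0_simps E1_simps cov_closed linear_add[OF cov_linear])
  next
    case (4 M r u v)
    have l: "(\<lambda>f. xcov X M Y f v) \<in> linear_maps R (Hom \<C> M Y) (Ext \<C> X Y)"
      unfolding cov_def by (rule Fm_bilinear_right) (use 4 XY idn_mor in auto)
    show ?case using 4 XY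
      by (auto simp: du_0 E0_simps E1_simps cov_closed linear_smult[OF l])
  next
    case (5 M r u v)
    then show ?case using XY by (auto simp: du_0 E0_simps E1_simps cov_closed linear_smult[OF cov_linear])
  next
    case (6 M M' f u v)
    then show ?case using XY by (auto simp: E0_simps econ_0 du_0 cov_cmp)
  qed
next
  case (Suc k)
  show ?thesis
    unfolding Suc Step(2)
    using extension_step.tens_balanced[OF Step(1) XY, of k] by (simp add: du_Suc case_prod_beta)
qed

text \<open>
  For \<open>n = 0\<close> this is the co-Yoneda lemma: \<open>f \<union> v = id \<union> f\<^sub>* v\<close> forces the value at the identity.
\<close>

lemma du_lift:
  assumes XY: "X \<in> obj \<C>" "Y \<in> obj \<C>" and N: "module R N" and h: "balanced n X Y N h"
  obtains H where "H \<in> linear_maps R (E (Suc n) X Y) N"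
    and "\<And>M u v. \<lbrakk>M \<in> obj \<C>; u \<in> carrier (E n M Y); v \<in> carrier (Ext \<C> X M)\<rbrakk>
      \<Longrightarrow> H (du n X M v Y u) = h (M, u, v)"
proof (cases n)
  case 0
  note h = h[unfolded 0]
  have id: "XHom (idn \<C> Y) \<in> carrier (E 0 Y Y)" using XY idn_mor by (simp add: E0_simps)
  let ?H = "\<lambda>w. h (Y, XHom (idn \<C> Y), un_XExt w)"
  show ?thesis
  proof (rule that)
    show "?H \<in> linear_maps R (E (Suc n) X Y) N" unfolding 0
      using balanced_map.closed[OF h XY(2) id] balanced_map.add_right[OF h XY(2) id]
        balanced_map.smult_right[OF h XY(2) _ id] XY
      by (intro linearI) (auto simp: E1_simps)
    fix M u v
    assume m: "M \<in> obj \<C>" "u \<in> carrier (E n M Y)" "v \<in> carrier (Ext \<C> X M)"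
    then obtain f where f: "f \<in> mor \<C> M Y" "u = XHom f" using XY 0 by (auto simp: E0_simps)
    show "?H (du n X M v Y u) = h (M, u, v)"
      unfolding 0 f using balanced_map.dinatural[OF h m(1) XY(2) f(1) id m(3)] f(1) XY m(1)
      by (simp add: du_0 econ_0[OF XY(2) m(1) XY(2)] idn_mor cmp_idn_left)
  qed
next
  case (Suc k)
  show ?thesis
    by (rule extension_step.ext_lift[OF Step(1) XY N h[unfolded Suc]], rule that)
      (simp_all add: Suc du_Suc Step(2))
qed

lemma du_linear_eq:
  assumes XY: "X \<in> obj \<C>" "Y \<in> obj \<C>" and N: "module R N"
    and f: "f \<in> linear_maps R (E (Suc n) X Y) N" and g: "g \<in> linear_maps R (E (Suc n) X Y) N"
    and eq: "\<And>M u v. \<lbrakk>M \<in> obj \<C>; u \<in> carrier (E n M Y); v \<in> carrier (Ext \<C> X M)\<rbrakk>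
      \<Longrightarrow> f (du n X M v Y u) = g (du n X M v Y u)"
    and w: "w \<in> carrier (E (Suc n) X Y)"
  shows "f w = g w"
proof (cases n)
  case 0
  from w obtain v where v: "v \<in> carrier (Ext \<C> X Y)" "w = XExt v" using XY by (auto simp: 0 E1_simps)
  have "du n X Y v Y (XHom (idn \<C> Y)) = w" using v XY by (simp add: 0 du_0 cov_idn)
  then show ?thesis using eq[OF XY(2) _ v(1), of "XHom (idn \<C> Y)"] XY idn_mor 0 by (simp add: E0_simps)
next
  case (Suc k)
  show ?thesis
    by (rule extension_step.ext_linear_eq[OF Step(1) XY N f[unfolded Suc Step(2)] g[unfolded Suc Step(2)] _
          w[unfolded Suc Step(2)]])
      (use eq in \<open>simp add: Suc du_Suc\<close>)
qed

lemma du_induct [consumes 3, case_names zero tensor add]: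
  assumes XY: "X \<in> obj \<C>" "Y \<in> obj \<C>" and w: "w \<in> carrier (E (Suc n) X Y)"
    and zero: "W \<zero>\<^bsub>E (Suc n) X Y\<^esub>"
    and tensor: "\<And>M u v. \<lbrakk>M \<in> obj \<C>; u \<in> carrier (E n M Y); v \<in> carrier (Ext \<C> X M)\<rbrakk>
      \<Longrightarrow> W (du n X M v Y u)"
    and add: "\<And>w w'. \<lbrakk>w \<in> carrier (E (Suc n) X Y); w' \<in> carrier (E (Suc n) X Y); W w; W w'\<rbrakk>
      \<Longrightarrow> W (w \<oplus>\<^bsub>E (Suc n) X Y\<^esub> w')"
  shows "W w"
proof (cases n)
  case 0
  from w obtain v where v: "v \<in> carrier (Ext \<C> X Y)" "w = XExt v" using XY by (auto simp: 0 E1_simps)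
  have "du n X Y v Y (XHom (idn \<C> Y)) = w" using v XY by (simp add: 0 du_0 cov_idn)
  then show ?thesis using tensor[OF XY(2) _ v(1), of "XHom (idn \<C> Y)"] XY idn_mor 0 by (simp add: E0_simps)
next
  case (Suc k)
  show ?thesis
  proof (rule extension_step.ext_induct[OF Step(1) XY w[unfolded Suc Step(2)]])
    show "W \<zero>\<^bsub>extension_step.ext R \<C> (E (Suc k)) (Em (Suc k)) X Y\<^esub>"
      using zero by (simp add: Suc Step(2))
  qed (use tensor add in \<open>simp_all add: Suc Step(2) du_Suc\<close>)
qed

lemma du_act:
  assumes "X \<in> obj \<C>" "X' \<in> obj \<C>" "Y \<in> obj \<C>" "Y' \<in> obj \<C>" "f \<in> mor \<C> X' X" "g \<in> mor \<C> Y Y'"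
    "M \<in> obj \<C>" "u \<in> carrier (E n M Y)" "v \<in> carrier (Ext \<C> X M)"
  shows "Em (Suc n) X X' Y Y' f g (du n X M v Y u) = du n X' M (xcon M X X' f v) Y' (ecov n M Y Y' g u)"
proof (cases n)
  case 0
  then obtain k where k: "k \<in> mor \<C> M Y" "u = XHom k" using assms by (auto simp: E0_simps)
  then show ?thesis using assms
    by (simp add: 0 du_0 ecov_0 PExt_act.simps(2) Fm_cov_contrav(1) cov_closed cov_contrav[symmetric] contrav_closed cov_cmp)
next
  case (Suc k)
  then show ?thesis
    using extension_step.act_tens[OF Step(1) assms(1-7), of u k v] assms(8,9) by (simp only: du_Suc Step(3) Suc)
qed

lemma du_cov:
  assumes "X \<in> obj \<C>" "Y \<in> obj \<C>" "Y' \<in> obj \<C>" "g \<in> mor \<C> Y Y'"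
    "M \<in> obj \<C>" "u \<in> carrier (E n M Y)" "v \<in> carrier (Ext \<C> X M)"
  shows "ecov (Suc n) X Y Y' g (du n X M v Y u) = du n X M v Y' (ecov n M Y Y' g u)"
  unfolding cov_def[of _ "Em (Suc n)"]
  using du_act[of X X Y Y' "idn \<C> X" g M u n v] assms by (simp add: idn_mor contrav_idn)

lemma du_contrav:
  assumes "X \<in> obj \<C>" "X' \<in> obj \<C>" "Y \<in> obj \<C>" "f \<in> mor \<C> X' X"
    "M \<in> obj \<C>" "u \<in> carrier (E n M Y)" "v \<in> carrier (Ext \<C> X M)"
  shows "econ (Suc n) Y X X' f (du n X M v Y u) = du n X' M (xcon M X X' f v) Y u"
  unfolding contrav_def[of _ "Em (Suc n)"]
  using du_act[of X X' Y Y f "idn \<C> Y" M u n v] assms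
  by (simp add: idn_mor bilinear_functor.cov_idn[OF E_bilinear])

lemma du_dinatural:
  assumes "X \<in> obj \<C>" "Y \<in> obj \<C>" "M \<in> obj \<C>" "M' \<in> obj \<C>" "f \<in> mor \<C> M M'"
    "u \<in> carrier (E n M' Y)" "v \<in> carrier (Ext \<C> X M)"
  shows "du n X M v Y (econ n Y M' M f u) = du n X M' (xcov X M M' f v) Y u"
  using balanced_map.dinatural[OF du_balanced assms(3-7)] assms(1,2) by simp

lemma du_linear:
  assumes "X \<in> obj \<C>" "Y \<in> obj \<C>" "M \<in> obj \<C>" "v \<in> carrier (Ext \<C> X M)"
  shows "delta_upper R \<C> n X M v Y \<in> linear_maps R (E n M Y) (E (Suc n) X Y)"
  using balanced_map.closed[OF du_balanced[OF assms(1,2)] assms(3) _ assms(4)]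
    balanced_map.add_left[OF du_balanced[OF assms(1,2)] assms(3) _ _ assms(4)]
    balanced_map.smult_left[OF du_balanced[OF assms(1,2)] assms(3) _ _ assms(4)]
  by (intro linearI) auto

lemma du_linear_right:
  assumes "X \<in> obj \<C>" "Y \<in> obj \<C>" "M \<in> obj \<C>" "u \<in> carrier (E n M Y)"
  shows "(\<lambda>v. du n X M v Y u) \<in> linear_maps R (Ext \<C> X M) (E (Suc n) X Y)"
  using balanced_map.closed[OF du_balanced[OF assms(1,2)] assms(3,4)]
    balanced_map.add_right[OF du_balanced[OF assms(1,2)] assms(3,4)]
    balanced_map.smult_right[OF du_balanced[OF assms(1,2)] assms(3) _ assms(4)]
  by (intro linearI) auto

lemma du_closed:
  "\<lbrakk>X \<in> obj \<C>; Y \<in> obj \<C>; M \<in> obj \<C>; v \<in> carrier (Ext \<C> X M); u \<in> carrier (E n M Y)\<rbrakk>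
    \<Longrightarrow> du n X M v Y u \<in> carrier (E (Suc n) X Y)"
  by (rule linear_closed[OF du_linear])

end


context extension_tower
begin

lemma dl_0: "dl 0 C A d X (XHom f) = XExt (xcon A C X f d)"
  by (simp add: delta_lower_def econ_1)

lemma dl_1: "dl (Suc 0) C A d X (XExt e) = du (Suc 0) X C e A (XExt d)"
  by (simp add: delta_lower_def delta_upper_def)

lemma dl_Suc_Suc:
  "dl (Suc (Suc t)) C A d X l = coset_name R (step_coend_map R \<C> (E (Suc (Suc t))) (Em (Suc (Suc t))) X A
     (\<lambda>(N, u, v). (N, dl (Suc t) C A d N u, v))
     (inv_into (carrier (step_coend R \<C> (E (Suc t)) (Em (Suc t)) X C)) (coset_name R) l))"
  by (simp add: delta_lower_def Let_def)

text \<open>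
  Linearity, naturality and the formula on generators depend on each other.  Naturality and linearity in degree
  \<open>n\<close> say that \<open>(M, u, v) \<mapsto> \<delta>\<^sub>\<sharp> u \<union> v\<close> is balanced, which makes \<open>\<delta>\<^sub>\<sharp>\<close> in degree \<open>n + 1\<close> well defined and
  linear with the stated values on generators; these values then yield naturality in degree \<open>n + 1\<close>.
\<close>

lemma dl_facts:
  assumes d: "A \<in> obj \<C>" "C \<in> obj \<C>" "d \<in> carrier (Ext \<C> C A)"
  shows "(\<forall>X\<in>obj \<C>. delta_lower R \<C> n C A d X \<in> linear_maps R (E n X C) (E (Suc n) X A)) \<and>
    (\<forall>X\<in>obj \<C>. \<forall>X'\<in>obj \<C>. \<forall>f\<in>mor \<C> X' X. \<forall>u\<in>carrier (E n X C).
       dl n C A d X' (econ n C X X' f u) = econ (Suc n) A X X' f (dl n C A d X u)) \<and>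
    (\<forall>X\<in>obj \<C>. \<forall>M\<in>obj \<C>. \<forall>u\<in>carrier (E n M C). \<forall>v\<in>carrier (Ext \<C> X M).
       dl (Suc n) C A d X (du n X M v C u) = du (Suc n) X M v A (dl n C A d M u))"
proof -
  define L where "L n \<longleftrightarrow> (\<forall>X\<in>obj \<C>. delta_lower R \<C> n C A d X \<in> linear_maps R (E n X C) (E (Suc n) X A))" for n
  define N where "N n \<longleftrightarrow> (\<forall>X\<in>obj \<C>. \<forall>X'\<in>obj \<C>. \<forall>f\<in>mor \<C> X' X. \<forall>u\<in>carrier (E n X C).
       dl n C A d X' (econ n C X X' f u) = econ (Suc n) A X X' f (dl n C A d X u))" for n
  define T where "T n \<longleftrightarrow> (\<forall>X\<in>obj \<C>. \<forall>M\<in>obj \<C>. \<forall>u\<in>carrier (E n M C). \<forall>v\<in>carrier (Ext \<C> X M).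
       dl (Suc n) C A d X (du n X M v C u) = du (Suc n) X M v A (dl n C A d M u))" for n
  have L0: "L 0"
    unfolding L_def
  proof (intro ballI linearI)
    fix X assume X: "X \<in> obj \<C>"
    have l: "(\<lambda>f. xcon A C X f d) \<in> linear_maps R (Hom \<C> X C) (Ext \<C> X A)"
      unfolding contrav_def by (rule Fm_bilinear_left) (use d X idn_mor in auto)
    show "dl 0 C A d X u \<in> carrier (E (Suc 0) X A)" if "u \<in> carrier (E 0 X C)" for u
      using that d X by (auto simp: E0_simps E1_simps dl_0 contrav_closed)
    show "dl 0 C A d X (u \<oplus>\<^bsub>E 0 X C\<^esub> v) = dl 0 C A d X u \<oplus>\<^bsub>E (Suc 0) X A\<^esub> dl 0 C A d X v"
      if "u \<in> carrier (E 0 X C)" "v \<in> carrier (E 0 X C)" for u v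
      using that d X by (auto simp: E0_simps E1_simps dl_0 contrav_closed linear_add[OF l])
    show "dl 0 C A d X (r \<odot>\<^bsub>E 0 X C\<^esub> u) = r \<odot>\<^bsub>E (Suc 0) X A\<^esub> dl 0 C A d X u"
      if "r \<in> carrier R" "u \<in> carrier (E 0 X C)" for r u
      using that d X by (auto simp: E0_simps E1_simps dl_0 contrav_closed linear_smult[OF l])
  qed
  have N0: "N 0"
    unfolding N_def using d by (auto simp: E0_simps dl_0 econ_0 econ_1 contrav_cmp)
  have step: "T n \<and> L (Suc n)" if LN: "L n" "N n" for n
  proof (cases n)
    case 0
    have "T 0"
      unfolding T_def
    proof (intro ballI)
      fix X M u v
      assume a: "X \<in> obj \<C>" "M \<in> obj \<C>" "u \<in> carrier (E 0 M C)" "v \<in> carrier (Ext \<C> X M)"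
      then obtain f where f: "f \<in> mor \<C> M C" "u = XHom f" using d by (auto simp: E0_simps)
      have dd: "XExt d \<in> carrier (E (Suc 0) C A)" using d by (simp add: E1_simps)
      show "dl (Suc 0) C A d X (du 0 X M v C u) = du (Suc 0) X M v A (dl 0 C A d M u)"
        using du_dinatural[OF a(1) d(1) a(2) d(2) f(1) dd a(4)] f(2)
        by (simp add: du_0 dl_1 dl_0 econ_1)
    qed
    moreover have "L (Suc 0)"
      unfolding L_def
    proof (intro ballI linearI)
      fix X assume X: "X \<in> obj \<C>"
      have dd: "XExt d \<in> carrier (E (Suc 0) C A)" using d by (simp add: E1_simps)
      note l = du_linear_right[OF X d(1,2) dd]
      show "dl (Suc 0) C A d X u \<in> carrier (E (Suc (Suc 0)) X A)" if "u \<in> carrier (E (Suc 0) X C)" for u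
        using that d X by (auto simp: E1_simps dl_1 linear_closed[OF l])
      show "dl (Suc 0) C A d X (u \<oplus>\<^bsub>E (Suc 0) X C\<^esub> v)
          = dl (Suc 0) C A d X u \<oplus>\<^bsub>E (Suc (Suc 0)) X A\<^esub> dl (Suc 0) C A d X v"
        if "u \<in> carrier (E (Suc 0) X C)" "v \<in> carrier (E (Suc 0) X C)" for u v
        using that d X by (auto simp: E1_simps dl_1 linear_add[OF l])
      show "dl (Suc 0) C A d X (r \<odot>\<^bsub>E (Suc 0) X C\<^esub> u) = r \<odot>\<^bsub>E (Suc (Suc 0)) X A\<^esub> dl (Suc 0) C A d X u"
        if "r \<in> carrier R" "u \<in> carrier (E (Suc 0) X C)" for r u
        using that d X by (auto simp: E1_simps dl_1 linear_smult[OF l])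
    qed
    ultimately show ?thesis using 0 by simp
  next
    case (Suc k)
    let ?h = "\<lambda>(M, u, v). (M, dl (Suc k) C A d M u, v)"
    have l: "delta_lower R \<C> (Suc k) C A d M \<in> linear_maps R (E (Suc k) M C) (E (Suc (Suc k)) M A)"
      if "M \<in> obj \<C>" for M
      using LN(1) that unfolding L_def Suc by blast
    note cl = linear_closed[OF l]
    have main: "delta_lower R \<C> (Suc (Suc k)) C A d X \<in> linear_maps R (E (Suc (Suc k)) X C) (E (Suc (Suc (Suc k))) X A)"
      "\<And>M u v. \<lbrakk>M \<in> obj \<C>; u \<in> carrier (E (Suc k) M C); v \<in> carrier (Ext \<C> X M)\<rbrakk>
        \<Longrightarrow> dl (Suc (Suc k)) C A d X (du (Suc k) X M v C u) = du (Suc (Suc k)) X M v A (dl (Suc k) C A d M u)"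
      if X: "X \<in> obj \<C>" for X
    proof -
      have bal: "balanced (Suc k) X C (E (Suc (Suc (Suc k))) X A)
        (\<lambda>g. extension_step.tens R \<C> (E (Suc (Suc k))) (Em (Suc (Suc k))) X A (?h g))"
      proof -
        note b = du_balanced[OF X d(1), of "Suc (Suc k)"]
        have "balanced (Suc k) X C (E (Suc (Suc (Suc k))) X A)
          (\<lambda>(M, u, v). du (Suc (Suc k)) X M v A (dl (Suc k) C A d M u))"
        proof (rule balanced_map.intro, goal_cases)
          case (1 M u v)
          then show ?case using balanced_map.closed[OF b] cl by simp
        next
          case (2 M u u' v)
          then show ?case using balanced_map.add_left[OF b] cl by (simp add: linear_add[OF l])
        next
          case (3 M u v v')
          then show ?case using balanced_map.add_right[OF b] cl by simp
        next
          case (4 M r u v)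
          then show ?case using balanced_map.smult_left[OF b] cl by (simp add: linear_smult[OF l])
        next
          case (5 M r u v)
          then show ?case using balanced_map.smult_right[OF b] cl by simp
        next
          case (6 M M' f u v)
          have "dl (Suc k) C A d M (econ (Suc k) C M' M f u) = econ (Suc (Suc k)) A M' M f (dl (Suc k) C A d M' u)"
            using LN(2) 6 unfolding N_def Suc by blast
          then show ?case using balanced_map.dinatural[OF b 6(1-3) cl[OF 6(2,4)] 6(5)] by simp
        qed
        then show ?thesis by (simp add: du_Suc case_prod_unfold)
      qed
      have g: "?h \<in> coend_gens \<C> (\<lambda>M. E (Suc k) M C) (\<lambda>M. Ext \<C> X M)
          \<rightarrow> coend_gens \<C> (\<lambda>M. E (Suc (Suc k)) M A) (\<lambda>M. Ext \<C> X M)"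
        by (auto simp: coend_gens_def cl)
      note m = step_map_lift[OF Step(1) Step(1) X d(2) X d(1) g bal[unfolded Step(2)[of "Suc k"]],
          folded dl_Suc_Suc Step(2)]
      show "delta_lower R \<C> (Suc (Suc k)) C A d X \<in> linear_maps R (E (Suc (Suc k)) X C) (E (Suc (Suc (Suc k))) X A)"
        using m(1) by simp
      show "dl (Suc (Suc k)) C A d X (du (Suc k) X M v C u) = du (Suc (Suc k)) X M v A (dl (Suc k) C A d M u)"
        if "M \<in> obj \<C>" "u \<in> carrier (E (Suc k) M C)" "v \<in> carrier (Ext \<C> X M)" for M u v
        using m(2)[OF that] by (simp add: du_Suc)
    qed
    show ?thesis unfolding T_def L_def Suc using main by blast
  qed
  have "L n \<and> N n"
  proof (induction n)
    case 0
    show ?case using L0 N0 by simp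
  next
    case (Suc n)
    then have T: "T n" and L': "L (Suc n)" and L: "L n" and N: "N n" using step by auto
    have "N (Suc n)"
      unfolding N_def
    proof (intro ballI)
      fix X X' f w
      assume a: "X \<in> obj \<C>" "X' \<in> obj \<C>" "f \<in> mor \<C> X' X" "w \<in> carrier (E (Suc n) X C)"
      note con = bilinear_functor.contrav_linear[OF E_bilinear]
      have l: "delta_lower R \<C> (Suc n) C A d M \<in> linear_maps R (E (Suc n) M C) (E (Suc (Suc n)) M A)"
        if "M \<in> obj \<C>" for M
        using L' that unfolding L_def by blast
      show "dl (Suc n) C A d X' (econ (Suc n) C X X' f w) = econ (Suc (Suc n)) A X X' f (dl (Suc n) C A d X w)"
      proof (rule du_linear_eq[OF a(1) d(2) E_module[OF a(2) d(1)]
            linear_comp[OF con[OF a(1,2) d(2) a(3)] l[OF a(2)]]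
            linear_comp[OF l[OF a(1)] con[OF a(1,2) d(1) a(3)]] _ a(4)])
        fix M u v
        assume m: "M \<in> obj \<C>" "u \<in> carrier (E n M C)" "v \<in> carrier (Ext \<C> X M)"
        have u: "dl n C A d M u \<in> carrier (E (Suc n) M A)"
          using linear_closed[OF L[unfolded L_def, rule_format, OF m(1)] m(2)] .
        have v: "xcon M X X' f v \<in> carrier (Ext \<C> X' M)" by (rule contrav_closed[OF a(1,2) m(1) a(3) m(3)])
        show "dl (Suc n) C A d X' (econ (Suc n) C X X' f (du n X M v C u))
            = econ (Suc (Suc n)) A X X' f (dl (Suc n) C A d X (du n X M v C u))"
          using T m a d u v unfolding T_def by (simp add: du_contrav)
      qed
    qed
    with L' show ?case by simp
  qed
  moreover from this have "T n" using step by blast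
  ultimately show ?thesis unfolding L_def N_def T_def by blast
qed

lemma dl_linear:
  assumes "A \<in> obj \<C>" "C \<in> obj \<C>" "d \<in> carrier (Ext \<C> C A)" "X \<in> obj \<C>"
  shows "delta_lower R \<C> n C A d X \<in> linear_maps R (E n X C) (E (Suc n) X A)"
  using dl_facts[OF assms(1-3)] assms(4) by blast

lemma dl_closed:
  assumes "A \<in> obj \<C>" "C \<in> obj \<C>" "d \<in> carrier (Ext \<C> C A)" "X \<in> obj \<C>" "u \<in> carrier (E n X C)"
  shows "dl n C A d X u \<in> carrier (E (Suc n) X A)"
  by (rule linear_closed[OF dl_linear[OF assms(1-4)] assms(5)])

lemma dl_natural:
  assumes "A \<in> obj \<C>" "C \<in> obj \<C>" "d \<in> carrier (Ext \<C> C A)"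
    "X \<in> obj \<C>" "X' \<in> obj \<C>" "f \<in> mor \<C> X' X" "u \<in> carrier (E n X C)"
  shows "dl n C A d X' (econ n C X X' f u) = econ (Suc n) A X X' f (dl n C A d X u)"
  using dl_facts[OF assms(1-3)] assms(4-) by blast

text \<open>The two connecting maps commute: both sides are \<open>d \<union> u \<union> v\<close>.\<close>

lemma dl_du:
  assumes "A \<in> obj \<C>" "C \<in> obj \<C>" "d \<in> carrier (Ext \<C> C A)"
    "X \<in> obj \<C>" "M \<in> obj \<C>" "u \<in> carrier (E n M C)" "v \<in> carrier (Ext \<C> X M)"
  shows "dl (Suc n) C A d X (du n X M v C u) = du (Suc n) X M v A (dl n C A d M u)"
  using dl_facts[OF assms(1-3)] assms(4-) by blast

lemmas E_cov_linear = bilinear_functor.cov_linear[OF E_bilinear]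
lemmas E_contrav_linear = bilinear_functor.contrav_linear[OF E_bilinear]
lemmas E_cov_closed = bilinear_functor.cov_closed[OF E_bilinear]
lemmas E_contrav_closed = bilinear_functor.contrav_closed[OF E_bilinear]

lemma dl_push:
  assumes "A \<in> obj \<C>" "A' \<in> obj \<C>" "C \<in> obj \<C>" "d \<in> carrier (Ext \<C> C A)" "a \<in> mor \<C> A A'"
    "X \<in> obj \<C>" "u \<in> carrier (E n X C)"
  shows "ecov (Suc n) X A A' a (dl n C A d X u) = dl n C A' (xcov C A A' a d) X u"
  using assms(6,7)
proof (induction n arbitrary: X u)
  case 0
  then show ?case using assms by (auto simp: E0_simps dl_0 ecov_1 cov_contrav)
next
  case (Suc n)
  note d = assms(1-5) cov_closed[OF assms(3,1,2,5,4)]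
  show ?case
  proof (rule du_linear_eq[OF Suc.prems(1) d(3) E_module[OF Suc.prems(1) d(2)]
        linear_comp[OF dl_linear E_cov_linear] dl_linear _ Suc.prems(2)])
    fix M u v
    assume m: "M \<in> obj \<C>" "u \<in> carrier (E n M C)" "v \<in> carrier (Ext \<C> X M)"
    then show "ecov (Suc (Suc n)) X A A' a (dl (Suc n) C A d X (du n X M v C u))
        = dl (Suc n) C A' (xcov C A A' a d) X (du n X M v C u)"
      using Suc d by (simp add: dl_du du_cov dl_closed)
  qed (use Suc.prems d in auto)
qed

lemma dl_pull:
  assumes "A \<in> obj \<C>" "C \<in> obj \<C>" "C' \<in> obj \<C>" "d \<in> carrier (Ext \<C> C' A)" "c \<in> mor \<C> C C'"
    "X \<in> obj \<C>" "u \<in> carrier (E n X C)"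
  shows "dl n C' A d X (ecov n X C C' c u) = dl n C A (xcon A C' C c d) X u"
  using assms(6,7)
proof (induction n arbitrary: X u)
  case 0
  then show ?case using assms by (auto simp: E0_simps dl_0 ecov_0 contrav_cmp)
next
  case (Suc n)
  note d = assms(1-5) contrav_closed[OF assms(3,2,1,5,4)]
  show ?case
  proof (rule du_linear_eq[OF Suc.prems(1) d(2) E_module[OF Suc.prems(1) d(1)]
        linear_comp[OF E_cov_linear dl_linear] dl_linear _ Suc.prems(2)])
    fix M u v
    assume m: "M \<in> obj \<C>" "u \<in> carrier (E n M C)" "v \<in> carrier (Ext \<C> X M)"
    then show "dl (Suc n) C' A d X (ecov (Suc n) X C C' c (du n X M v C u))
        = dl (Suc n) C A (xcon A C' C c d) X (du n X M v C u)"
      using Suc d by (simp add: dl_du du_cov E_cov_closed)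
  qed (use Suc.prems d in auto)
qed

text \<open>
  The zero extension is its own image under the zero morphism of \<open>A\<close>.
\<close>

lemma dl_zero:
  assumes "A \<in> obj \<C>" "C \<in> obj \<C>" "X \<in> obj \<C>" "u \<in> carrier (E n X C)"
  shows "dl n C A \<zero>\<^bsub>Ext \<C> C A\<^esub> X u = \<zero>\<^bsub>E (Suc n) X A\<^esub>"
proof -
  have z: "\<zero>\<^bsub>Ext \<C> C A\<^esub> \<in> carrier (Ext \<C> C A)" "\<zero>\<^bsub>Hom \<C> A A\<^esub> \<in> mor \<C> A A"
    using assms by (auto intro: mzero_closed F_module Hom_module)
  have "dl n C A \<zero>\<^bsub>Ext \<C> C A\<^esub> X u = ecov (Suc n) X A A \<zero>\<^bsub>Hom \<C> A A\<^esub> (dl n C A \<zero>\<^bsub>Ext \<C> C A\<^esub> X u)"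
    using dl_push[OF assms(1,1,2) z assms(3,4)] cov_zero[OF assms(2,1,1) z(1)] by simp
  then show ?thesis
    using bilinear_functor.cov_zero[OF E_bilinear assms(3,1,1) dl_closed[OF assms(1,2) z(1) assms(3,4)]]
    by simp
qed

end


section \<open>Exactness in degree zero\<close>

sublocale additive_realization \<subseteq> extension_tower R \<C>
  by (rule extension_tower.intro) (rule bilinear_functor_axioms)

context extriangulated_category
begin

lemma triD:
  assumes "s_triangle \<C> A B C x y d"
  shows "A \<in> obj \<C>" "B \<in> obj \<C>" "C \<in> obj \<C>" "x \<in> mor \<C> A B" "y \<in> mor \<C> B C" "d \<in> carrier (Ext \<C> C A)"
  using assms by (auto simp: s_triangle_def is_seq_def)

definition zobj :: 'o where "zobj = (SOME Z. zero_object \<C> Z)"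

lemma zobj: "zero_object \<C> zobj"
  unfolding zobj_def using ex_zero_object by (rule someI_ex)

lemma zobj_obj: "zobj \<in> obj \<C>"
  using zobj by (simp add: zero_object_def)

lemma zobj_eq:
  "\<lbrakk>X \<in> obj \<C>; f \<in> mor \<C> X zobj; g \<in> mor \<C> X zobj\<rbrakk> \<Longrightarrow> f = g"
  "\<lbrakk>X \<in> obj \<C>; f \<in> mor \<C> zobj X; g \<in> mor \<C> zobj X\<rbrakk> \<Longrightarrow> f = g"
  using zobj by (auto simp: zero_object_def)

lemmas zero_mor = mzero_closed[OF Hom_module]
lemmas zero_ext = mzero_closed[OF F_module]

lemma cmp_zero_left:
  "\<lbrakk>X \<in> obj \<C>; Y \<in> obj \<C>; Z \<in> obj \<C>; f \<in> mor \<C> X Y\<rbrakk> \<Longrightarrow> \<zero>\<^bsub>Hom \<C> Y Z\<^esub> \<cdot>\<^bsub>\<C>\<^esub> f = \<zero>\<^bsub>Hom \<C> X Z\<^esub>"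
  using linear_zero[OF Hom_module Hom_module cmp_linear_left] by blast

lemma tri_idn_right:
  assumes C: "C \<in> obj \<C>"
  shows "s_triangle \<C> zobj C C \<zero>\<^bsub>Hom \<C> zobj C\<^esub> (idn \<C> C) \<zero>\<^bsub>Ext \<C> C zobj\<^esub>"
proof -
  note z = zobj_obj zero_mor[OF zobj_obj C] zero_mor[OF C zobj_obj]
  have "biproduct \<C> zobj C C \<zero>\<^bsub>Hom \<C> zobj C\<^esub> (idn \<C> C) \<zero>\<^bsub>Hom \<C> C zobj\<^esub> (idn \<C> C)"
    unfolding biproduct_def
    using z C idn_mor cmp_idn_left[OF C C idn_mor] cmp_idn_left[OF zobj_obj C] cmp_idn_right[OF C zobj_obj]
      zobj_eq(1)[OF zobj_obj] cmp_zero_left[OF zobj_obj C zobj_obj z(2)] zero_mor[OF zobj_obj zobj_obj]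
      cmp_zero_left[OF C zobj_obj C z(3)] madd_zero[OF Hom_module] by auto
  then show ?thesis by (rule realize_zero)
qed

lemma tri_idn_left:
  assumes C: "C \<in> obj \<C>"
  shows "s_triangle \<C> C C zobj (idn \<C> C) \<zero>\<^bsub>Hom \<C> C zobj\<^esub> \<zero>\<^bsub>Ext \<C> zobj C\<^esub>"
proof -
  note z = zobj_obj zero_mor[OF zobj_obj C] zero_mor[OF C zobj_obj]
  have "biproduct \<C> C zobj C (idn \<C> C) \<zero>\<^bsub>Hom \<C> zobj C\<^esub> (idn \<C> C) \<zero>\<^bsub>Hom \<C> C zobj\<^esub>"
    unfolding biproduct_def
    using z C idn_mor cmp_idn_left[OF C C idn_mor] cmp_idn_left[OF zobj_obj C] cmp_idn_right[OF C zobj_obj]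
      zobj_eq(1)[OF zobj_obj] cmp_zero_left[OF zobj_obj C zobj_obj z(2)] zero_mor[OF zobj_obj zobj_obj]
      cmp_zero_left[OF C zobj_obj C z(3)] madd_zero[OF Hom_module] by auto
  then show ?thesis by (rule realize_zero)
qed

lemma ext_morphismI:
  assumes "A \<in> obj \<C>" "C \<in> obj \<C>" "A' \<in> obj \<C>" "C' \<in> obj \<C>"
    "d \<in> carrier (Ext \<C> C A)" "d' \<in> carrier (Ext \<C> C' A')" "a \<in> mor \<C> A A'" "c \<in> mor \<C> C C'"
    "xcov C A A' a d = xcon A' C' C c d'"
  shows "ext_morphism \<C> C A d C' A' d' a c"
  using assms by (simp add: ext_morphism_def push_def pull_def)

lemma ext_morphismD:
  assumes "ext_morphism \<C> C A d C' A' d' a c"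
  shows "a \<in> mor \<C> A A'" "c \<in> mor \<C> C C'" "xcov C A A' a d = xcon A' C' C c d'"
  using assms by (simp_all add: ext_morphism_def push_def pull_def)

context
  fixes A B C x y d
  assumes t: "s_triangle \<C> A B C x y d"
begin

text \<open>
  The identity of \<open>B\<close> is part of a morphism from the given triangle to \<open>B \<rightarrow> B \<rightarrow> 0\<close>, and of one from
  \<open>0 \<rightarrow> B \<rightarrow> B\<close> to the given triangle.  Their compatibility with the extensions expresses \<open>x\<^sub>* \<delta>\<close> as a
  pullback and \<open>y\<^sup>* \<delta>\<close> as a pushforward of a zero extension.
\<close>

lemma tri_push: "xcov C A B x d = \<zero>\<^bsub>Ext \<C> C B\<^esub>"
proof -
  note T = triD[OF t]
  obtain c where "ext_morphism \<C> C A d zobj B \<zero>\<^bsub>Ext \<C> zobj B\<^esub> x c"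
    using ET3[OF t tri_idn_left[OF T(2)] T(4) idn_mor[OF T(2)]] by blast
  then have "c \<in> mor \<C> C zobj" "xcov C A B x d = xcon B zobj C c \<zero>\<^bsub>Ext \<C> zobj B\<^esub>"
    by (auto dest: ext_morphismD)
  then show ?thesis using linear_zero[OF F_module F_module contrav_linear] T zobj_obj by simp
qed

lemma tri_pull: "xcon A C B y d = \<zero>\<^bsub>Ext \<C> B A\<^esub>"
proof -
  note T = triD[OF t]
  obtain a where "ext_morphism \<C> B zobj \<zero>\<^bsub>Ext \<C> B zobj\<^esub> C A d a y"
    using ET3_op[OF tri_idn_right[OF T(2)] t idn_mor[OF T(2)] T(5)] by blast
  then have "a \<in> mor \<C> zobj A" "xcov B zobj A a \<zero>\<^bsub>Ext \<C> B zobj\<^esub> = xcon A C B y d"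
    by (auto dest: ext_morphismD)
  then show ?thesis using linear_zero[OF F_module F_module cov_linear, of B zobj A a] T zobj_obj by simp
qed

lemma tri_cmp: "y \<cdot>\<^bsub>\<C>\<^esub> x = \<zero>\<^bsub>Hom \<C> A C\<^esub>"
proof -
  note T = triD[OF t]
  obtain a where "ext_morphism \<C> C A d C zobj \<zero>\<^bsub>Ext \<C> C zobj\<^esub> a (idn \<C> C)"
    and *: "y \<cdot>\<^bsub>\<C>\<^esub> x = \<zero>\<^bsub>Hom \<C> zobj C\<^esub> \<cdot>\<^bsub>\<C>\<^esub> a"
    using ET3_op[OF t tri_idn_right[OF T(3)] T(5) idn_mor[OF T(3)]] by blast
  then have "a \<in> mor \<C> A zobj" by (auto dest: ext_morphismD)
  then show ?thesis using * cmp_zero_left T zobj_obj by simp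
qed

text \<open>
  A morphism that vanishes on \<open>A\<close> is the middle component of a morphism to the triangle \<open>0 \<rightarrow> Y \<rightarrow> Y\<close>,
  and the last component of the latter is the factorization.
\<close>

lemma con_mid_0:
  assumes Y: "Y \<in> obj \<C>" and b: "b \<in> mor \<C> B Y" "b \<cdot>\<^bsub>\<C>\<^esub> x = \<zero>\<^bsub>Hom \<C> A Y\<^esub>"
  shows "\<exists>c\<in>mor \<C> C Y. c \<cdot>\<^bsub>\<C>\<^esub> y = b"
proof -
  note T = triD[OF t]
  have "b \<cdot>\<^bsub>\<C>\<^esub> x = \<zero>\<^bsub>Hom \<C> zobj Y\<^esub> \<cdot>\<^bsub>\<C>\<^esub> \<zero>\<^bsub>Hom \<C> A zobj\<^esub>"
    using b(2) cmp_zero_left[OF T(1) zobj_obj Y] zero_mor T zobj_obj by simp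
  from ET3[OF t tri_idn_right[OF Y] zero_mor[OF T(1) zobj_obj] b(1) this]
  show ?thesis using cmp_idn_left[OF T(2) Y b(1)] by (auto dest: ext_morphismD)
qed

text \<open>
  If \<open>f\<^sub>* \<delta> = 0\<close> then \<open>(f, 0)\<close> is a morphism of extensions from \<open>\<delta>\<close> to the extension of \<open>Y \<rightarrow> Y \<rightarrow> 0\<close>, and a
  middle component of its realization extends \<open>f\<close>.
\<close>

lemma con_left_0:
  assumes Y: "Y \<in> obj \<C>" and f: "f \<in> mor \<C> A Y" "xcov C A Y f d = \<zero>\<^bsub>Ext \<C> C Y\<^esub>"
  shows "\<exists>b\<in>mor \<C> B Y. b \<cdot>\<^bsub>\<C>\<^esub> x = f"
proof -
  note T = triD[OF t]
  have "ext_morphism \<C> C A d zobj Y \<zero>\<^bsub>Ext \<C> zobj Y\<^esub> f \<zero>\<^bsub>Hom \<C> C zobj\<^esub>"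
    by (rule ext_morphismI)
      (use T Y f zobj_obj zero_mor zero_ext linear_zero[OF F_module F_module contrav_linear] in auto)
  from realize_morphism[OF t tri_idn_left[OF Y] this]
  show ?thesis using cmp_idn_left[OF T(1) Y f(1)] by auto
qed

text \<open>
  Realize the given extension by \<open>Y \<rightarrow> D \<rightarrow> C\<close>.  Since it becomes zero on \<open>B\<close>, the deflation \<open>y\<close> lifts to
  \<open>B \<rightarrow> D\<close>, and completing this lift to a morphism of triangles gives \<open>A \<rightarrow> Y\<close>.
\<close>

lemma con_right_0:
  assumes Y: "Y \<in> obj \<C>" and e: "e \<in> carrier (Ext \<C> C Y)" "xcon Y C B y e = \<zero>\<^bsub>Ext \<C> B Y\<^esub>"
  shows "\<exists>a\<in>mor \<C> A Y. xcov C A Y a d = e"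
proof -
  note T = triD[OF t]
  obtain D p q where t': "s_triangle \<C> Y D C p q e" using realized[OF Y T(3) e(1)] by blast
  note T' = triD[OF t']
  have "ext_morphism \<C> B zobj \<zero>\<^bsub>Ext \<C> B zobj\<^esub> C Y e \<zero>\<^bsub>Hom \<C> zobj Y\<^esub> y"
    by (rule ext_morphismI)
      (use T Y e zobj_obj zero_mor zero_ext linear_zero[OF F_module F_module cov_linear] in auto)
  from realize_morphism[OF tri_idn_right[OF T(2)] t' this]
  obtain b where b: "b \<in> mor \<C> B D" "q \<cdot>\<^bsub>\<C>\<^esub> b = y \<cdot>\<^bsub>\<C>\<^esub> idn \<C> B" by blast
  then have "idn \<C> C \<cdot>\<^bsub>\<C>\<^esub> y = q \<cdot>\<^bsub>\<C>\<^esub> b" using T by (simp add: cmp_idn_left cmp_idn_right)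
  from ET3_op[OF t t' b(1) idn_mor[OF T(3)] this]
  obtain a where "ext_morphism \<C> C A d C Y e a (idn \<C> C)" by blast
  from ext_morphismD[OF this] show ?thesis using contrav_idn[OF T(3) Y e(1)] by auto
qed

lemma cov_left_0:
  assumes X: "X \<in> obj \<C>" and f: "f \<in> mor \<C> X C" "xcon A C X f d = \<zero>\<^bsub>Ext \<C> X A\<^esub>"
  shows "\<exists>b\<in>mor \<C> X B. y \<cdot>\<^bsub>\<C>\<^esub> b = f"
proof -
  note T = triD[OF t]
  have "ext_morphism \<C> X zobj \<zero>\<^bsub>Ext \<C> X zobj\<^esub> C A d \<zero>\<^bsub>Hom \<C> zobj A\<^esub> f"
    by (rule ext_morphismI)
      (use T X f zobj_obj zero_mor zero_ext linear_zero[OF F_module F_module cov_linear] in auto)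
  from realize_morphism[OF tri_idn_right[OF X] t this]
  show ?thesis using cmp_idn_right[OF X T(3) f(1)] by auto
qed

text \<open>
  Dually, in a realization \<open>A \<rightarrow> D \<rightarrow> X\<close> the inflation \<open>x\<close> extends to \<open>D \<rightarrow> B\<close>, and completing this to a
  morphism of triangles gives \<open>X \<rightarrow> C\<close>.
\<close>

lemma cov_right_0:
  assumes X: "X \<in> obj \<C>" and e: "e \<in> carrier (Ext \<C> X A)" "xcov X A B x e = \<zero>\<^bsub>Ext \<C> X B\<^esub>"
  shows "\<exists>c\<in>mor \<C> X C. xcon A C X c d = e"
proof -
  note T = triD[OF t]
  obtain D p q where t': "s_triangle \<C> A D X p q e" using realized[OF T(1) X e(1)] by blast
  note T' = triD[OF t']
  have "ext_morphism \<C> X A e zobj B \<zero>\<^bsub>Ext \<C> zobj B\<^esub> x \<zero>\<^bsub>Hom \<C> X zobj\<^esub>"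
    by (rule ext_morphismI)
      (use T X e zobj_obj zero_mor zero_ext linear_zero[OF F_module F_module contrav_linear] in auto)
  from realize_morphism[OF t' tri_idn_left[OF T(2)] this]
  obtain b where b: "b \<in> mor \<C> D B" "b \<cdot>\<^bsub>\<C>\<^esub> p = idn \<C> B \<cdot>\<^bsub>\<C>\<^esub> x" by blast
  then have "b \<cdot>\<^bsub>\<C>\<^esub> p = x \<cdot>\<^bsub>\<C>\<^esub> idn \<C> A" using T by (simp add: cmp_idn_left cmp_idn_right)
  from ET3[OF t' t idn_mor[OF T(1)] b(1) this]
  obtain c where "ext_morphism \<C> X A e C A d (idn \<C> A) c" by blast
  from ext_morphismD[OF this] show ?thesis using cov_idn[OF X T(1) e(1)] by auto
qed

end

end


section \<open>The covariant long exact sequence\<close>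

context extriangulated_category
begin

lemmas E_cov_cmp = bilinear_functor.cov_cmp[OF E_bilinear]
lemmas E_cov_zero = bilinear_functor.cov_zero[OF E_bilinear]
lemmas E_contrav_cmp = bilinear_functor.contrav_cmp[OF E_bilinear]
lemmas E_contrav_zero = bilinear_functor.contrav_zero[OF E_bilinear]
lemmas E_cov_contrav = bilinear_functor.cov_contrav[OF E_bilinear]

definition inj_triangle where
  "inj_triangle A J B x y d \<longleftrightarrow> s_triangle \<C> A J B x y d \<and> injective_morphism \<C> A J x"

text \<open>
  The functor acts on the first factor of a generator \<open>u \<union> v\<close>, so vanishing passes from \<open>\<bbbE>\<^sup>n\<close> to \<open>\<bbbE>\<^sup>n\<^sup>+\<^sup>1\<close>.
\<close>

lemma inj_ext_zero:
  assumes t: "inj_triangle A J B x y d" and X: "X \<in> obj \<C>" and u: "u \<in> carrier (E (Suc n) X A)"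
  shows "ecov (Suc n) X A J x u = \<zero>\<^bsub>E (Suc n) X J\<^esub>"
  using X u
proof (induction n arbitrary: X u)
  case 0
  note T = triD[of A J B x y d]
  have "xcov X A J x v = \<zero>\<^bsub>Ext \<C> X J\<^esub>" if "v \<in> carrier (Ext \<C> X A)" for v
    using t 0 that by (simp add: inj_triangle_def injective_morphism_def push_def)
  then show ?case using 0 t T by (auto simp: inj_triangle_def E1_simps ecov_1)
next
  case (Suc n)
  have T: "A \<in> obj \<C>" "J \<in> obj \<C>" "x \<in> mor \<C> A J"
    using t triD[of A J B x y d] by (auto simp: inj_triangle_def)
  show ?case
  proof (rule du_linear_eq[OF Suc.prems(1) T(1) E_module[OF Suc.prems(1) T(2)]
        E_cov_linear[OF Suc.prems(1) T] linear_zero_map[OF E_module[OF Suc.prems(1) T(2)]] _ Suc.prems(2)])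
    fix M u v
    assume m: "M \<in> obj \<C>" "u \<in> carrier (E (Suc n) M A)" "v \<in> carrier (Ext \<C> X M)"
    show "ecov (Suc (Suc n)) X A J x (du (Suc n) X M v A u) = \<zero>\<^bsub>E (Suc (Suc n)) X J\<^esub>"
      using m T Suc
      by (simp add: du_cov linear_zero[OF E_module E_module du_linear])
  qed
qed

text \<open>
  A generator \<open>u \<union> v\<close> with \<open>u = \<delta>\<^sub>\<sharp> w\<close> is the image of \<open>w \<union> v\<close>.
\<close>

lemma inj_dl_surj:
  assumes t: "inj_triangle A J B x y d" and X: "X \<in> obj \<C>" and u: "u \<in> carrier (E (Suc n) X A)"
  shows "\<exists>w\<in>carrier (E n X B). dl n B A d X w = u"
  using X u
proof (induction n arbitrary: X u)
  case 0
  have s: "s_triangle \<C> A J B x y d" using t by (simp add: inj_triangle_def)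
  note T = triD[OF s]
  obtain v where v: "v \<in> carrier (Ext \<C> X A)" "u = XExt v" using 0 T by (auto simp: E1_simps)
  have "xcov X A J x v = \<zero>\<^bsub>Ext \<C> X J\<^esub>"
    using t 0(1) v by (simp add: inj_triangle_def injective_morphism_def push_def)
  from cov_right_0[OF s 0(1) v(1) this] show ?case
    using 0 T v by (auto simp: E0_simps dl_0)
next
  case (Suc n)
  have s: "s_triangle \<C> A J B x y d" using t by (simp add: inj_triangle_def)
  note T = triD[OF s]
  note l = dl_linear[OF T(1,3,6) Suc.prems(1), of "Suc n"]
  note mods = E_module[OF Suc.prems(1) T(1)] E_module[OF Suc.prems(1) T(3)]
  from Suc.prems(1) T(1) Suc.prems(2) show ?case
  proof (induction rule: du_induct)
    case zero
    show ?case using linear_zero[OF mods(2,1) l] mzero_closed[OF mods(2)] by blast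
  next
    case (tensor M u v)
    then obtain w where w: "w \<in> carrier (E n M B)" "dl n B A d M w = u" using Suc.IH by blast
    then show ?case
      using dl_du[OF T(1,3,6) Suc.prems(1) tensor(1) w(1) tensor(3)]
        du_closed[OF Suc.prems(1) T(3) tensor(1,3) w(1)] by auto
  next
    case (add w w')
    then show ?case using linear_add[OF l] madd_closed[OF mods(2)] by metis
  qed
qed

text \<open>
  This is right exactness of the coend.  A map from \<open>\<bbbE>\<^sup>n\<^sup>+\<^sup>2(X, A)\<close> to the cokernel of \<open>y\<^sub>*\<close> that composes with
  \<open>\<delta>\<^sub>\<sharp>\<close> to the projection is defined on generators by lifting their first factor along \<open>\<delta>\<^sub>\<sharp>\<close> in degree \<open>n\<close>;
  the induction hypothesis makes it independent of the lift.
\<close>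

lemma inj_dl_kernel:
  assumes t: "inj_triangle A J B x y d" and X: "X \<in> obj \<C>" and w: "w \<in> carrier (E n X B)"
    and 0: "dl n B A d X w = \<zero>\<^bsub>E (Suc n) X A\<^esub>"
  shows "\<exists>b\<in>carrier (E n X J). ecov n X J B y b = w"
  using X w 0
proof (induction n arbitrary: X w)
  case 0
  have s: "s_triangle \<C> A J B x y d" using t by (simp add: inj_triangle_def)
  note T = triD[OF s]
  obtain f where f: "f \<in> mor \<C> X B" "w = XHom f" using 0 T by (auto simp: E0_simps)
  have "xcon A B X f d = \<zero>\<^bsub>Ext \<C> X A\<^esub>" using 0 f T by (auto simp: dl_0 E1_simps)
  from cov_left_0[OF s 0(1) f(1) this] show ?case
    using 0 T f by (auto simp: E0_simps ecov_0)
next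
  case (Suc n)
  have s: "s_triangle \<C> A J B x y d" using t by (simp add: inj_triangle_def)
  note T = triD[OF s] and X = Suc.prems(1)
  note EXB = E_module[OF X T(3), of "Suc n"] and EXJ = E_module[OF X T(2), of "Suc n"]
  note cov = E_cov_linear[OF X T(2,3,5), of "Suc n"]
  let ?H = "ecov (Suc n) X J B y ` carrier (E (Suc n) X J)"
  let ?N = "quotient_module (E (Suc n) X B) ?H"
  have H: "submodule ?H R (E (Suc n) X B)" by (rule linear_image_submodule[OF EXJ EXB cov])
  note N = quotient_is_module[OF EXB H] and pr = quotient_proj_linear[OF EXB H]
  let ?cl = "\<lambda>z. ?H +>\<^bsub>E (Suc n) X B\<^esub> z"
  define lft where "lft M u = (SOME w. w \<in> carrier (E n M B) \<and> dl n B A d M w = u)" for M u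
  let ?h = "\<lambda>(M, u, v). ?cl (du n X M v B (lft M u))"
  have lft: "lft M u \<in> carrier (E n M B)" "dl n B A d M (lft M u) = u"
    if "M \<in> obj \<C>" "u \<in> carrier (E (Suc n) M A)" for M u
    using someI_ex[of "\<lambda>w. w \<in> carrier (E n M B) \<and> dl n B A d M w = u"] inj_dl_surj[OF t that]
    unfolding lft_def by blast+
  \<comment> \<open>Two lifts of \<open>u\<close> differ by an element that comes from \<open>J\<close>.\<close>
  have key: "?h (M, u, v) = ?cl (du n X M v B w)"
    if m: "M \<in> obj \<C>" "v \<in> carrier (Ext \<C> X M)" and w: "w \<in> carrier (E n M B)" "dl n B A d M w = u" for M u v w
  proof -
    have u: "u \<in> carrier (E (Suc n) M A)" using dl_closed[OF T(1,3,6) m(1) w(1)] w(2) by simp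
    note l = lft[OF m(1) u]
    note EMB = E_module[OF m(1) T(3), of n]
    let ?z = "lft M u \<ominus>\<^bsub>E n M B\<^esub> w"
    have z: "?z \<in> carrier (E n M B)" by (rule mminus_closed[OF EMB l(1) w(1)])
    have "dl n B A d M ?z = \<zero>\<^bsub>E (Suc n) M A\<^esub>"
      by (rule linear_minus_eq_zero[OF EMB E_module[OF m(1) T(1)] dl_linear[OF T(1,3,6) m(1)] l(1) w(1)])
        (simp add: l w)
    then obtain b where b: "b \<in> carrier (E n M J)" "ecov n M J B y b = ?z"
      using Suc.IH[OF m(1) z] by blast
    have "du n X M v B (lft M u) \<ominus>\<^bsub>E (Suc n) X B\<^esub> du n X M v B w = du n X M v B ?z"
      by (rule linear_minus[OF EMB EXB du_linear[OF X T(3) m] l(1) w(1), symmetric])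
    also have "\<dots> = ecov (Suc n) X J B y (du n X M v J b)"
      using du_cov[OF X T(2,3,5) m(1) b(1) m(2)] b(2) by simp
    also have "\<dots> \<in> ?H" using du_closed[OF X T(2) m b(1)] by blast
    finally show ?thesis
      using quotient_simps(5)[OF EXB H du_closed[OF X T(3) m l(1)] du_closed[OF X T(3) m w(1)]] by simp
  qed
  note tc = lft madd_closed[OF E_module] msmult_closed[OF E_module] T
  note lin = linear_add[OF dl_linear] linear_smult[OF dl_linear]
  have clc: "?cl (du n X M v B w) \<in> carrier ?N"
    if "M \<in> obj \<C>" "v \<in> carrier (Ext \<C> X M)" "w \<in> carrier (E n M B)" for M v w
    by (rule linear_closed[OF pr du_closed[OF X T(3) that]])
  have bal: "balanced (Suc n) X A ?N ?h"
  proof (rule balanced_map.intro, goal_cases)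
    case (1 M u v)
    then show ?case using clc lft by simp
  next
    case (2 M u u' v)
    note l = lft[OF 2(1,2)] lft[OF 2(1,3)]
    have "?h (M, u \<oplus>\<^bsub>E (Suc n) M A\<^esub> u', v) = ?cl (du n X M v B (lft M u \<oplus>\<^bsub>E n M B\<^esub> lft M u'))"
      by (rule key[OF 2(1,4)]) (use 2 in \<open>simp_all add: tc lin\<close>)
    then show ?case
      using l by (simp add: linear_add[OF du_linear[OF X T(3) 2(1,4)]] linear_add[OF pr] du_closed[OF X T(3) 2(1,4)])
  next
    case (3 M u v v')
    note l = lft[OF 3(1,2)]
    then show ?case
      using 3 by (simp add: linear_add[OF du_linear_right[OF X T(3) 3(1) l(1)]] linear_add[OF pr] du_closed[OF X T(3) 3(1)])
  next
    case (4 M r u v)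
    note l = lft[OF 4(1,3)]
    have "?h (M, r \<odot>\<^bsub>E (Suc n) M A\<^esub> u, v) = ?cl (du n X M v B (r \<odot>\<^bsub>E n M B\<^esub> lft M u))"
      by (rule key[OF 4(1,4)]) (use 4 in \<open>simp_all add: tc lin\<close>)
    then show ?case
      using l 4 by (simp add: linear_smult[OF du_linear[OF X T(3) 4(1,4)]] linear_smult[OF pr] du_closed[OF X T(3) 4(1,4)])
  next
    case (5 M r u v)
    note l = lft[OF 5(1,3)]
    then show ?case
      using 5 by (simp add: linear_smult[OF du_linear_right[OF X T(3) 5(1) l(1)]] linear_smult[OF pr] du_closed[OF X T(3) 5(1)])
  next
    case (6 M M' f u v)
    note l = lft[OF 6(2,4)]
    have "?h (M, econ (Suc n) A M' M f u, v) = ?cl (du n X M v B (econ n B M' M f (lft M' u)))"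
      using 6 l T by (intro key) (auto simp: dl_natural E_contrav_closed)
    then show ?case using du_dinatural[OF X T(3) 6(1,2,3) l(1) 6(5)] by simp
  qed
  obtain K where K: "K \<in> linear_maps R (E (Suc (Suc n)) X A) ?N"
    and Kdu: "\<And>M u v. \<lbrakk>M \<in> obj \<C>; u \<in> carrier (E (Suc n) M A); v \<in> carrier (Ext \<C> X M)\<rbrakk>
      \<Longrightarrow> K (du (Suc n) X M v A u) = ?h (M, u, v)"
    by (rule du_lift[OF X T(1) N bal], rule that)
  note dll = dl_linear[OF T(1,3,6) X, of "Suc n"]
  have "K (dl (Suc n) B A d X w) = ?cl w"
  proof (rule du_linear_eq[OF X T(3) N linear_comp[OF dll K] pr _ Suc.prems(2)])
    fix M u v
    assume m: "M \<in> obj \<C>" "u \<in> carrier (E n M B)" "v \<in> carrier (Ext \<C> X M)"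
    show "K (dl (Suc n) B A d X (du n X M v B u)) = ?cl (du n X M v B u)"
      using Kdu[OF m(1) dl_closed[OF T(1,3,6) m(1,2)] m(3)] key[OF m(1,3,2) refl]
        dl_du[OF T(1,3,6) X m] by simp
  qed
  moreover have "K (dl (Suc n) B A d X w) = \<zero>\<^bsub>?N\<^esub>"
    using linear_zero[OF E_module[OF X T(1)] N K] Suc.prems(3) by simp
  ultimately have "w \<in> ?H" using quotient_proj_zero[OF EXB H Suc.prems(2)] by simp
  then show ?case by blast
qed

text \<open>
  The output of (ET4) for \<open>A \<rightarrow> B \<rightarrow> C\<close> and an injective triangle \<open>B \<rightarrow> J \<rightarrow> B'\<close>: the cone \<open>C\<close> is embedded
  into the cone \<open>D\<close> of \<open>A \<rightarrow> J\<close> with cone \<open>B'\<close>.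
\<close>

definition rotated where
  "rotated A B C x y d J B' g g' d' D p e h d2 \<longleftrightarrow>
    inj_triangle B J B' g g' d' \<and> inj_triangle A J D (g \<cdot>\<^bsub>\<C>\<^esub> x) h d2 \<and>
    s_triangle \<C> C D B' p e (xcov B' B C y d') \<and>
    h \<cdot>\<^bsub>\<C>\<^esub> g = p \<cdot>\<^bsub>\<C>\<^esub> y \<and> e \<cdot>\<^bsub>\<C>\<^esub> h = g' \<and> xcon A D C p d2 = d \<and>
    xcov D A B x d2 = xcon B B' D e d'"

lemma rotatedD:
  assumes "rotated A B C x y d J B' g g' d' D p e h d2"
  shows "inj_triangle B J B' g g' d'" "inj_triangle A J D (g \<cdot>\<^bsub>\<C>\<^esub> x) h d2"
    "s_triangle \<C> B J B' g g' d'" "s_triangle \<C> A J D (g \<cdot>\<^bsub>\<C>\<^esub> x) h d2"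
    "s_triangle \<C> C D B' p e (xcov B' B C y d')"
    "h \<cdot>\<^bsub>\<C>\<^esub> g = p \<cdot>\<^bsub>\<C>\<^esub> y" "e \<cdot>\<^bsub>\<C>\<^esub> h = g'" "xcon A D C p d2 = d"
    "xcov D A B x d2 = xcon B B' D e d'"
  using assms by (simp_all add: rotated_def inj_triangle_def)

lemma rotation:
  assumes inj: "enough_injective_morphisms \<C>" and t: "s_triangle \<C> A B C x y d"
  obtains J B' g g' d' D p e h d2
  where "rotated A B C x y d J B' g g' d' D p e h d2"
proof -
  note T = triD[OF t]
  obtain J g where J: "J \<in> obj \<C>" "inflation \<C> B J g" "injective_morphism \<C> B J g"
    using inj T(2) unfolding enough_injective_morphisms_def by blast
  then obtain B' g' d' where t': "s_triangle \<C> B J B' g g' d'" unfolding inflation_def by blast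
  note T' = triD[OF t']
  from ET4[OF t t'] obtain D p e h d2 where
    D: "s_triangle \<C> A J D (g \<cdot>\<^bsub>\<C>\<^esub> x) h d2" "s_triangle \<C> C D B' p e (push \<C> B' B C y d')"
    "h \<cdot>\<^bsub>\<C>\<^esub> g = p \<cdot>\<^bsub>\<C>\<^esub> y" "e \<cdot>\<^bsub>\<C>\<^esub> h = g'" "pull \<C> A D C p d2 = d"
    "push \<C> D A B x d2 = pull \<C> B B' D e d'"
    by blast
  have "injective_morphism \<C> A J (g \<cdot>\<^bsub>\<C>\<^esub> x)"
    unfolding injective_morphism_def push_def
  proof (intro conjI ballI)
    show "g \<cdot>\<^bsub>\<C>\<^esub> x \<in> mor \<C> A J" by (rule cmp_closed[OF T(1,2) J(1) T(4) T'(4)])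
    fix X v assume X: "X \<in> obj \<C>" and v: "v \<in> carrier (Ext \<C> X A)"
    have "xcov X A J (g \<cdot>\<^bsub>\<C>\<^esub> x) v = xcov X B J g (xcov X A B x v)"
      using cov_cmp[OF X T(1,2) J(1) T(4) T'(4) v] by simp
    then show "xcov X A J (g \<cdot>\<^bsub>\<C>\<^esub> x) v = \<zero>\<^bsub>Ext \<C> X J\<^esub>"
      using J(3) X cov_closed[OF X T(1,2,4) v] by (simp add: injective_morphism_def push_def)
  qed
  then show ?thesis
    by (intro that[of J B' g g' d' D p e h d2]) (use t' J(3) D in \<open>simp_all add: rotated_def inj_triangle_def push_def pull_def\<close>)
qed

definition cov_middle where "cov_middle n \<longleftrightarrow> (\<forall>A B C x y d X u. s_triangle \<C> A B C x y d \<longrightarrow> X \<in> obj \<C> \<longrightarrow>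
  u \<in> carrier (E n X B) \<longrightarrow> ecov n X B C y u = \<zero>\<^bsub>E n X C\<^esub> \<longrightarrow> (\<exists>w\<in>carrier (E n X A). ecov n X A B x w = u))"

definition cov_left where "cov_left n \<longleftrightarrow> (\<forall>A B C x y d X u. s_triangle \<C> A B C x y d \<longrightarrow> X \<in> obj \<C> \<longrightarrow>
  u \<in> carrier (E n X C) \<longrightarrow> dl n C A d X u = \<zero>\<^bsub>E (Suc n) X A\<^esub> \<longrightarrow> (\<exists>w\<in>carrier (E n X B). ecov n X B C y w = u))"

definition cov_right where "cov_right n \<longleftrightarrow> (\<forall>A B C x y d X u. s_triangle \<C> A B C x y d \<longrightarrow> X \<in> obj \<C> \<longrightarrow>
  u \<in> carrier (E (Suc n) X A) \<longrightarrow> ecov (Suc n) X A B x u = \<zero>\<^bsub>E (Suc n) X B\<^esub> \<longrightarrow>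
  (\<exists>w\<in>carrier (E n X C). dl n C A d X w = u))"

lemma cov_left_base: "cov_left 0"
  unfolding cov_left_def
proof (intro allI impI)
  fix A B C x y d X u
  assume s: "s_triangle \<C> A B C x y d" and X: "X \<in> obj \<C>" and u: "u \<in> carrier (E 0 X C)"
    and 0: "dl 0 C A d X u = \<zero>\<^bsub>E (Suc 0) X A\<^esub>"
  note T = triD[OF s]
  obtain f where f: "f \<in> mor \<C> X C" "u = XHom f" using u T X by (auto simp: E0_simps)
  have "xcon A C X f d = \<zero>\<^bsub>Ext \<C> X A\<^esub>" using 0 X f T by (auto simp: dl_0 E1_simps)
  from cov_left_0[OF s X f(1) this] show "\<exists>w\<in>carrier (E 0 X B). ecov 0 X B C y w = u"
    using X T f by (auto simp: E0_simps ecov_0)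
qed

lemma cov_right_base: "cov_right 0"
  unfolding cov_right_def
proof (intro allI impI)
  fix A B C x y d X u
  assume s: "s_triangle \<C> A B C x y d" and X: "X \<in> obj \<C>" and u: "u \<in> carrier (E (Suc 0) X A)"
    and 0: "ecov (Suc 0) X A B x u = \<zero>\<^bsub>E (Suc 0) X B\<^esub>"
  note T = triD[OF s]
  obtain v where v: "v \<in> carrier (Ext \<C> X A)" "u = XExt v" using u X T by (auto simp: E1_simps)
  have "xcov X A B x v = \<zero>\<^bsub>Ext \<C> X B\<^esub>" using 0 v X T by (simp add: ecov_1 E1_simps)
  from cov_right_0[OF s X v(1) this] show "\<exists>w\<in>carrier (E 0 X C). dl 0 C A d X w = u"
    using X T v by (auto simp: E0_simps dl_0)
qed

context
  assumes enough: "enough_injective_morphisms \<C>"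
begin

text \<open>
  Write \<open>u \<in> \<bbbE>\<^sup>n\<^sup>+\<^sup>1(X, B)\<close> as the image of \<open>w \<in> \<bbbE>\<^sup>n(X, B')\<close>.  Then \<open>y\<^sub>* u = 0\<close> says that the connecting map
  of \<open>C \<rightarrow> D \<rightarrow> B'\<close> kills \<open>w\<close>, so \<open>w\<close> comes from \<open>\<bbbE>\<^sup>n(X, D)\<close>, which maps onto \<open>\<bbbE>\<^sup>n\<^sup>+\<^sup>1(X, A)\<close>.
\<close>

lemma cov_middle_step:
  assumes L: "cov_left n"
  shows "cov_middle (Suc n)"
  unfolding cov_middle_def
proof (intro allI impI)
  fix A B C x y d X u
  assume s: "s_triangle \<C> A B C x y d" and X: "X \<in> obj \<C>" and u: "u \<in> carrier (E (Suc n) X B)"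
    and 0: "ecov (Suc n) X B C y u = \<zero>\<^bsub>E (Suc n) X C\<^esub>"
  obtain J B' g g' d' D p e h d2 where r: "rotated A B C x y d J B' g g' d' D p e h d2"
    by (rule rotation[OF enough s])
  note i1 = rotatedD(1)[OF r] and i2 = rotatedD(2)[OF r] and s1 = rotatedD(3)[OF r]
    and s2 = rotatedD(4)[OF r] and s3 = rotatedD(5)[OF r] and eqs = rotatedD(6-9)[OF r]
  note T = triD[OF s] and T1 = triD[OF s1] and T2 = triD[OF s2] and T3 = triD[OF s3]
  obtain w where w: "w \<in> carrier (E n X B')" "dl n B' B d' X w = u" using inj_dl_surj[OF i1 X u] by blast
  have "dl n B' C (xcov B' B C y d') X w = \<zero>\<^bsub>E (Suc n) X C\<^esub>"
    using dl_push[OF T(2,3) T1(3,6) T(5) X w(1)] w(2) 0 by simp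
  then obtain z where z: "z \<in> carrier (E n X D)" "ecov n X D B' e z = w"
    using L s3 X w(1) unfolding cov_left_def by blast
  have "ecov (Suc n) X A B x (dl n D A d2 X z) = u"
    using dl_push[OF T(1,2) T2(3,6) T(4) X z(1)] dl_pull[OF T1(1) T2(3) T1(3,6) T3(5) X z(1)]
      eqs(4) z(2) w(2) by simp
  then show "\<exists>w\<in>carrier (E (Suc n) X A). ecov (Suc n) X A B x w = u"
    using dl_closed[OF T(1) T2(3,6) X z(1)] by blast
qed

text \<open>
  If \<open>\<delta>\<^sub>\<sharp> u = 0\<close> then \<open>p\<^sub>* u\<close> lifts to some \<open>j \<in> \<bbbE>\<^sup>m(X, J)\<close>, and the image of \<open>j\<close> in \<open>\<bbbE>\<^sup>m(X, B')\<close> is zero,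
  so \<open>j\<close> comes from \<open>b \<in> \<bbbE>\<^sup>m(X, B)\<close>.  The difference \<open>u - y\<^sub>* b\<close> is killed by \<open>p\<^sub>*\<close>, hence is in the image of the connecting
  map of \<open>C \<rightarrow> D \<rightarrow> B'\<close>, which factors through \<open>y\<^sub>*\<close>.
\<close>

lemma cov_left_step:
  assumes M: "cov_middle (Suc n)" and Ri: "cov_right n"
  shows "cov_left (Suc n)"
  unfolding cov_left_def
proof (intro allI impI)
  fix A B C x y d X u
  assume s: "s_triangle \<C> A B C x y d" and X: "X \<in> obj \<C>" and u: "u \<in> carrier (E (Suc n) X C)"
    and 0: "dl (Suc n) C A d X u = \<zero>\<^bsub>E (Suc (Suc n)) X A\<^esub>"
  obtain J B' g g' d' D p e h d2 where r: "rotated A B C x y d J B' g g' d' D p e h d2"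
    by (rule rotation[OF enough s])
  note i1 = rotatedD(1)[OF r] and i2 = rotatedD(2)[OF r] and s1 = rotatedD(3)[OF r]
    and s2 = rotatedD(4)[OF r] and s3 = rotatedD(5)[OF r] and eqs = rotatedD(6-9)[OF r]
  note T = triD[OF s] and T1 = triD[OF s1] and T2 = triD[OF s2] and T3 = triD[OF s3]
  let ?m = "Suc n"
  note EC = E_module[OF X T(3), of ?m] and ED = E_module[OF X T3(2), of ?m]
  have pu: "ecov ?m X C D p u \<in> carrier (E ?m X D)" by (rule E_cov_closed[OF X T(3) T3(2,4) u])
  have "dl ?m D A d2 X (ecov ?m X C D p u) = \<zero>\<^bsub>E (Suc ?m) X A\<^esub>"
    using dl_pull[OF T(1,3) T2(3,6) T3(4) X u] eqs(3) 0 by simp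
  then obtain j where j: "j \<in> carrier (E ?m X J)" "ecov ?m X J D h j = ecov ?m X C D p u"
    using inj_dl_kernel[OF i2 X pu] by blast
  have "ecov ?m X J B' g' j = ecov ?m X D B' e (ecov ?m X C D p u)"
    using E_cov_cmp[OF X T1(2) T3(2,3) T2(5) T3(5) j(1)] eqs(2) j(2) by simp
  also have "\<dots> = \<zero>\<^bsub>E ?m X B'\<^esub>"
    using E_cov_cmp[OF X T3(1-5) u] tri_cmp[OF s3] E_cov_zero[OF X T3(1,3) u] by simp
  finally obtain b where b: "b \<in> carrier (E ?m X B)" "ecov ?m X B J g b = j"
    using M s1 X j(1) unfolding cov_middle_def by blast
  let ?yb = "ecov ?m X B C y b"
  have yb: "?yb \<in> carrier (E ?m X C)" by (rule E_cov_closed[OF X T(2,3,5) b(1)])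
  have eq: "ecov ?m X C D p u = ecov ?m X C D p ?yb"
    using E_cov_cmp[OF X T(2,3) T3(2) T(5) T3(4) b(1)] E_cov_cmp[OF X T(2) T1(2) T3(2) T1(4) T2(5) b(1)]
      eqs(1) b(2) j(2) by simp
  have v: "u \<ominus>\<^bsub>E ?m X C\<^esub> ?yb \<in> carrier (E ?m X C)" by (rule mminus_closed[OF EC u yb])
  have "ecov ?m X C D p (u \<ominus>\<^bsub>E ?m X C\<^esub> ?yb) = \<zero>\<^bsub>E ?m X D\<^esub>"
    by (rule linear_minus_eq_zero[OF EC ED E_cov_linear[OF X T(3) T3(2,4)] u yb eq])
  then obtain w where w: "w \<in> carrier (E n X B')" "dl n B' C (xcov B' B C y d') X w = u \<ominus>\<^bsub>E ?m X C\<^esub> ?yb"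
    using Ri s3 X v unfolding cov_right_def by blast
  let ?dw = "dl n B' B d' X w"
  have dw: "?dw \<in> carrier (E ?m X B)" by (rule dl_closed[OF T1(1,3,6) X w(1)])
  have "ecov ?m X B C y (?dw \<oplus>\<^bsub>E ?m X B\<^esub> b) = (u \<ominus>\<^bsub>E ?m X C\<^esub> ?yb) \<oplus>\<^bsub>E ?m X C\<^esub> ?yb"
    using linear_add[OF E_cov_linear[OF X T(2,3,5)] dw b(1)] dl_push[OF T(2,3) T1(3,6) T(5) X w(1)] w(2)
    by simp
  also have "\<dots> = u" by (rule mminus_add_cancel[OF EC u yb])
  finally show "\<exists>w\<in>carrier (E ?m X B). ecov ?m X B C y w = u"
    using madd_closed[OF E_module[OF X T(2)] dw b(1)] by blast
qed

text \<open>
  Lift \<open>u\<close> to \<open>v \<in> \<bbbE>\<^sup>m(X, D)\<close>.  Since \<open>x\<^sub>* u = 0\<close>, the element \<open>e\<^sub>* v\<close> comes from \<open>\<bbbE>\<^sup>m(X, J)\<close>; subtracting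
  from \<open>v\<close> the image of this preimage in \<open>\<bbbE>\<^sup>m(X, D)\<close> leaves a lift of \<open>u\<close> that comes from \<open>\<bbbE>\<^sup>m(X, C)\<close>.
\<close>

lemma cov_right_step:
  assumes M: "cov_middle (Suc n)"
  shows "cov_right (Suc n)"
  unfolding cov_right_def
proof (intro allI impI)
  fix A B C x y d X u
  let ?m = "Suc n"
  assume s: "s_triangle \<C> A B C x y d" and X: "X \<in> obj \<C>" and u: "u \<in> carrier (E (Suc ?m) X A)"
    and 0: "ecov (Suc ?m) X A B x u = \<zero>\<^bsub>E (Suc ?m) X B\<^esub>"
  obtain J B' g g' d' D p e h d2 where r: "rotated A B C x y d J B' g g' d' D p e h d2"
    by (rule rotation[OF enough s])
  note i1 = rotatedD(1)[OF r] and i2 = rotatedD(2)[OF r] and s1 = rotatedD(3)[OF r]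
    and s2 = rotatedD(4)[OF r] and s3 = rotatedD(5)[OF r] and eqs = rotatedD(6-9)[OF r]
  note T = triD[OF s] and T1 = triD[OF s1] and T2 = triD[OF s2] and T3 = triD[OF s3]
  note ED = E_module[OF X T3(2), of ?m]
  obtain v where v: "v \<in> carrier (E ?m X D)" "dl ?m D A d2 X v = u" using inj_dl_surj[OF i2 X u] by blast
  have ev: "ecov ?m X D B' e v \<in> carrier (E ?m X B')" by (rule E_cov_closed[OF X T3(2,3,5) v(1)])
  have "dl ?m B' B d' X (ecov ?m X D B' e v) = \<zero>\<^bsub>E (Suc ?m) X B\<^esub>"
    using dl_push[OF T(1,2) T2(3,6) T(4) X v(1)] dl_pull[OF T1(1) T2(3) T1(3,6) T3(5) X v(1)]
      eqs(4) v(2) 0 by simp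
  then obtain j where j: "j \<in> carrier (E ?m X J)" "ecov ?m X J B' g' j = ecov ?m X D B' e v"
    using inj_dl_kernel[OF i1 X ev] by blast
  let ?hj = "ecov ?m X J D h j"
  have hj: "?hj \<in> carrier (E ?m X D)" by (rule E_cov_closed[OF X T2(2,3,5) j(1)])
  have eq: "ecov ?m X D B' e v = ecov ?m X D B' e ?hj"
    using E_cov_cmp[OF X T1(2) T3(2,3) T2(5) T3(5) j(1)] eqs(2) j(2) by simp
  have "ecov ?m X D B' e (v \<ominus>\<^bsub>E ?m X D\<^esub> ?hj) = \<zero>\<^bsub>E ?m X B'\<^esub>"
    by (rule linear_minus_eq_zero[OF ED E_module[OF X T3(3)] E_cov_linear[OF X T3(2,3,5)] v(1) hj eq])
  then obtain w where w: "w \<in> carrier (E ?m X C)" "ecov ?m X C D p w = v \<ominus>\<^bsub>E ?m X D\<^esub> ?hj"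
    using M s3 X mminus_closed[OF ED v(1) hj] unfolding cov_middle_def by blast
  have hj_zero: "dl ?m D A d2 X ?hj = \<zero>\<^bsub>E (Suc ?m) X A\<^esub>"
    using dl_pull[OF T2(1,2,3,6,5) X j(1)] tri_pull[OF s2] dl_zero[OF T2(1,2) X j(1)] by simp
  have "dl ?m C A d X w = dl ?m D A d2 X (v \<ominus>\<^bsub>E ?m X D\<^esub> ?hj)"
    using dl_pull[OF T(1,3) T2(3,6) T3(4) X w(1)] eqs(3) w(2) by simp
  also have "\<dots> = u \<ominus>\<^bsub>E (Suc ?m) X A\<^esub> \<zero>\<^bsub>E (Suc ?m) X A\<^esub>"
    using linear_minus[OF ED E_module[OF X T(1)] dl_linear[OF T2(1,3,6) X] v(1) hj] hj_zero v(2) by simp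
  also have "\<dots> = u" by (rule mminus_zero[OF E_module[OF X T(1)] u])
  finally show "\<exists>w\<in>carrier (E ?m X C). dl ?m C A d X w = u" using w(1) by blast
qed

lemma cov_exact: "cov_left n \<and> cov_right n \<and> cov_middle (Suc n)"
proof -
  have "cov_left n \<and> cov_right n"
    by (induction n)
      (auto intro: cov_left_base cov_right_base cov_left_step cov_right_step cov_middle_step)
  then show ?thesis using cov_middle_step by blast
qed

lemma inj_cov_injective:
  assumes t: "inj_triangle A J B x y d" and X: "X \<in> obj \<C>" and u: "u \<in> carrier (E (Suc n) X J)"
    and 0: "ecov (Suc n) X J B y u = \<zero>\<^bsub>E (Suc n) X B\<^esub>"
  shows "u = \<zero>\<^bsub>E (Suc n) X J\<^esub>"
proof -
  have s: "s_triangle \<C> A J B x y d" using t by (simp add: inj_triangle_def)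
  obtain w where w: "w \<in> carrier (E (Suc n) X A)" "ecov (Suc n) X A J x w = u"
    using cov_exact[of n] s X u 0 unfolding cov_middle_def by blast
  then show ?thesis using inj_ext_zero[OF t X w(1)] by simp
qed

end

end


section \<open>The contravariant long exact sequence in positive degrees\<close>

context extriangulated_category
begin

lemma du_ext_morphism:
  assumes m: "ext_morphism \<C> C A d C' A' d' a c" and Y: "Y \<in> obj \<C>" and u: "u \<in> carrier (E n A' Y)"
  shows "du n C A d Y (econ n Y A' A a u) = econ (Suc n) Y C' C c (du n C' A' d' Y u)"
proof -
  have T: "A \<in> obj \<C>" "C \<in> obj \<C>" "A' \<in> obj \<C>" "C' \<in> obj \<C>" "d \<in> carrier (Ext \<C> C A)"
    "d' \<in> carrier (Ext \<C> C' A')" and M: "a \<in> mor \<C> A A'" "c \<in> mor \<C> C C'"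
    "xcov C A A' a d = xcon A' C' C c d'"
    using m by (auto simp: ext_morphism_def push_def pull_def)
  show ?thesis
    using du_dinatural[OF T(2) Y T(1,3) M(1) u T(5)] du_contrav[OF T(4,2) Y M(2) T(3) u T(6)] M(3) by simp
qed

definition con_middle where "con_middle n \<longleftrightarrow> (\<forall>A B C x y d Y u. s_triangle \<C> A B C x y d \<longrightarrow> Y \<in> obj \<C> \<longrightarrow>
  u \<in> carrier (E n B Y) \<longrightarrow> econ n Y B A x u = \<zero>\<^bsub>E n A Y\<^esub> \<longrightarrow> (\<exists>w\<in>carrier (E n C Y). econ n Y C B y w = u))"

definition con_left where "con_left n \<longleftrightarrow> (\<forall>A B C x y d Y u. s_triangle \<C> A B C x y d \<longrightarrow> Y \<in> obj \<C> \<longrightarrow>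
  u \<in> carrier (E n A Y) \<longrightarrow> du n C A d Y u = \<zero>\<^bsub>E (Suc n) C Y\<^esub> \<longrightarrow> (\<exists>w\<in>carrier (E n B Y). econ n Y B A x w = u))"

definition con_right where "con_right n \<longleftrightarrow> (\<forall>A B C x y d Y u. s_triangle \<C> A B C x y d \<longrightarrow> Y \<in> obj \<C> \<longrightarrow>
  u \<in> carrier (E (Suc n) C Y) \<longrightarrow> econ (Suc n) Y C B y u = \<zero>\<^bsub>E (Suc n) B Y\<^esub> \<longrightarrow>
  (\<exists>w\<in>carrier (E n A Y). du n C A d Y w = u))"

lemma con_middle_base: "con_middle 0"
  unfolding con_middle_def
proof (intro allI impI)
  fix A B C x y d Y u
  assume s: "s_triangle \<C> A B C x y d" and Y: "Y \<in> obj \<C>" and u: "u \<in> carrier (E 0 B Y)"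
    and 0: "econ 0 Y B A x u = \<zero>\<^bsub>E 0 A Y\<^esub>"
  note T = triD[OF s]
  obtain f where f: "f \<in> mor \<C> B Y" "u = XHom f" using u T Y by (auto simp: E0_simps)
  have "f \<cdot>\<^bsub>\<C>\<^esub> x = \<zero>\<^bsub>Hom \<C> A Y\<^esub>" using 0 f T Y by (simp add: econ_0 E0_simps)
  from con_mid_0[OF s Y f(1) this] show "\<exists>w\<in>carrier (E 0 C Y). econ 0 Y C B y w = u"
    using Y T f by (auto simp: E0_simps econ_0)
qed

lemma con_left_base: "con_left 0"
  unfolding con_left_def
proof (intro allI impI)
  fix A B C x y d Y u
  assume s: "s_triangle \<C> A B C x y d" and Y: "Y \<in> obj \<C>" and u: "u \<in> carrier (E 0 A Y)"
    and 0: "du 0 C A d Y u = \<zero>\<^bsub>E (Suc 0) C Y\<^esub>"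
  note T = triD[OF s]
  obtain f where f: "f \<in> mor \<C> A Y" "u = XHom f" using u T Y by (auto simp: E0_simps)
  have "xcov C A Y f d = \<zero>\<^bsub>Ext \<C> C Y\<^esub>" using 0 f T Y by (simp add: du_0 E1_simps)
  from con_left_0[OF s Y f(1) this] show "\<exists>w\<in>carrier (E 0 B Y). econ 0 Y B A x w = u"
    using Y T f by (auto simp: E0_simps econ_0)
qed

lemma con_right_base: "con_right 0"
  unfolding con_right_def
proof (intro allI impI)
  fix A B C x y d Y u
  assume s: "s_triangle \<C> A B C x y d" and Y: "Y \<in> obj \<C>" and u: "u \<in> carrier (E (Suc 0) C Y)"
    and 0: "econ (Suc 0) Y C B y u = \<zero>\<^bsub>E (Suc 0) B Y\<^esub>"
  note T = triD[OF s]
  obtain v where v: "v \<in> carrier (Ext \<C> C Y)" "u = XExt v" using u Y T by (auto simp: E1_simps)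
  have "xcon Y C B y v = \<zero>\<^bsub>Ext \<C> B Y\<^esub>" using 0 v Y T by (simp add: econ_1 E1_simps)
  from con_right_0[OF s Y v(1) this] show "\<exists>w\<in>carrier (E 0 A Y). du 0 C A d Y w = u"
    using Y T v by (auto simp: E0_simps du_0)
qed

text \<open>
  Lifts along \<open>\<bbbE>\<^sup>n(-, B) \<rightarrow> \<bbbE>\<^sup>n\<^sup>+\<^sup>1(-, A)\<close> may be corrected by elements that come from \<open>J\<close>.
\<close>

lemma inj_dl_cancel:
  assumes t: "inj_triangle A J B i q e" and X: "X \<in> obj \<C>"
    and u: "u \<in> carrier (E n X B)" and v: "v \<in> carrier (E n X J)"
  shows "dl n B A e X (u \<ominus>\<^bsub>E n X B\<^esub> ecov n X J B q v) = dl n B A e X u"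
proof -
  have s: "s_triangle \<C> A J B i q e" using t by (simp add: inj_triangle_def)
  note T = triD[OF s]
  have "dl n B A e X (ecov n X J B q v) = \<zero>\<^bsub>E (Suc n) X A\<^esub>"
    using dl_pull[OF T(1,2,3,6,5) X v] tri_pull[OF s] dl_zero[OF T(1,2) X v] by simp
  then show ?thesis
    using linear_minus[OF E_module[OF X T(3)] E_module[OF X T(1)] dl_linear[OF T(1,3,6) X] u
        E_cov_closed[OF X T(2,3,5) v]]
      mminus_zero[OF E_module[OF X T(1)] dl_closed[OF T(1,3,6) X u]] by simp
qed

lemma inj_ex:
  assumes "enough_injective_morphisms \<C>" "Y \<in> obj \<C>"
  obtains J B i q e where "inj_triangle Y J B i q e"
  using assms unfolding enough_injective_morphisms_def inflation_def inj_triangle_def by blast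

context
  assumes enough: "enough_injective_morphisms \<C>"
begin

text \<open>
  In the three steps, \<open>Y \<rightarrow> J \<rightarrow> Y'\<close> is an injective triangle.  A class \<open>u\<close> with values in \<open>Y\<close> is lifted to a
  class \<open>u'\<close> with values in \<open>Y'\<close> of one degree lower; the obstruction to the required property of \<open>u'\<close> is
  the image of a class with values in \<open>J\<close>.  As \<open>\<bbbE>\<^sup>m(-, J) \<rightarrow> \<bbbE>\<^sup>m(-, Y')\<close> is injective for \<open>m > 0\<close>, that class
  is in the kernel of the next map of the sequence for \<open>J\<close>, so it has a preimage there, and subtracting
  the image of this preimage from \<open>u'\<close> removes the obstruction.
\<close>

lemma con_middle_step:
  assumes M: "con_middle n" and L: "con_left n"
  shows "con_middle (Suc n)"
  unfolding con_middle_def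
proof (intro allI impI)
  fix A B C x y d Y u
  assume s: "s_triangle \<C> A B C x y d" and Y: "Y \<in> obj \<C>" and u: "u \<in> carrier (E (Suc n) B Y)"
    and 0: "econ (Suc n) Y B A x u = \<zero>\<^bsub>E (Suc n) A Y\<^esub>"
  obtain J Y' i q e where i: "inj_triangle Y J Y' i q e" by (rule inj_ex[OF enough Y])
  have s1: "s_triangle \<C> Y J Y' i q e" using i by (simp add: inj_triangle_def)
  note T = triD[OF s] and T1 = triD[OF s1]
  obtain u' where u': "u' \<in> carrier (E n B Y')" "dl n Y' Y e B u' = u"
    using inj_dl_surj[OF i T(2) u] by blast
  let ?xu = "econ n Y' B A x u'"
  have xu: "?xu \<in> carrier (E n A Y')" by (rule E_contrav_closed[OF T(2,1) T1(3) T(4) u'(1)])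
  have "dl n Y' Y e A ?xu = \<zero>\<^bsub>E (Suc n) A Y\<^esub>"
    using dl_natural[OF T1(1,3,6) T(2,1,4) u'(1)] u'(2) 0 by simp
  then obtain j where j: "j \<in> carrier (E n A J)" "ecov n A J Y' q j = ?xu"
    using inj_dl_kernel[OF i T(1) xu] by blast
  have "ecov (Suc n) C J Y' q (du n C A d J j) = du n C A d Y' ?xu"
    using du_cov[OF T(3) T1(2,3,5) T(1) j(1) T(6)] j(2) by simp
  also have "\<dots> = du n C B \<zero>\<^bsub>Ext \<C> C B\<^esub> Y' u'"
    using du_dinatural[OF T(3) T1(3) T(1,2,4) u'(1) T(6)] tri_push[OF s] by simp
  also have "\<dots> = \<zero>\<^bsub>E (Suc n) C Y'\<^esub>"
    by (rule linear_zero[OF F_module[OF T(3,2)] E_module[OF T(3) T1(3)] du_linear_right[OF T(3) T1(3) T(2) u'(1)]])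
  finally have "du n C A d J j = \<zero>\<^bsub>E (Suc n) C J\<^esub>"
    by (rule inj_cov_injective[OF enough i T(3) du_closed[OF T(3) T1(2) T(1,6) j(1)]])
  then obtain b where b: "b \<in> carrier (E n B J)" "econ n J B A x b = j"
    using L s T1(2) j(1) unfolding con_left_def by blast
  let ?qb = "ecov n B J Y' q b"
  have qb: "?qb \<in> carrier (E n B Y')" by (rule E_cov_closed[OF T(2) T1(2,3,5) b(1)])
  note EB = E_module[OF T(2) T1(3), of n]
  have v: "u' \<ominus>\<^bsub>E n B Y'\<^esub> ?qb \<in> carrier (E n B Y')" by (rule mminus_closed[OF EB u'(1) qb])
  have eq: "?xu = econ n Y' B A x ?qb"
    using E_cov_contrav[OF T(2,1) T1(2,3) T(4) T1(5) b(1)] b(2) j(2) by simp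
  have "econ n Y' B A x (u' \<ominus>\<^bsub>E n B Y'\<^esub> ?qb) = \<zero>\<^bsub>E n A Y'\<^esub>"
    by (rule linear_minus_eq_zero[OF EB E_module[OF T(1) T1(3)] E_contrav_linear[OF T(2,1) T1(3) T(4)] u'(1) qb eq])
  then obtain w where w: "w \<in> carrier (E n C Y')" "econ n Y' C B y w = u' \<ominus>\<^bsub>E n B Y'\<^esub> ?qb"
    using M s T1(3) v unfolding con_middle_def by blast
  have "econ (Suc n) Y C B y (dl n Y' Y e C w) = u"
    using dl_natural[OF T1(1,3,6) T(3,2,5) w(1)] w(2) inj_dl_cancel[OF i T(2) u'(1) b(1)] u'(2) by simp
  then show "\<exists>w\<in>carrier (E (Suc n) C Y). econ (Suc n) Y C B y w = u"
    using dl_closed[OF T1(1,3,6) T(3) w(1)] by blast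
qed

lemma con_left_step:
  assumes L: "con_left n" and Ri: "con_right n"
  shows "con_left (Suc n)"
  unfolding con_left_def
proof (intro allI impI)
  fix A B C x y d Y u
  assume s: "s_triangle \<C> A B C x y d" and Y: "Y \<in> obj \<C>" and u: "u \<in> carrier (E (Suc n) A Y)"
    and 0: "du (Suc n) C A d Y u = \<zero>\<^bsub>E (Suc (Suc n)) C Y\<^esub>"
  obtain J Y' i q e where i: "inj_triangle Y J Y' i q e" by (rule inj_ex[OF enough Y])
  have s1: "s_triangle \<C> Y J Y' i q e" using i by (simp add: inj_triangle_def)
  note T = triD[OF s] and T1 = triD[OF s1]
  obtain u' where u': "u' \<in> carrier (E n A Y')" "dl n Y' Y e A u' = u"
    using inj_dl_surj[OF i T(1) u] by blast
  let ?du = "du n C A d Y' u'"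
  have du: "?du \<in> carrier (E (Suc n) C Y')" by (rule du_closed[OF T(3) T1(3) T(1,6) u'(1)])
  have "dl (Suc n) Y' Y e C ?du = \<zero>\<^bsub>E (Suc (Suc n)) C Y\<^esub>"
    using dl_du[OF T1(1,3,6) T(3,1) u'(1) T(6)] u'(2) 0 by simp
  then obtain j where j: "j \<in> carrier (E (Suc n) C J)" "ecov (Suc n) C J Y' q j = ?du"
    using inj_dl_kernel[OF i T(3) du] by blast
  have "ecov (Suc n) B J Y' q (econ (Suc n) J C B y j) = econ (Suc n) Y' C B y ?du"
    using E_cov_contrav[OF T(3,2) T1(2,3) T(5) T1(5) j(1)] j(2) by simp
  also have "\<dots> = du n B A \<zero>\<^bsub>Ext \<C> B A\<^esub> Y' u'"
    using du_contrav[OF T(3,2) T1(3) T(5) T(1) u'(1) T(6)] tri_pull[OF s] by simp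
  also have "\<dots> = \<zero>\<^bsub>E (Suc n) B Y'\<^esub>"
    by (rule linear_zero[OF F_module[OF T(2,1)] E_module[OF T(2) T1(3)] du_linear_right[OF T(2) T1(3) T(1) u'(1)]])
  finally have "econ (Suc n) J C B y j = \<zero>\<^bsub>E (Suc n) B J\<^esub>"
    by (rule inj_cov_injective[OF enough i T(2) E_contrav_closed[OF T(3,2) T1(2) T(5) j(1)]])
  then obtain a where a: "a \<in> carrier (E n A J)" "du n C A d J a = j"
    using Ri s T1(2) j(1) unfolding con_right_def by blast
  let ?qa = "ecov n A J Y' q a"
  have qa: "?qa \<in> carrier (E n A Y')" by (rule E_cov_closed[OF T(1) T1(2,3,5) a(1)])
  note EA = E_module[OF T(1) T1(3), of n]
  have v: "u' \<ominus>\<^bsub>E n A Y'\<^esub> ?qa \<in> carrier (E n A Y')" by (rule mminus_closed[OF EA u'(1) qa])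
  have eq: "?du = du n C A d Y' ?qa"
    using du_cov[OF T(3) T1(2,3,5) T(1) a(1) T(6)] a(2) j(2) by simp
  have "du n C A d Y' (u' \<ominus>\<^bsub>E n A Y'\<^esub> ?qa) = \<zero>\<^bsub>E (Suc n) C Y'\<^esub>"
    by (rule linear_minus_eq_zero[OF EA E_module[OF T(3) T1(3)] du_linear[OF T(3) T1(3) T(1,6)] u'(1) qa eq])
  then obtain b where b: "b \<in> carrier (E n B Y')" "econ n Y' B A x b = u' \<ominus>\<^bsub>E n A Y'\<^esub> ?qa"
    using L s T1(3) v unfolding con_left_def by blast
  have "econ (Suc n) Y B A x (dl n Y' Y e B b) = u"
    using dl_natural[OF T1(1,3,6) T(2,1,4) b(1)] b(2) inj_dl_cancel[OF i T(1) u'(1) a(1)] u'(2) by simp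
  then show "\<exists>w\<in>carrier (E (Suc n) B Y). econ (Suc n) Y B A x w = u"
    using dl_closed[OF T1(1,3,6) T(2) b(1)] by blast
qed

lemma con_right_step:
  assumes M: "con_middle (Suc n)" and Ri: "con_right n"
  shows "con_right (Suc n)"
  unfolding con_right_def
proof (intro allI impI)
  fix A B C x y d Y u
  let ?m = "Suc n"
  assume s: "s_triangle \<C> A B C x y d" and Y: "Y \<in> obj \<C>" and u: "u \<in> carrier (E (Suc ?m) C Y)"
    and 0: "econ (Suc ?m) Y C B y u = \<zero>\<^bsub>E (Suc ?m) B Y\<^esub>"
  obtain J Y' i q e where i: "inj_triangle Y J Y' i q e" by (rule inj_ex[OF enough Y])
  have s1: "s_triangle \<C> Y J Y' i q e" using i by (simp add: inj_triangle_def)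
  note T = triD[OF s] and T1 = triD[OF s1]
  obtain u' where u': "u' \<in> carrier (E ?m C Y')" "dl ?m Y' Y e C u' = u"
    using inj_dl_surj[OF i T(3) u] by blast
  let ?yu = "econ ?m Y' C B y u'"
  have yu: "?yu \<in> carrier (E ?m B Y')" by (rule E_contrav_closed[OF T(3,2) T1(3) T(5) u'(1)])
  have "dl ?m Y' Y e B ?yu = \<zero>\<^bsub>E (Suc ?m) B Y\<^esub>"
    using dl_natural[OF T1(1,3,6) T(3,2,5) u'(1)] u'(2) 0 by simp
  then obtain j where j: "j \<in> carrier (E ?m B J)" "ecov ?m B J Y' q j = ?yu"
    using inj_dl_kernel[OF i T(2) yu] by blast
  have "ecov ?m A J Y' q (econ ?m J B A x j) = econ ?m Y' B A x ?yu"
    using E_cov_contrav[OF T(2,1) T1(2,3) T(4) T1(5) j(1)] j(2) by simp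
  also have "\<dots> = \<zero>\<^bsub>E ?m A Y'\<^esub>"
    using E_contrav_cmp[OF T(3,2,1) T1(3) T(5,4) u'(1)] tri_cmp[OF s] E_contrav_zero[OF T(3,1) T1(3) u'(1)]
    by simp
  finally have "econ ?m J B A x j = \<zero>\<^bsub>E ?m A J\<^esub>"
    by (rule inj_cov_injective[OF enough i T(1) E_contrav_closed[OF T(2,1) T1(2) T(4) j(1)]])
  then obtain c where c: "c \<in> carrier (E ?m C J)" "econ ?m J C B y c = j"
    using M s T1(2) j(1) unfolding con_middle_def by blast
  let ?qc = "ecov ?m C J Y' q c"
  have qc: "?qc \<in> carrier (E ?m C Y')" by (rule E_cov_closed[OF T(3) T1(2,3,5) c(1)])
  note EC = E_module[OF T(3) T1(3), of ?m]
  have v: "u' \<ominus>\<^bsub>E ?m C Y'\<^esub> ?qc \<in> carrier (E ?m C Y')" by (rule mminus_closed[OF EC u'(1) qc])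
  have eq: "?yu = econ ?m Y' C B y ?qc"
    using E_cov_contrav[OF T(3,2) T1(2,3) T(5) T1(5) c(1)] c(2) j(2) by simp
  have "econ ?m Y' C B y (u' \<ominus>\<^bsub>E ?m C Y'\<^esub> ?qc) = \<zero>\<^bsub>E ?m B Y'\<^esub>"
    by (rule linear_minus_eq_zero[OF EC E_module[OF T(2) T1(3)] E_contrav_linear[OF T(3,2) T1(3) T(5)] u'(1) qc eq])
  then obtain a where a: "a \<in> carrier (E n A Y')" "du n C A d Y' a = u' \<ominus>\<^bsub>E ?m C Y'\<^esub> ?qc"
    using Ri s T1(3) v unfolding con_right_def by blast
  have "du ?m C A d Y (dl n Y' Y e A a) = u"
    using dl_du[OF T1(1,3,6) T(3,1) a(1) T(6)] a(2) inj_dl_cancel[OF i T(3) u'(1) c(1)] u'(2) by simp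
  then show "\<exists>w\<in>carrier (E ?m A Y). du ?m C A d Y w = u"
    using dl_closed[OF T1(1,3,6) T(1) a(1)] by blast
qed

lemma con_exact: "con_middle n \<and> con_left n \<and> con_right n"
  by (induction n)
    (auto intro: con_middle_base con_left_base con_right_base con_middle_step con_left_step con_right_step)

end

end


section \<open>Descent of exactness along dimension shifting\<close>

text \<open>
  The descent is carried out for an arbitrary connected sequence of functors.  For \<open>\<bbbE>\<^sub>I\<^sub>I\<close> it starts in
  degree zero.
\<close>

locale extriangulated_connected_sequence =
  extriangulated_category R \<C> + contravariant_connected_sequence R \<C> F Fm conn
  for R :: "('r, 'q) ring_scheme" and \<C> :: "('r, 'o, 'm, 'e, 'z) excat_scheme"
    and F :: "int \<Rightarrow> ('r, 'o, 'a) bimod" and Fm :: "int \<Rightarrow> ('o, 'm, 'a) biact"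
    and conn :: "int \<Rightarrow> 'o \<Rightarrow> 'o \<Rightarrow> 'e \<Rightarrow> 'o \<Rightarrow> 'a \<Rightarrow> 'a"
begin

abbreviation "fcon k \<equiv> contrav \<C> (Fm k)"

lemmas seq_module = bilinear_functor.F_module[OF F_bilinear_functor]
lemmas fcon_linear = bilinear_functor.contrav_linear[OF F_bilinear_functor]
lemmas fcon_closed = bilinear_functor.contrav_closed[OF F_bilinear_functor]
lemmas fcon_cmp = bilinear_functor.contrav_cmp[OF F_bilinear_functor]
lemmas fcon_idn = bilinear_functor.contrav_idn[OF F_bilinear_functor]
lemmas fcon_zero = bilinear_functor.contrav_zero[OF F_bilinear_functor]
lemmas conn_closed = linear_closed[OF conn_linear]

lemma conn_push_con:
  assumes "A \<in> obj \<C>" "A' \<in> obj \<C>" "C \<in> obj \<C>" "d \<in> carrier (Ext \<C> C A)" "a \<in> mor \<C> A A'"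
    "Y \<in> obj \<C>" "u \<in> carrier (F k A' Y)"
  shows "conn k C A' (xcov C A A' a d) Y u = conn k C A d Y (fcon k Y A' A a u)"
proof -
  have d': "xcov C A A' a d \<in> carrier (Ext \<C> C A')" by (rule cov_closed[OF assms(3,1,2,5,4)])
  have "ext_morphism \<C> C A d C A' (xcov C A A' a d) a (idn \<C> C)"
    by (rule ext_morphismI) (use assms d' in \<open>auto intro: idn_mor simp: contrav_idn\<close>)
  from conn_ext_morphism[OF this assms(6,7)] show ?thesis
    using fcon_idn[OF assms(3,6) conn_closed[OF assms(2,3) d' assms(6,7)]] by simp
qed

lemma conn_pull_con:
  assumes "A \<in> obj \<C>" "C \<in> obj \<C>" "C' \<in> obj \<C>" "d \<in> carrier (Ext \<C> C' A)" "c \<in> mor \<C> C C'"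
    "Y \<in> obj \<C>" "u \<in> carrier (F k A Y)"
  shows "conn k C A (xcon A C' C c d) Y u = fcon (k + 1) Y C' C c (conn k C' A d Y u)"
proof -
  have d': "xcon A C' C c d \<in> carrier (Ext \<C> C A)" by (rule contrav_closed[OF assms(3,2,1,5,4)])
  have "ext_morphism \<C> C A (xcon A C' C c d) C' A d (idn \<C> A) c"
    by (rule ext_morphismI) (use assms d' in \<open>auto intro: idn_mor simp: cov_idn\<close>)
  from conn_ext_morphism[OF this assms(6,7)] show ?thesis
    using fcon_idn[OF assms(1,6,7)] by simp
qed

text \<open>
  The zero extension is a pullback along a zero morphism.
\<close>

lemma conn_zero:
  assumes "A \<in> obj \<C>" "C \<in> obj \<C>" "Y \<in> obj \<C>" "u \<in> carrier (F k A Y)"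
  shows "conn k C A \<zero>\<^bsub>Ext \<C> C A\<^esub> Y u = \<zero>\<^bsub>F (k + 1) C Y\<^esub>"
proof -
  note z = zero_ext[OF zobj_obj assms(1)] zero_mor[OF assms(2) zobj_obj]
  have "conn k C A (xcon A zobj C \<zero>\<^bsub>Hom \<C> C zobj\<^esub> \<zero>\<^bsub>Ext \<C> zobj A\<^esub>) Y u
      = fcon (k + 1) Y zobj C \<zero>\<^bsub>Hom \<C> C zobj\<^esub> (conn k zobj A \<zero>\<^bsub>Ext \<C> zobj A\<^esub> Y u)"
    by (rule conn_pull_con[OF assms(1,2) zobj_obj z(1,2) assms(3,4)])
  then show ?thesis
    using contrav_zero[OF zobj_obj assms(2,1) z(1)]
      fcon_zero[OF zobj_obj assms(2,3) conn_closed[OF assms(1) zobj_obj z(1) assms(3,4)]] by simp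
qed

definition middle_exact where "middle_exact k \<longleftrightarrow> (\<forall>A B C x y d Y u. s_triangle \<C> A B C x y d \<longrightarrow> Y \<in> obj \<C> \<longrightarrow>
  u \<in> carrier (F k B Y) \<longrightarrow> fcon k Y B A x u = \<zero>\<^bsub>F k A Y\<^esub> \<longrightarrow> (\<exists>w\<in>carrier (F k C Y). fcon k Y C B y w = u))"

definition left_exact where "left_exact k \<longleftrightarrow> (\<forall>A B C x y d Y u. s_triangle \<C> A B C x y d \<longrightarrow> Y \<in> obj \<C> \<longrightarrow>
  u \<in> carrier (F k A Y) \<longrightarrow> conn k C A d Y u = \<zero>\<^bsub>F (k + 1) C Y\<^esub> \<longrightarrow>
  (\<exists>w\<in>carrier (F k B Y). fcon k Y B A x w = u))"

definition right_exact where "right_exact k \<longleftrightarrow> (\<forall>A B C x y d Y u. s_triangle \<C> A B C x y d \<longrightarrow> Y \<in> obj \<C> \<longrightarrow>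
  u \<in> carrier (F (k + 1) C Y) \<longrightarrow> fcon (k + 1) Y C B y u = \<zero>\<^bsub>F (k + 1) B Y\<^esub> \<longrightarrow>
  (\<exists>w\<in>carrier (F k A Y). conn k C A d Y w = u))"

text \<open>
  In degree \<open>k\<close> the functor is determined by degree \<open>k + 1\<close>: \<open>\<epsilon>\<^sup>\<sharp>\<close> identifies \<open>F\<^sup>k(A, Y)\<close> with the kernel of
  \<open>q\<^sup>* : F\<^sup>k\<^sup>+\<^sup>1(B, Y) \<rightarrow> F\<^sup>k\<^sup>+\<^sup>1(J, Y)\<close>.
\<close>

definition dimension_shift where "dimension_shift k \<longleftrightarrow> (\<forall>A J B i q e Y. inj_triangle A J B i q e \<longrightarrow> Y \<in> obj \<C> \<longrightarrow>
  inj_on (conn k B A e Y) (carrier (F k A Y)) \<and>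
  (\<forall>u\<in>carrier (F (k + 1) B Y). fcon (k + 1) Y B J q u = \<zero>\<^bsub>F (k + 1) J Y\<^esub> \<longrightarrow>
    (\<exists>w\<in>carrier (F k A Y). conn k B A e Y w = u)))"

lemma conn_tri_pull:
  assumes s: "s_triangle \<C> A B C x y d" and Y: "Y \<in> obj \<C>" and u: "u \<in> carrier (F k A Y)"
  shows "fcon (k + 1) Y C B y (conn k C A d Y u) = \<zero>\<^bsub>F (k + 1) B Y\<^esub>"
proof -
  note T = triD[OF s]
  show ?thesis using conn_pull_con[OF T(1,2,3,6,5) Y u] tri_pull[OF s] conn_zero[OF T(1,2) Y u] by simp
qed

lemma conn_tri_push:
  assumes s: "s_triangle \<C> A B C x y d" and Y: "Y \<in> obj \<C>" and u: "u \<in> carrier (F k B Y)"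
  shows "conn k C A d Y (fcon k Y B A x u) = \<zero>\<^bsub>F (k + 1) C Y\<^esub>"
proof -
  note T = triD[OF s]
  show ?thesis using conn_push_con[OF T(1,2,3,6,4) Y u] tri_push[OF s] conn_zero[OF T(2,3) Y u] by simp
qed

text \<open>
  Consecutive maps of a connected sequence compose to zero because \<open>y x = 0\<close>, \<open>x\<^sub>* \<delta> = 0\<close> and \<open>y\<^sup>* \<delta> = 0\<close>; what
  remains of exactness are the three lifting properties.
\<close>

lemma delta_functorI:
  assumes "\<And>k. middle_exact k" "\<And>k. left_exact k" "\<And>k. right_exact k"
  shows "contravariant_delta_functor R \<C> F Fm conn"
proof (rule contravariant_delta_functor.intro, rule contravariant_connected_sequence_axioms,
    rule contravariant_delta_functor_axioms.intro)
  fix A B C x y d Y k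
  assume s: "s_triangle \<C> A B C x y d" and Y: "Y \<in> obj \<C>"
  note T = triD[OF s]
  show "exact_at (F k C Y) (F k B Y) (F k A Y) (fcon k Y C B y) (fcon k Y B A x)"
  proof (rule exact_atI)
    fix u assume u: "u \<in> carrier (F k C Y)"
    show "fcon k Y C B y u \<in> carrier (F k B Y)" by (rule fcon_closed[OF T(3,2) Y T(5) u])
    show "fcon k Y B A x (fcon k Y C B y u) = \<zero>\<^bsub>F k A Y\<^esub>"
      using fcon_cmp[OF T(3,2,1) Y T(5,4) u] tri_cmp[OF s] fcon_zero[OF T(3,1) Y u] by simp
  next
    fix v assume "v \<in> carrier (F k B Y)" "fcon k Y B A x v = \<zero>\<^bsub>F k A Y\<^esub>"
    then show "\<exists>u\<in>carrier (F k C Y). fcon k Y C B y u = v"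
      using assms(1)[of k] s Y unfolding middle_exact_def by blast
  qed
  show "exact_at (F k B Y) (F k A Y) (F (k + 1) C Y) (fcon k Y B A x) (conn k C A d Y)"
  proof (rule exact_atI)
    fix u assume u: "u \<in> carrier (F k B Y)"
    show "fcon k Y B A x u \<in> carrier (F k A Y)" by (rule fcon_closed[OF T(2,1) Y T(4) u])
    show "conn k C A d Y (fcon k Y B A x u) = \<zero>\<^bsub>F (k + 1) C Y\<^esub>" by (rule conn_tri_push[OF s Y u])
  next
    fix v assume "v \<in> carrier (F k A Y)" "conn k C A d Y v = \<zero>\<^bsub>F (k + 1) C Y\<^esub>"
    then show "\<exists>u\<in>carrier (F k B Y). fcon k Y B A x u = v"
      using assms(2)[of k] s Y unfolding left_exact_def by blast
  qed
  show "exact_at (F k A Y) (F (k + 1) C Y) (F (k + 1) B Y) (conn k C A d Y) (fcon (k + 1) Y C B y)"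
  proof (rule exact_atI)
    fix u assume u: "u \<in> carrier (F k A Y)"
    show "conn k C A d Y u \<in> carrier (F (k + 1) C Y)" by (rule conn_closed[OF T(1,3,6) Y u])
    show "fcon (k + 1) Y C B y (conn k C A d Y u) = \<zero>\<^bsub>F (k + 1) B Y\<^esub>" by (rule conn_tri_pull[OF s Y u])
  next
    fix v assume "v \<in> carrier (F (k + 1) C Y)" "fcon (k + 1) Y C B y v = \<zero>\<^bsub>F (k + 1) B Y\<^esub>"
    then show "\<exists>u\<in>carrier (F k A Y). conn k C A d Y u = v"
      using assms(3)[of k] s Y unfolding right_exact_def by blast
  qed
qed

context
  assumes enough: "enough_injective_morphisms \<C>"
begin

text \<open>
  An element \<open>u\<close> of \<open>F(C)\<close> in degree \<open>k + 1\<close> with \<open>y\<^sup>* u = 0\<close> extends to \<open>a\<close> on \<open>D\<close>, by exactness for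
  \<open>C \<rightarrow> D \<rightarrow> B'\<close>.  The restriction of \<open>a\<close> to \<open>J\<close> vanishes on \<open>B\<close>, so it comes from \<open>B'\<close>, and subtracting this
  contribution from \<open>a\<close> gives an extension of \<open>u\<close> that vanishes on \<open>J\<close>, that is, an element of \<open>F(A)\<close> in
  degree \<open>k\<close>.
\<close>

lemma shift_right:
  assumes M: "middle_exact (k + 1)" and L: "left_exact (k + 1)" and S: "dimension_shift k"
  shows "right_exact k"
  unfolding right_exact_def
proof (intro allI impI)
  let ?k = "k + 1"
  fix A B C x y d Y u
  assume s: "s_triangle \<C> A B C x y d" and Y: "Y \<in> obj \<C>" and u: "u \<in> carrier (F ?k C Y)"
    and 0: "fcon ?k Y C B y u = \<zero>\<^bsub>F ?k B Y\<^esub>"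
  obtain J B' g g' d' D p e h d2 where r: "rotated A B C x y d J B' g g' d' D p e h d2"
    by (rule rotation[OF enough s])
  note i1 = rotatedD(1)[OF r] and i2 = rotatedD(2)[OF r] and s1 = rotatedD(3)[OF r]
    and s2 = rotatedD(4)[OF r] and s3 = rotatedD(5)[OF r] and eqs = rotatedD(6-9)[OF r]
  note T = triD[OF s] and T1 = triD[OF s1] and T2 = triD[OF s2] and T3 = triD[OF s3]
  have "conn ?k B' C (xcov B' B C y d') Y u = \<zero>\<^bsub>F (?k + 1) B' Y\<^esub>"
    using conn_push_con[OF T(2,3) T1(3,6) T(5) Y u] 0
      linear_zero[OF seq_module[OF T(2) Y] seq_module[OF T1(3) Y] conn_linear[OF T1(1,3,6) Y]] by simp
  then obtain a where a: "a \<in> carrier (F ?k D Y)" "fcon ?k Y D C p a = u"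
    using L s3 Y u unfolding left_exact_def by blast
  let ?ha = "fcon ?k Y D J h a"
  have ha: "?ha \<in> carrier (F ?k J Y)" by (rule fcon_closed[OF T2(3,2) Y T2(5) a(1)])
  have "fcon ?k Y J B g ?ha = fcon ?k Y C B y u"
    using fcon_cmp[OF T2(3,2) T(2) Y T2(5) T1(4) a(1)] fcon_cmp[OF T3(2) T(3,2) Y T3(4) T(5) a(1)]
      eqs(1) a(2) by simp
  then obtain w where w: "w \<in> carrier (F ?k B' Y)" "fcon ?k Y B' J g' w = ?ha"
    using M s1 Y ha 0 unfolding middle_exact_def by metis
  let ?ew = "fcon ?k Y B' D e w"
  have ew: "?ew \<in> carrier (F ?k D Y)" by (rule fcon_closed[OF T3(3,2) Y T3(5) w(1)])
  note FD = seq_module[OF T2(3) Y, of ?k]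
  let ?a = "a \<ominus>\<^bsub>F ?k D Y\<^esub> ?ew"
  have ac: "?a \<in> carrier (F ?k D Y)" by (rule mminus_closed[OF FD a(1) ew])
  have eq: "?ha = fcon ?k Y D J h ?ew"
    using fcon_cmp[OF T3(3,2) T2(2) Y T3(5) T2(5) w(1)] eqs(2) w(2) by simp
  have "fcon ?k Y D J h ?a = \<zero>\<^bsub>F ?k J Y\<^esub>"
    by (rule linear_minus_eq_zero[OF FD seq_module[OF T2(2) Y] fcon_linear[OF T2(3,2) Y T2(5)] a(1) ew eq])
  then obtain b where b: "b \<in> carrier (F k A Y)" "conn k D A d2 Y b = ?a"
    using S i2 Y ac unfolding dimension_shift_def by blast
  have "fcon ?k Y D C p ?ew = \<zero>\<^bsub>F ?k C Y\<^esub>"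
    using fcon_cmp[OF T3(3,2,1) Y T3(5,4) w(1)] tri_cmp[OF s3] fcon_zero[OF T3(3,1) Y w(1)] by simp
  then have "fcon ?k Y D C p ?a = u"
    using linear_minus[OF FD seq_module[OF T(3) Y] fcon_linear[OF T3(2,1) Y T3(4)] a(1) ew] a(2)
      mminus_zero[OF seq_module[OF T(3) Y] u] by simp
  then have "conn k C A d Y b = u"
    using conn_pull_con[OF T(1,3) T2(3,6) T3(4) Y b(1)] eqs(3) b(2) by simp
  then show "\<exists>w\<in>carrier (F k A Y). conn k C A d Y w = u" using b(1) by blast
qed

lemma conn_rotation:
  assumes x: "x \<in> mor \<C> A B" and e: "e \<in> mor \<C> D B'" and obs: "A \<in> obj \<C>" "B \<in> obj \<C>" "D \<in> obj \<C>" "B' \<in> obj \<C>"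
    and d: "d2 \<in> carrier (Ext \<C> D A)" "d' \<in> carrier (Ext \<C> B' B)"
    and eq: "xcov D A B x d2 = xcon B B' D e d'" and Y: "Y \<in> obj \<C>" and b: "b \<in> carrier (F k B Y)"
  shows "conn k D A d2 Y (fcon k Y B A x b) = fcon (k + 1) Y B' D e (conn k B' B d' Y b)"
  by (rule conn_ext_morphism[OF ext_morphismI Y b]) (use assms in auto)

text \<open>
  Under the identification with kernels, \<open>x\<^sup>*\<close> in degree \<open>k\<close> is the restriction of \<open>e\<^sup>*\<close> in degree \<open>k + 1\<close>, and
  \<open>\<delta>\<^sup>\<sharp>\<close> is that of \<open>p\<^sup>*\<close>.
\<close>

lemma shift_left:
  assumes M: "middle_exact (k + 1)" and S: "dimension_shift k"
  shows "left_exact k"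
  unfolding left_exact_def
proof (intro allI impI)
  let ?k = "k + 1"
  fix A B C x y d Y u
  assume s: "s_triangle \<C> A B C x y d" and Y: "Y \<in> obj \<C>" and u: "u \<in> carrier (F k A Y)"
    and 0: "conn k C A d Y u = \<zero>\<^bsub>F ?k C Y\<^esub>"
  obtain J B' g g' d' D p e h d2 where r: "rotated A B C x y d J B' g g' d' D p e h d2"
    by (rule rotation[OF enough s])
  note i1 = rotatedD(1)[OF r] and i2 = rotatedD(2)[OF r] and s1 = rotatedD(3)[OF r]
    and s2 = rotatedD(4)[OF r] and s3 = rotatedD(5)[OF r] and eqs = rotatedD(6-9)[OF r]
  note T = triD[OF s] and T1 = triD[OF s1] and T2 = triD[OF s2] and T3 = triD[OF s3]
  let ?a = "conn k D A d2 Y u"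
  have a: "?a \<in> carrier (F ?k D Y)" by (rule conn_closed[OF T2(1,3,6) Y u])
  have "fcon ?k Y D C p ?a = \<zero>\<^bsub>F ?k C Y\<^esub>"
    using conn_pull_con[OF T(1,3) T2(3,6) T3(4) Y u] eqs(3) 0 by simp
  then obtain b where b: "b \<in> carrier (F ?k B' Y)" "fcon ?k Y B' D e b = ?a"
    using M s3 Y a unfolding middle_exact_def by blast
  have "fcon ?k Y B' J g' b = \<zero>\<^bsub>F ?k J Y\<^esub>"
    using fcon_cmp[OF T3(3,2) T2(2) Y T3(5) T2(5) b(1)] eqs(2) b(2) conn_tri_pull[OF s2 Y u] by simp
  then obtain w where w: "w \<in> carrier (F k B Y)" "conn k B' B d' Y w = b"
    using S i1 Y b(1) unfolding dimension_shift_def by blast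
  have "conn k D A d2 Y (fcon k Y B A x w) = ?a"
    using conn_rotation[OF T(4) T3(5) T(1,2) T3(2,3) T2(6) T1(6) eqs(4) Y w(1)] w(2) b(2) by simp
  moreover have "inj_on (conn k D A d2 Y) (carrier (F k A Y))"
    using S i2 Y unfolding dimension_shift_def by blast
  ultimately have "fcon k Y B A x w = u"
    using fcon_closed[OF T(2,1) Y T(4) w(1)] u by (metis inj_onD)
  then show "\<exists>w\<in>carrier (F k B Y). fcon k Y B A x w = u" using w(1) by blast
qed

text \<open>
  The connecting map of \<open>C \<rightarrow> D \<rightarrow> B'\<close> is \<open>y\<^sup>*\<close> followed by the identification of \<open>F(B)\<close> with a kernel, so
  exactness at \<open>F(B)\<close> is exactness at \<open>F(B')\<close> one degree higher.
\<close>

lemma shift_middle: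
  assumes Ri: "right_exact k" and S: "dimension_shift k"
  shows "middle_exact k"
  unfolding middle_exact_def
proof (intro allI impI)
  let ?k = "k + 1"
  fix A B C x y d Y u
  assume s: "s_triangle \<C> A B C x y d" and Y: "Y \<in> obj \<C>" and u: "u \<in> carrier (F k B Y)"
    and 0: "fcon k Y B A x u = \<zero>\<^bsub>F k A Y\<^esub>"
  obtain J B' g g' d' D p e h d2 where r: "rotated A B C x y d J B' g g' d' D p e h d2"
    by (rule rotation[OF enough s])
  note i1 = rotatedD(1)[OF r] and i2 = rotatedD(2)[OF r] and s1 = rotatedD(3)[OF r]
    and s2 = rotatedD(4)[OF r] and s3 = rotatedD(5)[OF r] and eqs = rotatedD(6-9)[OF r]
  note T = triD[OF s] and T1 = triD[OF s1] and T2 = triD[OF s2] and T3 = triD[OF s3]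
  let ?b = "conn k B' B d' Y u"
  have b: "?b \<in> carrier (F ?k B' Y)" by (rule conn_closed[OF T1(1,3,6) Y u])
  have "fcon ?k Y B' D e ?b = \<zero>\<^bsub>F ?k D Y\<^esub>"
    using conn_rotation[OF T(4) T3(5) T(1,2) T3(2,3) T2(6) T1(6) eqs(4) Y u] 0
      linear_zero[OF seq_module[OF T(1) Y] seq_module[OF T2(3) Y] conn_linear[OF T2(1,3,6) Y]] by simp
  then obtain w where w: "w \<in> carrier (F k C Y)" "conn k B' C (xcov B' B C y d') Y w = ?b"
    using Ri s3 Y b unfolding right_exact_def by blast
  have "conn k B' B d' Y (fcon k Y C B y w) = ?b"
    using conn_push_con[OF T(2,3) T1(3,6) T(5) Y w(1)] w(2) by simp
  moreover have "inj_on (conn k B' B d' Y) (carrier (F k B Y))"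
    using S i1 Y unfolding dimension_shift_def by blast
  ultimately have "fcon k Y C B y w = u"
    using fcon_closed[OF T(3,2) Y T(5) w(1)] u by (metis inj_onD)
  then show "\<exists>w\<in>carrier (F k C Y). fcon k Y C B y w = u" using w(1) by blast
qed

end

end


section \<open>Modules of natural transformations\<close>

locale nat_trans_data = linear_category R \<C>
  for R :: "('r, 'q) ring_scheme" and \<C> :: "('r, 'o, 'm, 'z) lincat_scheme" +
  fixes P :: "'o \<Rightarrow> ('r, 'a) module" and Pm :: "'o \<Rightarrow> 'o \<Rightarrow> 'm \<Rightarrow> 'a \<Rightarrow> 'a"
    and Q :: "'o \<Rightarrow> ('r, 'b) module" and Qm :: "'o \<Rightarrow> 'o \<Rightarrow> 'm \<Rightarrow> 'b \<Rightarrow> 'b"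
  assumes P_module: "W \<in> obj \<C> \<Longrightarrow> module R (P W)"
    and Q_module: "W \<in> obj \<C> \<Longrightarrow> module R (Q W)"
    and Pm_closed: "\<lbrakk>W \<in> obj \<C>; W' \<in> obj \<C>; f \<in> mor \<C> W' W; u \<in> carrier (P W)\<rbrakk>
      \<Longrightarrow> Pm W W' f u \<in> carrier (P W')"
    and Qm_linear: "\<lbrakk>W \<in> obj \<C>; W' \<in> obj \<C>; f \<in> mor \<C> W' W\<rbrakk>
      \<Longrightarrow> Qm W W' f \<in> linear_maps R (Q W) (Q W')"
begin

abbreviation "Nt \<equiv> nat_trans_module R \<C> P Pm Q Qm"

lemma nat_transI:
  assumes lin: "\<And>W. W \<in> obj \<C> \<Longrightarrow> \<phi> W \<in> linear_maps R (P W) (Q W)"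
    and nat: "\<And>W W' f u. \<lbrakk>W \<in> obj \<C>; W' \<in> obj \<C>; f \<in> mor \<C> W' W; u \<in> carrier (P W)\<rbrakk>
      \<Longrightarrow> \<phi> W' (Pm W W' f u) = Qm W W' f (\<phi> W u)"
  shows "(\<lambda>W\<in>obj \<C>. \<lambda>u\<in>carrier (P W). \<phi> W u) \<in> carrier Nt"
proof -
  have "restrict (\<phi> W) (carrier (P W)) \<in> linear_maps R (P W) (Q W)" if "W \<in> obj \<C>" for W
    by (rule linear_cong[OF lin[OF that] P_module[OF that]]) simp
  then show ?thesis by (auto simp: nat_trans_module_def nat Pm_closed)
qed

lemma nat_trans_linear: "\<lbrakk>\<tau> \<in> carrier Nt; W \<in> obj \<C>\<rbrakk> \<Longrightarrow> \<tau> W \<in> linear_maps R (P W) (Q W)"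
  by (auto simp: nat_trans_module_def)

lemma nat_trans_natural:
  "\<lbrakk>\<tau> \<in> carrier Nt; W \<in> obj \<C>; W' \<in> obj \<C>; f \<in> mor \<C> W' W; u \<in> carrier (P W)\<rbrakk>
    \<Longrightarrow> \<tau> W' (Pm W W' f u) = Qm W W' f (\<tau> W u)"
  by (auto simp: nat_trans_module_def)

lemma nat_trans_eqI:
  assumes \<tau>: "\<tau> \<in> carrier Nt" and \<sigma>: "\<sigma> \<in> carrier Nt"
    and eq: "\<And>W u. \<lbrakk>W \<in> obj \<C>; u \<in> carrier (P W)\<rbrakk> \<Longrightarrow> \<tau> W u = \<sigma> W u"
  shows "\<tau> = \<sigma>"
proof (rule extensionalityI[of _ "obj \<C>"])
  show "\<tau> \<in> extensional (obj \<C>)" "\<sigma> \<in> extensional (obj \<C>)"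
    using \<tau> \<sigma> by (auto simp: nat_trans_module_def PiE_def)
  show "\<tau> W = \<sigma> W" if "W \<in> obj \<C>" for W
    by (rule extensionalityI[of _ "carrier (P W)"]) (use \<tau> \<sigma> eq that in \<open>auto simp: nat_trans_module_def PiE_def\<close>)
qed

lemma nat_trans_val:
  assumes "W \<in> obj \<C>" "u \<in> carrier (P W)"
  shows "\<zero>\<^bsub>Nt\<^esub> W u = \<zero>\<^bsub>Q W\<^esub>" "(\<sigma> \<oplus>\<^bsub>Nt\<^esub> \<tau>) W u = \<sigma> W u \<oplus>\<^bsub>Q W\<^esub> \<tau> W u"
    "(r \<odot>\<^bsub>Nt\<^esub> \<tau>) W u = r \<odot>\<^bsub>Q W\<^esub> \<tau> W u"
  using assms by (simp_all add: nat_trans_module_def)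

lemma nat_trans_ops:
  shows "\<zero>\<^bsub>Nt\<^esub> \<in> carrier Nt"
    and "\<lbrakk>\<sigma> \<in> carrier Nt; \<tau> \<in> carrier Nt\<rbrakk> \<Longrightarrow> \<sigma> \<oplus>\<^bsub>Nt\<^esub> \<tau> \<in> carrier Nt"
    and "\<lbrakk>r \<in> carrier R; \<tau> \<in> carrier Nt\<rbrakk> \<Longrightarrow> r \<odot>\<^bsub>Nt\<^esub> \<tau> \<in> carrier Nt"
proof -
  have z: "\<zero>\<^bsub>Nt\<^esub> = (\<lambda>W\<in>obj \<C>. \<lambda>u\<in>carrier (P W). \<zero>\<^bsub>Q W\<^esub>)" by (simp add: nat_trans_module_def)
  show "\<zero>\<^bsub>Nt\<^esub> \<in> carrier Nt" unfolding z
    by (rule nat_transI) (auto intro: linear_zero_map Q_module simp: linear_zero[OF Q_module Q_module Qm_linear])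
  show "\<sigma> \<oplus>\<^bsub>Nt\<^esub> \<tau> \<in> carrier Nt" if \<sigma>: "\<sigma> \<in> carrier Nt" and \<tau>: "\<tau> \<in> carrier Nt"
  proof -
    have eq: "\<sigma> \<oplus>\<^bsub>Nt\<^esub> \<tau> = (\<lambda>W\<in>obj \<C>. \<lambda>u\<in>carrier (P W). \<sigma> W u \<oplus>\<^bsub>Q W\<^esub> \<tau> W u)"
      by (simp add: nat_trans_module_def)
    note ls = nat_trans_linear[OF \<sigma>] and lt = nat_trans_linear[OF \<tau>]
    show ?thesis unfolding eq
    proof (rule nat_transI)
      fix W assume W: "W \<in> obj \<C>"
      interpret N: module R "Q W" by (rule Q_module[OF W])
      show "(\<lambda>u. \<sigma> W u \<oplus>\<^bsub>Q W\<^esub> \<tau> W u) \<in> linear_maps R (P W) (Q W)"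
        by (intro linearI) (simp_all add: linear_closed[OF ls[OF W]] linear_closed[OF lt[OF W]]
          linear_add[OF ls[OF W]] linear_add[OF lt[OF W]] linear_smult[OF ls[OF W]] linear_smult[OF lt[OF W]]
          N.a_ac N.smult_r_distr)
    next
      fix W W' f u
      assume a: "W \<in> obj \<C>" "W' \<in> obj \<C>" "f \<in> mor \<C> W' W" "u \<in> carrier (P W)"
      then show "\<sigma> W' (Pm W W' f u) \<oplus>\<^bsub>Q W'\<^esub> \<tau> W' (Pm W W' f u) = Qm W W' f (\<sigma> W u \<oplus>\<^bsub>Q W\<^esub> \<tau> W u)"
        by (simp add: nat_trans_natural[OF \<sigma> a] nat_trans_natural[OF \<tau> a] linear_add[OF Qm_linear]
            linear_closed[OF ls] linear_closed[OF lt])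
    qed
  qed
  show "r \<odot>\<^bsub>Nt\<^esub> \<tau> \<in> carrier Nt" if r: "r \<in> carrier R" and \<tau>: "\<tau> \<in> carrier Nt"
  proof -
    have eq: "r \<odot>\<^bsub>Nt\<^esub> \<tau> = (\<lambda>W\<in>obj \<C>. \<lambda>u\<in>carrier (P W). r \<odot>\<^bsub>Q W\<^esub> \<tau> W u)"
      by (simp add: nat_trans_module_def)
    note lt = nat_trans_linear[OF \<tau>]
    show ?thesis unfolding eq
    proof (rule nat_transI)
      fix W assume W: "W \<in> obj \<C>"
      interpret N: module R "Q W" by (rule Q_module[OF W])
      show "(\<lambda>u. r \<odot>\<^bsub>Q W\<^esub> \<tau> W u) \<in> linear_maps R (P W) (Q W)"
        using r by (intro linearI) (simp_all add: linear_closed[OF lt[OF W]]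
          linear_add[OF lt[OF W]] linear_smult[OF lt[OF W]] N.smult_r_distr N.smult_assoc1[symmetric] m_comm)
    next
      fix W W' f u
      assume a: "W \<in> obj \<C>" "W' \<in> obj \<C>" "f \<in> mor \<C> W' W" "u \<in> carrier (P W)"
      then show "r \<odot>\<^bsub>Q W'\<^esub> \<tau> W' (Pm W W' f u) = Qm W W' f (r \<odot>\<^bsub>Q W\<^esub> \<tau> W u)"
        using r by (simp add: nat_trans_natural[OF \<tau> a] linear_smult[OF Qm_linear] linear_closed[OF lt])
    qed
  qed
qed

lemma nat_trans_is_module: "module R Nt"
proof (rule moduleI)
  note ops = nat_trans_ops
  note cl = linear_closed[OF nat_trans_linear]
  note eqI = nat_trans_eqI
  show "cring R" by unfold_locales
  show "abelian_group Nt"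
  proof (rule abelian_groupI)
    fix \<tau> assume \<tau>: "\<tau> \<in> carrier Nt"
    show "\<exists>\<sigma>\<in>carrier Nt. \<sigma> \<oplus>\<^bsub>Nt\<^esub> \<tau> = \<zero>\<^bsub>Nt\<^esub>"
    proof (intro bexI eqI)
      show c: "(\<ominus>\<^bsub>R\<^esub> \<one>\<^bsub>R\<^esub>) \<odot>\<^bsub>Nt\<^esub> \<tau> \<in> carrier Nt" using \<tau> by (intro ops) auto
      fix W u assume W: "W \<in> obj \<C>" "u \<in> carrier (P W)"
      interpret N: module R "Q W" by (rule Q_module[OF W(1)])
      show "((\<ominus>\<^bsub>R\<^esub> \<one>\<^bsub>R\<^esub>) \<odot>\<^bsub>Nt\<^esub> \<tau> \<oplus>\<^bsub>Nt\<^esub> \<tau>) W u = \<zero>\<^bsub>Nt\<^esub> W u"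
        using cl[OF \<tau> W] by (simp add: nat_trans_val[OF W] N.smult_l_minus N.l_neg)
    qed (use \<tau> ops in auto)
  next
    fix \<rho> \<sigma> \<tau> assume c: "\<rho> \<in> carrier Nt" "\<sigma> \<in> carrier Nt" "\<tau> \<in> carrier Nt"
    show "\<rho> \<oplus>\<^bsub>Nt\<^esub> \<sigma> \<oplus>\<^bsub>Nt\<^esub> \<tau> = \<rho> \<oplus>\<^bsub>Nt\<^esub> (\<sigma> \<oplus>\<^bsub>Nt\<^esub> \<tau>)"
    proof (intro eqI ops c)
      fix W u assume W: "W \<in> obj \<C>" "u \<in> carrier (P W)"
      interpret N: module R "Q W" by (rule Q_module[OF W(1)])
      show "(\<rho> \<oplus>\<^bsub>Nt\<^esub> \<sigma> \<oplus>\<^bsub>Nt\<^esub> \<tau>) W u = (\<rho> \<oplus>\<^bsub>Nt\<^esub> (\<sigma> \<oplus>\<^bsub>Nt\<^esub> \<tau>)) W u"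
        using c by (simp add: nat_trans_val[OF W] cl W N.a_assoc)
    qed
  next
    fix \<sigma> \<tau> assume c: "\<sigma> \<in> carrier Nt" "\<tau> \<in> carrier Nt"
    show "\<sigma> \<oplus>\<^bsub>Nt\<^esub> \<tau> = \<tau> \<oplus>\<^bsub>Nt\<^esub> \<sigma>"
    proof (intro eqI ops c)
      fix W u assume W: "W \<in> obj \<C>" "u \<in> carrier (P W)"
      interpret N: module R "Q W" by (rule Q_module[OF W(1)])
      show "(\<sigma> \<oplus>\<^bsub>Nt\<^esub> \<tau>) W u = (\<tau> \<oplus>\<^bsub>Nt\<^esub> \<sigma>) W u"
        using c by (simp add: nat_trans_val[OF W] cl W N.a_comm)
    qed
  next
    fix \<tau> assume c: "\<tau> \<in> carrier Nt"
    show "\<zero>\<^bsub>Nt\<^esub> \<oplus>\<^bsub>Nt\<^esub> \<tau> = \<tau>"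
    proof (intro eqI ops c)
      fix W u assume W: "W \<in> obj \<C>" "u \<in> carrier (P W)"
      show "(\<zero>\<^bsub>Nt\<^esub> \<oplus>\<^bsub>Nt\<^esub> \<tau>) W u = \<tau> W u"
        using c by (simp add: nat_trans_val[OF W] cl W madd_zero[OF Q_module])
    qed
  qed (auto intro: ops)
next
  fix r \<tau> assume "r \<in> carrier R" "\<tau> \<in> carrier Nt"
  then show "r \<odot>\<^bsub>Nt\<^esub> \<tau> \<in> carrier Nt" by (rule nat_trans_ops)
next
  fix r s \<tau> assume c: "r \<in> carrier R" "s \<in> carrier R" "\<tau> \<in> carrier Nt"
  show "(r \<oplus>\<^bsub>R\<^esub> s) \<odot>\<^bsub>Nt\<^esub> \<tau> = r \<odot>\<^bsub>Nt\<^esub> \<tau> \<oplus>\<^bsub>Nt\<^esub> s \<odot>\<^bsub>Nt\<^esub> \<tau>"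
    by (intro nat_trans_eqI nat_trans_ops c a_closed)
      (use c in \<open>simp add: nat_trans_val linear_closed[OF nat_trans_linear] module.smult_l_distr[OF Q_module]\<close>)
  show "(r \<otimes>\<^bsub>R\<^esub> s) \<odot>\<^bsub>Nt\<^esub> \<tau> = r \<odot>\<^bsub>Nt\<^esub> (s \<odot>\<^bsub>Nt\<^esub> \<tau>)"
    by (intro nat_trans_eqI nat_trans_ops c m_closed)
      (use c in \<open>simp add: nat_trans_val linear_closed[OF nat_trans_linear] module.smult_assoc1[OF Q_module]\<close>)
next
  fix r \<sigma> \<tau> assume c: "r \<in> carrier R" "\<sigma> \<in> carrier Nt" "\<tau> \<in> carrier Nt"
  show "r \<odot>\<^bsub>Nt\<^esub> (\<sigma> \<oplus>\<^bsub>Nt\<^esub> \<tau>) = r \<odot>\<^bsub>Nt\<^esub> \<sigma> \<oplus>\<^bsub>Nt\<^esub> r \<odot>\<^bsub>Nt\<^esub> \<tau>"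
    by (intro nat_trans_eqI nat_trans_ops c)
      (use c in \<open>simp add: nat_trans_val linear_closed[OF nat_trans_linear] module.smult_r_distr[OF Q_module]\<close>)
next
  fix \<tau> assume c: "\<tau> \<in> carrier Nt"
  show "\<one>\<^bsub>R\<^esub> \<odot>\<^bsub>Nt\<^esub> \<tau> = \<tau>"
    by (intro nat_trans_eqI nat_trans_ops c one_closed)
      (use c in \<open>simp add: nat_trans_val linear_closed[OF nat_trans_linear] module.smult_one[OF Q_module]\<close>)
qed

end


section \<open>Negative extensions\<close>

context extension_tower
begin

abbreviation "NE \<equiv> NExt R \<C>"
abbreviation "NEm \<equiv> NExt_act R \<C>"

lemma Hom_con:
  "\<lbrakk>W \<in> obj \<C>; W' \<in> obj \<C>; Y \<in> obj \<C>; f \<in> mor \<C> W' W; t \<in> mor \<C> W Y\<rbrakk>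
    \<Longrightarrow> contrav \<C> (Hom_act \<C>) Y W W' f t = t \<cdot>\<^bsub>\<C>\<^esub> f"
  by (simp add: contrav_def Hom_act_def cmp_idn_left)

lemma NE_data:
  assumes "X \<in> obj \<C>" "Y \<in> obj \<C>"
  shows "nat_trans_data R \<C> (\<lambda>W. E n W X) (econ n X) (\<lambda>W. Hom \<C> W Y) (contrav \<C> (Hom_act \<C>) Y)"
  by (rule nat_trans_data.intro, rule linear_category_axioms, rule nat_trans_data_axioms.intro)
    (use assms in \<open>simp_all add: E_module Hom_module E_contrav_closed
      bilinear_functor.contrav_linear[OF Hom_bilinear_functor]\<close>)

lemma NE_module: "\<lbrakk>X \<in> obj \<C>; Y \<in> obj \<C>\<rbrakk> \<Longrightarrow> module R (NE n X Y)"
  unfolding NExt_def by (rule nat_trans_data.nat_trans_is_module[OF NE_data])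

lemma NE_linear:
  "\<lbrakk>X \<in> obj \<C>; Y \<in> obj \<C>; \<tau> \<in> carrier (NE n X Y); W \<in> obj \<C>\<rbrakk>
    \<Longrightarrow> \<tau> W \<in> linear_maps R (E n W X) (Hom \<C> W Y)"
  unfolding NExt_def by (rule nat_trans_data.nat_trans_linear[OF NE_data])

lemmas NE_val_closed = linear_closed[OF NE_linear]

lemma NE_natural:
  assumes "X \<in> obj \<C>" "Y \<in> obj \<C>" "\<tau> \<in> carrier (NE n X Y)" "W \<in> obj \<C>" "W' \<in> obj \<C>" "f \<in> mor \<C> W' W"
    "u \<in> carrier (E n W X)"
  shows "\<tau> W' (econ n X W W' f u) = \<tau> W u \<cdot>\<^bsub>\<C>\<^esub> f"
  using nat_trans_data.nat_trans_natural[OF NE_data[OF assms(1,2)] assms(3)[unfolded NExt_def] assms(4-7)]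
    Hom_con[OF assms(4,5,2,6) NE_val_closed[OF assms(1-4,7)]] by simp

lemma NE_eqI:
  assumes "X \<in> obj \<C>" "Y \<in> obj \<C>" "\<tau> \<in> carrier (NE n X Y)" "\<sigma> \<in> carrier (NE n X Y)"
    and "\<And>W u. \<lbrakk>W \<in> obj \<C>; u \<in> carrier (E n W X)\<rbrakk> \<Longrightarrow> \<tau> W u = \<sigma> W u"
  shows "\<tau> = \<sigma>"
  by (rule nat_trans_data.nat_trans_eqI[OF NE_data[OF assms(1,2)] assms(3,4)[unfolded NExt_def] assms(5)])

lemma NE_I:
  assumes XY: "X \<in> obj \<C>" "Y \<in> obj \<C>"
    and lin: "\<And>W. W \<in> obj \<C> \<Longrightarrow> \<phi> W \<in> linear_maps R (E n W X) (Hom \<C> W Y)"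
    and nat: "\<And>W W' f u. \<lbrakk>W \<in> obj \<C>; W' \<in> obj \<C>; f \<in> mor \<C> W' W; u \<in> carrier (E n W X)\<rbrakk>
      \<Longrightarrow> \<phi> W' (econ n X W W' f u) = \<phi> W u \<cdot>\<^bsub>\<C>\<^esub> f"
  shows "(\<lambda>W\<in>obj \<C>. \<lambda>u\<in>carrier (E n W X). \<phi> W u) \<in> carrier (NE n X Y)"
  unfolding NExt_def
  by (rule nat_trans_data.nat_transI[OF NE_data[OF XY] lin])
    (use nat linear_closed[OF lin] XY in \<open>simp_all add: Hom_con\<close>)

lemma NE_val:
  assumes "X \<in> obj \<C>" "Y \<in> obj \<C>" "W \<in> obj \<C>" "u \<in> carrier (E n W X)"
  shows "\<zero>\<^bsub>NE n X Y\<^esub> W u = \<zero>\<^bsub>Hom \<C> W Y\<^esub>" "(\<sigma> \<oplus>\<^bsub>NE n X Y\<^esub> \<tau>) W u = \<sigma> W u \<oplus>\<^bsub>Hom \<C> W Y\<^esub> \<tau> W u"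
    "(r \<odot>\<^bsub>NE n X Y\<^esub> \<tau>) W u = r \<odot>\<^bsub>Hom \<C> W Y\<^esub> \<tau> W u"
  unfolding NExt_def by (rule nat_trans_data.nat_trans_val[OF NE_data[OF assms(1,2)] assms(3,4)])+

text \<open>
  The operations of the module of natural transformations are pointwise.
\<close>

lemma NE_linear_into:
  assumes XY: "X \<in> obj \<C>" "Y \<in> obj \<C>" and M: "module R M"
    and closed: "\<And>t. t \<in> carrier M \<Longrightarrow> \<Phi> t \<in> carrier (NE n X Y)"
    and lin: "\<And>W u. \<lbrakk>W \<in> obj \<C>; u \<in> carrier (E n W X)\<rbrakk> \<Longrightarrow> (\<lambda>t. \<Phi> t W u) \<in> linear_maps R M (Hom \<C> W Y)"
  shows "\<Phi> \<in> linear_maps R M (NE n X Y)"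
proof (rule linearI)
  note N = NE_module[OF XY, of n]
  show "\<Phi> u \<in> carrier (NE n X Y)" if "u \<in> carrier M" for u by (rule closed[OF that])
  show "\<Phi> (u \<oplus>\<^bsub>M\<^esub> v) = \<Phi> u \<oplus>\<^bsub>NE n X Y\<^esub> \<Phi> v" if "u \<in> carrier M" "v \<in> carrier M" for u v
    by (rule NE_eqI[OF XY, where n = n])
      (use that in \<open>simp_all add: closed madd_closed[OF M] madd_closed[OF N] NE_val XY linear_add[OF lin]\<close>)
  show "\<Phi> (r \<odot>\<^bsub>M\<^esub> u) = r \<odot>\<^bsub>NE n X Y\<^esub> \<Phi> u" if "r \<in> carrier R" "u \<in> carrier M" for r u
    by (rule NE_eqI[OF XY, where n = n])
      (use that in \<open>simp_all add: closed msmult_closed[OF M] msmult_closed[OF N] NE_val XY linear_smult[OF lin]\<close>)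
qed

lemma NE_eval_linear:
  assumes "X \<in> obj \<C>" "Y \<in> obj \<C>" "W \<in> obj \<C>" "u \<in> carrier (E n W X)"
  shows "(\<lambda>\<tau>. \<tau> W u) \<in> linear_maps R (NE n X Y) (Hom \<C> W Y)"
  by (intro linearI) (simp_all add: NE_val_closed[OF assms(1,2) _ assms(3,4)] NE_val assms)

lemma NEm_closed:
  assumes "X \<in> obj \<C>" "X' \<in> obj \<C>" "Y \<in> obj \<C>" "Y' \<in> obj \<C>" "f \<in> mor \<C> X' X" "g \<in> mor \<C> Y Y'"
    and \<tau>: "\<tau> \<in> carrier (NE n X Y)"
  shows "NEm n X X' Y Y' f g \<tau> \<in> carrier (NE n X' Y')"
  unfolding NExt_act_def
proof (rule NE_I[OF assms(2,4)])
  fix W assume W: "W \<in> obj \<C>"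
  show "(\<lambda>u. g \<cdot>\<^bsub>\<C>\<^esub> \<tau> W (ecov n W X' X f u)) \<in> linear_maps R (E n W X') (Hom \<C> W Y')"
    by (rule linear_comp[OF linear_comp[OF E_cov_linear NE_linear] cmp_linear_right]) (use assms W in auto)
next
  fix W W' k u assume a: "W \<in> obj \<C>" "W' \<in> obj \<C>" "k \<in> mor \<C> W' W" "u \<in> carrier (E n W X')"
  have v: "ecov n W X' X f u \<in> carrier (E n W X)" by (rule E_cov_closed[OF a(1) assms(2,1,5) a(4)])
  note t = NE_val_closed[OF assms(1,3) \<tau> a(1) v]
  show "g \<cdot>\<^bsub>\<C>\<^esub> \<tau> W' (ecov n W' X' X f (econ n X' W W' k u)) = g \<cdot>\<^bsub>\<C>\<^esub> \<tau> W (ecov n W X' X f u) \<cdot>\<^bsub>\<C>\<^esub> k"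
    using bilinear_functor.cov_contrav[OF E_bilinear a(1,2) assms(2,1) a(3) assms(5) a(4)]
      NE_natural[OF assms(1,3) \<tau> a(1,2,3) v] cmp_assoc[OF a(2,1) assms(3,4) a(3) t assms(6)] by simp
qed

lemma NEm_val:
  "\<lbrakk>W \<in> obj \<C>; u \<in> carrier (E n W X')\<rbrakk>
    \<Longrightarrow> NEm n X X' Y Y' f g \<tau> W u = g \<cdot>\<^bsub>\<C>\<^esub> \<tau> W (ecov n W X' X f u)"
  by (simp add: NExt_act_def)

lemma NE_bilinear: "bilinear_functor R \<C> (NE n) (NEm n)"
proof (rule bilinear_functor.intro, rule linear_category_axioms, rule bilinear_functor_axioms.intro)
  { fix X Y assume "X \<in> obj \<C>" "Y \<in> obj \<C>"
    then show "module R (NE n X Y)" by (rule NE_module) }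
  { fix X X' Y Y' f g
    assume a: "X \<in> obj \<C>" "X' \<in> obj \<C>" "Y \<in> obj \<C>" "Y' \<in> obj \<C>" "f \<in> mor \<C> X' X" "g \<in> mor \<C> Y Y'"
    show "NEm n X X' Y Y' f g \<in> linear_maps R (NE n X Y) (NE n X' Y')"
    proof (rule NE_linear_into[OF a(2,4) NE_module[OF a(1,3)] NEm_closed[OF a]])
      fix W u assume W: "W \<in> obj \<C>" "u \<in> carrier (E n W X')"
      show "(\<lambda>\<tau>. NEm n X X' Y Y' f g \<tau> W u) \<in> linear_maps R (NE n X Y) (Hom \<C> W Y')"
        unfolding NEm_val[OF W]
        by (rule linear_comp[OF NE_eval_linear cmp_linear_right]) (use a W E_cov_closed in auto)
    qed }
  { fix X Y \<tau> assume a: "X \<in> obj \<C>" "Y \<in> obj \<C>" "\<tau> \<in> carrier (NE n X Y)"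
    show "NEm n X X Y Y (idn \<C> X) (idn \<C> Y) \<tau> = \<tau>"
      by (rule NE_eqI[OF a(1,2) NEm_closed[OF a(1,1,2,2) idn_mor idn_mor] a(3)])
        (use a in \<open>simp_all add: NEm_val bilinear_functor.cov_idn[OF E_bilinear] cmp_idn_left NE_val_closed[OF a]\<close>) }
  { fix X X' X'' Y Y' Y'' f f' g g' \<tau>
    assume a: "X \<in> obj \<C>" "X' \<in> obj \<C>" "X'' \<in> obj \<C>" "Y \<in> obj \<C>" "Y' \<in> obj \<C>" "Y'' \<in> obj \<C>"
      "f \<in> mor \<C> X' X" "f' \<in> mor \<C> X'' X'" "g \<in> mor \<C> Y Y'" "g' \<in> mor \<C> Y' Y''" "\<tau> \<in> carrier (NE n X Y)"
    note ff = cmp_closed[OF a(3,2,1,8,7)] and gg = cmp_closed[OF a(4-6,9,10)]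
    note N1 = NEm_closed[OF a(1,2,4,5,7,9,11)]
    show "NEm n X X'' Y Y'' (f \<cdot>\<^bsub>\<C>\<^esub> f') (g' \<cdot>\<^bsub>\<C>\<^esub> g) \<tau> = NEm n X' X'' Y' Y'' f' g' (NEm n X X' Y Y' f g \<tau>)"
    proof (rule NE_eqI[OF a(3,6) NEm_closed[OF a(1,3,4,6) ff gg a(11)] NEm_closed[OF a(2,3,5,6,8,10) N1]])
      fix W u assume W: "W \<in> obj \<C>" "u \<in> carrier (E n W X'')"
      have c1: "ecov n W X'' X' f' u \<in> carrier (E n W X')" by (rule E_cov_closed[OF W(1) a(3,2,8) W(2)])
      note c2 = E_cov_closed[OF W(1) a(2,1,7) c1]
      show "NEm n X X'' Y Y'' (f \<cdot>\<^bsub>\<C>\<^esub> f') (g' \<cdot>\<^bsub>\<C>\<^esub> g) \<tau> W u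
          = NEm n X' X'' Y' Y'' f' g' (NEm n X X' Y Y' f g \<tau>) W u"
        using bilinear_functor.cov_cmp[OF E_bilinear W(1) a(3,2,1,8,7) W(2)]
          cmp_assoc[OF W(1) a(4-6) NE_val_closed[OF a(1,4,11) W(1) c2] a(9,10)]
        by (simp add: NEm_val W c1)
    qed }
  { fix X X' Y Y' g \<tau>
    assume a: "X \<in> obj \<C>" "X' \<in> obj \<C>" "Y \<in> obj \<C>" "Y' \<in> obj \<C>" "g \<in> mor \<C> Y Y'" "\<tau> \<in> carrier (NE n X Y)"
    show "(\<lambda>f. NEm n X X' Y Y' f g \<tau>) \<in> linear_maps R (Hom \<C> X' X) (NE n X' Y')"
    proof (rule NE_linear_into[OF a(2,4) Hom_module[OF a(2,1)]])
      show "NEm n X X' Y Y' f g \<tau> \<in> carrier (NE n X' Y')" if "f \<in> mor \<C> X' X" for f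
        by (rule NEm_closed[OF a(1-4) that a(5,6)])
      fix W u assume W: "W \<in> obj \<C>" "u \<in> carrier (E n W X')"
      have "(\<lambda>f. ecov n W X' X f u) \<in> linear_maps R (Hom \<C> X' X) (E n W X)"
        unfolding cov_def
        by (rule bilinear_functor.Fm_bilinear_right[OF E_bilinear]) (use a W idn_mor in auto)
      from linear_comp[OF linear_comp[OF this NE_linear[OF a(1,3,6) W(1)]] cmp_linear_right[OF W(1) a(3,4,5)]]
      show "(\<lambda>f. NEm n X X' Y Y' f g \<tau> W u) \<in> linear_maps R (Hom \<C> X' X) (Hom \<C> W Y')"
        unfolding NEm_val[OF W] .
    qed }
  { fix X X' Y Y' f \<tau>
    assume a: "X \<in> obj \<C>" "X' \<in> obj \<C>" "Y \<in> obj \<C>" "Y' \<in> obj \<C>" "f \<in> mor \<C> X' X" "\<tau> \<in> carrier (NE n X Y)"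
    show "(\<lambda>g. NEm n X X' Y Y' f g \<tau>) \<in> linear_maps R (Hom \<C> Y Y') (NE n X' Y')"
    proof (rule NE_linear_into[OF a(2,4) Hom_module[OF a(3,4)]])
      show "NEm n X X' Y Y' f g \<tau> \<in> carrier (NE n X' Y')" if "g \<in> mor \<C> Y Y'" for g
        by (rule NEm_closed[OF a(1-5) that a(6)])
      fix W u assume W: "W \<in> obj \<C>" "u \<in> carrier (E n W X')"
      show "(\<lambda>g. NEm n X X' Y Y' f g \<tau> W u) \<in> linear_maps R (Hom \<C> Y Y') (Hom \<C> W Y')"
        unfolding NEm_val[OF W]
        by (rule cmp_linear_left[OF W(1) a(3,4) NE_val_closed[OF a(1,3,6) W(1) E_cov_closed[OF W(1) a(2,1,5) W(2)]]])
    qed }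
qed

definition nconn where
  "nconn n C A d \<tau> = (\<lambda>W\<in>obj \<C>. \<lambda>u\<in>carrier (E n W C). \<tau> W (dl n C A d W u))"

lemma nconn_val: "\<lbrakk>W \<in> obj \<C>; u \<in> carrier (E n W C)\<rbrakk> \<Longrightarrow> nconn n C A d \<tau> W u = \<tau> W (dl n C A d W u)"
  by (simp add: nconn_def)

lemma nconn_closed:
  assumes "A \<in> obj \<C>" "C \<in> obj \<C>" "d \<in> carrier (Ext \<C> C A)" "Y \<in> obj \<C>" "\<tau> \<in> carrier (NE (Suc n) A Y)"
  shows "nconn n C A d \<tau> \<in> carrier (NE n C Y)"
  unfolding nconn_def
proof (rule NE_I[OF assms(2,4)])
  show "(\<lambda>u. \<tau> W (dl n C A d W u)) \<in> linear_maps R (E n W C) (Hom \<C> W Y)" if "W \<in> obj \<C>" for W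
    by (rule linear_comp[OF dl_linear[OF assms(1-3) that] NE_linear[OF assms(1,4,5) that]])
  fix W W' f u assume a: "W \<in> obj \<C>" "W' \<in> obj \<C>" "f \<in> mor \<C> W' W" "u \<in> carrier (E n W C)"
  show "\<tau> W' (dl n C A d W' (econ n C W W' f u)) = \<tau> W (dl n C A d W u) \<cdot>\<^bsub>\<C>\<^esub> f"
    using dl_natural[OF assms(1-3) a] NE_natural[OF assms(1,4,5) a(1-3) dl_closed[OF assms(1-3) a(1,4)]] by simp
qed

lemma nconn_linear:
  assumes "A \<in> obj \<C>" "C \<in> obj \<C>" "d \<in> carrier (Ext \<C> C A)" "Y \<in> obj \<C>"
  shows "nconn n C A d \<in> linear_maps R (NE (Suc n) A Y) (NE n C Y)"
proof (rule NE_linear_into[OF assms(2,4) NE_module[OF assms(1,4)] nconn_closed[OF assms]])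
  fix W u assume W: "W \<in> obj \<C>" "u \<in> carrier (E n W C)"
  show "(\<lambda>\<tau>. nconn n C A d \<tau> W u) \<in> linear_maps R (NE (Suc n) A Y) (Hom \<C> W Y)"
    unfolding nconn_val[OF W] by (rule NE_eval_linear[OF assms(1,4) W(1) dl_closed[OF assms(1-3) W]])
qed

lemma ncov_val:
  assumes "X \<in> obj \<C>" "W \<in> obj \<C>" "u \<in> carrier (E n W X)"
  shows "cov \<C> (NEm n) X Y Y' g \<tau> W u = g \<cdot>\<^bsub>\<C>\<^esub> \<tau> W u"
  using bilinear_functor.cov_idn[OF E_bilinear assms(2,1,3)] by (simp add: cov_def[of _ "NEm n"] NEm_val assms)

lemma ncon_val:
  assumes "X \<in> obj \<C>" "X' \<in> obj \<C>" "Y \<in> obj \<C>" "f \<in> mor \<C> X' X" "\<tau> \<in> carrier (NE n X Y)"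
    "W \<in> obj \<C>" "u \<in> carrier (E n W X')"
  shows "contrav \<C> (NEm n) Y X X' f \<tau> W u = \<tau> W (ecov n W X' X f u)"
  using cmp_idn_left[OF assms(6,3) NE_val_closed[OF assms(1,3,5,6) E_cov_closed[OF assms(6,2,1,4,7)]]]
  by (simp add: contrav_def[of _ "NEm n"] NEm_val assms)

lemmas NE_cov_closed = bilinear_functor.cov_closed[OF NE_bilinear]
lemmas NE_con_closed = bilinear_functor.contrav_closed[OF NE_bilinear]

lemma nconn_natural:
  assumes "A \<in> obj \<C>" "C \<in> obj \<C>" "d \<in> carrier (Ext \<C> C A)" "Y \<in> obj \<C>" "Y' \<in> obj \<C>" "g \<in> mor \<C> Y Y'"
    "\<tau> \<in> carrier (NE (Suc n) A Y)"
  shows "nconn n C A d (cov \<C> (NEm (Suc n)) A Y Y' g \<tau>) = cov \<C> (NEm n) C Y Y' g (nconn n C A d \<tau>)"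
proof (rule NE_eqI[OF assms(2,5), where n = n])
  show "nconn n C A d (cov \<C> (NEm (Suc n)) A Y Y' g \<tau>) \<in> carrier (NE n C Y')"
    by (rule nconn_closed[OF assms(1-3,5) NE_cov_closed[OF assms(1,4-7)]])
  show "cov \<C> (NEm n) C Y Y' g (nconn n C A d \<tau>) \<in> carrier (NE n C Y')"
    by (rule NE_cov_closed[OF assms(2,4-6) nconn_closed[OF assms(1-4,7)]])
  fix W u assume W: "W \<in> obj \<C>" "u \<in> carrier (E n W C)"
  show "nconn n C A d (cov \<C> (NEm (Suc n)) A Y Y' g \<tau>) W u = cov \<C> (NEm n) C Y Y' g (nconn n C A d \<tau>) W u"
    using W assms by (simp add: nconn_val ncov_val dl_closed)
qed

lemma nconn_ext_morphism:
  assumes obs: "A \<in> obj \<C>" "C \<in> obj \<C>" "A' \<in> obj \<C>" "C' \<in> obj \<C>" and d: "d \<in> carrier (Ext \<C> C A)"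
    "d' \<in> carrier (Ext \<C> C' A')" and a: "a \<in> mor \<C> A A'" and c: "c \<in> mor \<C> C C'"
    and eq: "xcov C A A' a d = xcon A' C' C c d'" and Y: "Y \<in> obj \<C>" and \<tau>: "\<tau> \<in> carrier (NE (Suc n) A' Y)"
  shows "nconn n C A d (contrav \<C> (NEm (Suc n)) Y A' A a \<tau>) = contrav \<C> (NEm n) Y C' C c (nconn n C' A' d' \<tau>)"
proof (rule NE_eqI[OF obs(2) Y, where n = n])
  note t' = nconn_closed[OF obs(3,4) d(2) Y \<tau>]
  show "nconn n C A d (contrav \<C> (NEm (Suc n)) Y A' A a \<tau>) \<in> carrier (NE n C Y)"
    by (rule nconn_closed[OF obs(1,2) d(1) Y NE_con_closed[OF obs(3,1) Y a \<tau>]])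
  show "contrav \<C> (NEm n) Y C' C c (nconn n C' A' d' \<tau>) \<in> carrier (NE n C Y)"
    by (rule NE_con_closed[OF obs(4,2) Y c t'])
  fix W u assume W: "W \<in> obj \<C>" "u \<in> carrier (E n W C)"
  have "ecov (Suc n) W A A' a (dl n C A d W u) = dl n C' A' d' W (ecov n W C C' c u)"
    using dl_push[OF obs(1,3,2) d(1) a W] dl_pull[OF obs(3,2,4) d(2) c W] eq by simp
  then show "nconn n C A d (contrav \<C> (NEm (Suc n)) Y A' A a \<tau>) W u
      = contrav \<C> (NEm n) Y C' C c (nconn n C' A' d' \<tau>) W u"
    using ncon_val[OF obs(3,1) Y a \<tau> W(1) dl_closed[OF obs(1,2) d(1) W]] ncon_val[OF obs(4,2) Y c t' W]
      E_cov_closed[OF W(1) obs(2,4) c W(2)] W by (simp add: nconn_val)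
qed


subsection \<open>The Yoneda isomorphism in degree zero\<close>

lemma yoneda_closed:
  assumes "X \<in> obj \<C>" "Y \<in> obj \<C>" "\<tau> \<in> carrier (NE 0 X Y)"
  shows "yoneda \<C> X \<tau> \<in> carrier (E 0 X Y)"
  using NE_val_closed[OF assms assms(1), of "XHom (idn \<C> X)"] assms idn_mor
  by (simp add: yoneda_def E0_simps)

lemma yoneda_linear:
  assumes "X \<in> obj \<C>" "Y \<in> obj \<C>"
  shows "yoneda \<C> X \<in> linear_maps R (NE 0 X Y) (E 0 X Y)"
proof -
  have id: "XHom (idn \<C> X) \<in> carrier (E 0 X X)" using assms idn_mor by (simp add: E0_simps)
  note l = NE_eval_linear[OF assms assms(1) id]
  show ?thesis unfolding yoneda_def
    by (intro linearI)
      (use assms in \<open>simp_all add: E0_simps linear_closed[OF l] linear_add[OF l] linear_smult[OF l]\<close>)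
qed

lemma yoneda_val:
  assumes "X \<in> obj \<C>" "Y \<in> obj \<C>" "\<tau> \<in> carrier (NE 0 X Y)" "W \<in> obj \<C>" "f \<in> mor \<C> W X"
  shows "\<tau> W (XHom f) = \<tau> X (XHom (idn \<C> X)) \<cdot>\<^bsub>\<C>\<^esub> f"
proof -
  have id: "XHom (idn \<C> X) \<in> carrier (E 0 X X)" using assms idn_mor by (simp add: E0_simps)
  show ?thesis
    using NE_natural[OF assms(1-3,1,4,5) id] econ_0[OF assms(1,4,1) idn_mor[OF assms(1)] assms(5)]
      cmp_idn_left[OF assms(4,1,5)] by simp
qed

lemma yoneda_bij:
  assumes "X \<in> obj \<C>" "Y \<in> obj \<C>"
  shows "bij_betw (yoneda \<C> X) (carrier (NE 0 X Y)) (carrier (E 0 X Y))"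
proof (rule bij_betwI')
  fix \<tau> \<sigma> assume t: "\<tau> \<in> carrier (NE 0 X Y)" "\<sigma> \<in> carrier (NE 0 X Y)"
  show "(yoneda \<C> X \<tau> = yoneda \<C> X \<sigma>) = (\<tau> = \<sigma>)"
  proof
    assume eq: "yoneda \<C> X \<tau> = yoneda \<C> X \<sigma>"
    show "\<tau> = \<sigma>"
    proof (rule NE_eqI[OF assms t])
      fix W u assume W: "W \<in> obj \<C>" "u \<in> carrier (E 0 W X)"
      then obtain f where "f \<in> mor \<C> W X" "u = XHom f" using assms by (auto simp: E0_simps)
      then show "\<tau> W u = \<sigma> W u"
        using yoneda_val[OF assms t(1) W(1)] yoneda_val[OF assms t(2) W(1)] eq by (simp add: yoneda_def)
    qed
  qed simp
next
  show "yoneda \<C> X \<tau> \<in> carrier (E 0 X Y)" if "\<tau> \<in> carrier (NE 0 X Y)" for \<tau>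
    by (rule yoneda_closed[OF assms that])
next
  fix t assume "t \<in> carrier (E 0 X Y)"
  then obtain f where f: "f \<in> mor \<C> X Y" "t = XHom f" using assms by (auto simp: E0_simps)
  let ?\<tau> = "\<lambda>W\<in>obj \<C>. \<lambda>u\<in>carrier (E 0 W X). f \<cdot>\<^bsub>\<C>\<^esub> un_XHom u"
  have "?\<tau> \<in> carrier (NE 0 X Y)"
  proof (rule NE_I[OF assms])
    fix W assume W: "W \<in> obj \<C>"
    note l = cmp_linear_right[OF W assms f(1)]
    show "(\<lambda>u. f \<cdot>\<^bsub>\<C>\<^esub> un_XHom u) \<in> linear_maps R (E 0 W X) (Hom \<C> W Y)"
      by (intro linearI)
        (use W assms in \<open>auto simp: E0_simps linear_closed[OF l] linear_add[OF l] linear_smult[OF l]\<close>)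
  next
    fix W W' k u assume "W \<in> obj \<C>" "W' \<in> obj \<C>" "k \<in> mor \<C> W' W" "u \<in> carrier (E 0 W X)"
    then show "f \<cdot>\<^bsub>\<C>\<^esub> un_XHom (econ 0 X W W' k u) = f \<cdot>\<^bsub>\<C>\<^esub> un_XHom u \<cdot>\<^bsub>\<C>\<^esub> k"
      using f assms cmp_assoc[of W' W X Y k _ f] by (auto simp: E0_simps econ_0)
  qed
  moreover have "yoneda \<C> X ?\<tau> = t"
    using f assms idn_mor by (simp add: yoneda_def E0_simps cmp_idn_right)
  ultimately show "\<exists>\<tau>\<in>carrier (NE 0 X Y). t = yoneda \<C> X \<tau>" by metis
qed

lemma yoneda_natural:
  assumes "X \<in> obj \<C>" "X' \<in> obj \<C>" "Y \<in> obj \<C>" "Y' \<in> obj \<C>" "f \<in> mor \<C> X' X" "g \<in> mor \<C> Y Y'"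
    and \<tau>: "\<tau> \<in> carrier (NE 0 X Y)"
  shows "yoneda \<C> X' (NEm 0 X X' Y Y' f g \<tau>) = Em 0 X X' Y Y' f g (yoneda \<C> X \<tau>)"
proof -
  have id: "XHom (idn \<C> X) \<in> carrier (E 0 X X)" "XHom (idn \<C> X') \<in> carrier (E 0 X' X')"
    using assms idn_mor by (simp_all add: E0_simps)
  have "NEm 0 X X' Y Y' f g \<tau> X' (XHom (idn \<C> X')) = g \<cdot>\<^bsub>\<C>\<^esub> \<tau> X' (XHom f)"
    using ecov_0[OF assms(2,2,1) idn_mor[OF assms(2)] assms(5)] cmp_idn_right[OF assms(2,1,5)] id assms
    by (simp add: NEm_val)
  also have "\<dots> = g \<cdot>\<^bsub>\<C>\<^esub> \<tau> X (XHom (idn \<C> X)) \<cdot>\<^bsub>\<C>\<^esub> f"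
    using yoneda_val[OF assms(1,3) \<tau> assms(2,5)]
      cmp_assoc[OF assms(2,1,3,4,5) NE_val_closed[OF assms(1,3) \<tau> assms(1) id(1)] assms(6)] by simp
  finally show ?thesis by (simp add: yoneda_def PExt_act.simps Hom_act_def)
qed

end


section \<open>The functors in all degrees\<close>

lemma (in cring) transport_linear_map:
  assumes "module R M" "f \<in> linear_maps R M N" "inj_on j (carrier M)" "inj_on j' (carrier N)"
    and "\<And>u. u \<in> carrier M \<Longrightarrow> g (j u) = j' (f u)"
  shows "g \<in> linear_maps R (transport j M) (transport j' N)"
  by (intro linearI)
    (auto simp: transport_simps[OF assms(3)] transport_simps[OF assms(4)] assms(5)
      linear_closed[OF assms(2)] linear_add[OF assms(2)] linear_smult[OF assms(2)]
      madd_closed[OF assms(1)] msmult_closed[OF assms(1)])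

lemma degree_cases [case_names nonnegative negative]:
  fixes k :: int
  obtains n where "k = int n" | n where "k = - int (Suc n)"
  by (metis int_cases)

context extriangulated_category
begin

lemma EII_positive:
  assumes "k = int (Suc n)"
  shows "EII R \<C> k = (\<lambda>X Y. transport Inl (E (Suc n) X Y))"
    and "EII_act R \<C> k = (\<lambda>X X' Y Y' f g u. Inl (Em (Suc n) X X' Y Y' f g (projl u)))"
    and "carrier (EII R \<C> k X Y) = Inl ` carrier (E (Suc n) X Y)"
    and "\<zero>\<^bsub>EII R \<C> k X Y\<^esub> = Inl \<zero>\<^bsub>E (Suc n) X Y\<^esub>"
    and "cov \<C> (EII_act R \<C> k) X Y Y' g (Inl u) = Inl (ecov (Suc n) X Y Y' g u)"
    and "contrav \<C> (EII_act R \<C> k) Y X X' f (Inl u) = Inl (econ (Suc n) Y X X' f u)"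
    and "EII_delta R \<C> k C A d Y (Inl u) = Inl (du (Suc n) C A d Y u)"
proof -
  have k: "k > 0" "nat k = Suc n" using assms by simp_all
  then show "EII R \<C> k = (\<lambda>X Y. transport Inl (E (Suc n) X Y))"
    "EII_act R \<C> k = (\<lambda>X X' Y Y' f g u. Inl (Em (Suc n) X X' Y Y' f g (projl u)))"
    "EII_delta R \<C> k C A d Y (Inl u) = Inl (du (Suc n) C A d Y u)"
    "carrier (EII R \<C> k X Y) = Inl ` carrier (E (Suc n) X Y)"
    "\<zero>\<^bsub>EII R \<C> k X Y\<^esub> = Inl \<zero>\<^bsub>E (Suc n) X Y\<^esub>"
    "cov \<C> (EII_act R \<C> k) X Y Y' g (Inl u) = Inl (ecov (Suc n) X Y Y' g u)"
    "contrav \<C> (EII_act R \<C> k) Y X X' f (Inl u) = Inl (econ (Suc n) Y X X' f u)"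
    by (auto simp: EII_def EII_act_def EII_delta_def cov_def contrav_def transport_def intro!: ext)
qed

lemma EII_nonpositive:
  assumes "k = - int n"
  shows "EII R \<C> k = (\<lambda>X Y. transport Inr (NE n X Y))"
    and "EII_act R \<C> k = (\<lambda>X X' Y Y' f g u. Inr (NEm n X X' Y Y' f g (projr u)))"
    and "carrier (EII R \<C> k X Y) = Inr ` carrier (NE n X Y)"
    and "\<zero>\<^bsub>EII R \<C> k X Y\<^esub> = Inr \<zero>\<^bsub>NE n X Y\<^esub>"
    and "cov \<C> (EII_act R \<C> k) X Y Y' g (Inr t) = Inr (cov \<C> (NEm n) X Y Y' g t)"
    and "contrav \<C> (EII_act R \<C> k) Y X X' f (Inr t) = Inr (contrav \<C> (NEm n) Y X X' f t)"
proof -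
  have k: "\<not> k > 0" "nat (- k) = n" using assms by simp_all
  then show "EII R \<C> k = (\<lambda>X Y. transport Inr (NE n X Y))"
    "EII_act R \<C> k = (\<lambda>X X' Y Y' f g u. Inr (NEm n X X' Y Y' f g (projr u)))"
    "carrier (EII R \<C> k X Y) = Inr ` carrier (NE n X Y)"
    "\<zero>\<^bsub>EII R \<C> k X Y\<^esub> = Inr \<zero>\<^bsub>NE n X Y\<^esub>"
    "cov \<C> (EII_act R \<C> k) X Y Y' g (Inr t) = Inr (cov \<C> (NEm n) X Y Y' g t)"
    "contrav \<C> (EII_act R \<C> k) Y X X' f (Inr t) = Inr (contrav \<C> (NEm n) Y X X' f t)"
    by (auto simp: EII_def EII_act_def cov_def contrav_def transport_def intro!: ext)
qed

lemma EII_delta_negative: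
  "k = - int (Suc n) \<Longrightarrow> EII_delta R \<C> k C A d Y (Inr t) = Inr (nconn n C A d t)"
  by (auto simp: EII_delta_def nconn_def Let_def)

lemma EII_bilinear: "bilinear_functor R \<C> (EII R \<C> k) (EII_act R \<C> k)"
proof (cases "k > 0")
  case True
  then have k: "k = int (Suc (nat (k - 1)))" by simp
  show ?thesis unfolding EII_positive(1,2)[OF k]
    by (rule bilinear_functor.transport_bilinear_functor[OF E_bilinear]) simp
next
  case False
  then have k: "k = - int (nat (- k))" by simp
  show ?thesis unfolding EII_nonpositive(1,2)[OF k]
    by (rule bilinear_functor.transport_bilinear_functor[OF NE_bilinear]) simp
qed

lemmas EII_module = bilinear_functor.F_module[OF EII_bilinear]

text \<open>
  In degrees \<open>n \<ge> 0\<close> this identifies \<open>\<bbbE>\<^sub>I\<^sub>I\<^sup>n\<close> with \<open>\<bbbE>\<^sup>n\<close>, so that degree zero can be treated together with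
  the positive degrees.
\<close>

definition plain :: "nat \<Rightarrow> 'o \<Rightarrow> ('r, 'o, 'm, 'e) eii_elt \<Rightarrow> ('r, 'o, 'm, 'e) xelt" where
  "plain n X w = (if n = 0 then yoneda \<C> X (projr w) else projl w)"

lemma plain_bij:
  assumes "X \<in> obj \<C>" "Y \<in> obj \<C>"
  shows "bij_betw (plain n X) (carrier (EII R \<C> (int n) X Y)) (carrier (E n X Y))"
proof (cases n)
  case 0
  have "bij_betw projr (Inr ` carrier (NE 0 X Y)) (carrier (NE 0 X Y))"
    by (auto simp: bij_betw_def inj_on_def image_image)
  from bij_betw_trans[OF this yoneda_bij[OF assms]] show ?thesis
    by (simp add: 0 plain_def[abs_def] comp_def EII_nonpositive(3)[of 0 0, simplified])
next
  case (Suc m)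
  show ?thesis
    unfolding Suc EII_positive(3)[OF refl]
    by (auto simp: bij_betw_def inj_on_def image_image plain_def)
qed

lemma plain_linear:
  assumes XY: "X \<in> obj \<C>" "Y \<in> obj \<C>"
  shows "plain n X \<in> linear_maps R (EII R \<C> (int n) X Y) (E n X Y)"
proof (cases n)
  case 0
  have i: "inj_on Inr (carrier (NE 0 X Y))" by (simp add: inj_on_def)
  note y = yoneda_linear[OF XY] and t = transport_simps[OF i]
  have eq: "EII R \<C> (int 0) = (\<lambda>X Y. transport Inr (NE 0 X Y))" by (rule EII_nonpositive(1)) simp
  show ?thesis
    unfolding 0 eq
    by (intro linearI)
      (auto simp: plain_def t linear_closed[OF y] linear_add[OF y] linear_smult[OF y])
next
  case (Suc m)
  have i: "inj_on Inl (carrier (E (Suc m) X Y))" by (simp add: inj_on_def)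
  note t = transport_simps[OF i]
  show ?thesis
    unfolding Suc EII_positive(1)[OF refl] by (intro linearI) (auto simp: plain_def t)
qed

lemma plain_natural:
  assumes "X \<in> obj \<C>" "X' \<in> obj \<C>" "Y \<in> obj \<C>" "Y' \<in> obj \<C>" "f \<in> mor \<C> X' X" "g \<in> mor \<C> Y Y'"
    and u: "u \<in> carrier (EII R \<C> (int n) X Y)"
  shows "plain n X' (EII_act R \<C> (int n) X X' Y Y' f g u) = Em n X X' Y Y' f g (plain n X u)"
proof (cases n)
  case 0
  then obtain t where t: "t \<in> carrier (NE 0 X Y)" "u = Inr t"
    using u EII_nonpositive(3)[of "int 0" 0] by auto
  show ?thesis
    using yoneda_natural[OF assms(1-6) t(1)] t(2) by (simp add: 0 plain_def EII_nonpositive(2)[of 0 0])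
next
  case (Suc m)
  show ?thesis unfolding Suc EII_positive(2)[OF refl] by (simp add: plain_def)
qed

lemma plain_cov:
  assumes "X \<in> obj \<C>" "Y \<in> obj \<C>" "Y' \<in> obj \<C>" "g \<in> mor \<C> Y Y'" "u \<in> carrier (EII R \<C> (int n) X Y)"
  shows "plain n X (cov \<C> (EII_act R \<C> (int n)) X Y Y' g u) = ecov n X Y Y' g (plain n X u)"
  unfolding cov_def by (rule plain_natural) (use assms idn_mor in auto)

lemma plain_contrav:
  assumes "X \<in> obj \<C>" "X' \<in> obj \<C>" "Y \<in> obj \<C>" "f \<in> mor \<C> X' X" "u \<in> carrier (EII R \<C> (int n) X Y)"
  shows "plain n X' (contrav \<C> (EII_act R \<C> (int n)) Y X X' f u) = econ n Y X X' f (plain n X u)"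
  unfolding contrav_def by (rule plain_natural) (use assms idn_mor in auto)

lemma plain_delta: "EII_delta R \<C> (int n) C A d Y u = Inl (du n C A d Y (plain n A u))"
  by (cases n) (simp_all add: EII_delta_def plain_def nat_add_distrib)

lemma EII_connected: "extriangulated_connected_sequence R \<C> (EII R \<C>) (EII_act R \<C>) (EII_delta R \<C>)"
proof (rule extriangulated_connected_sequence.intro, rule extriangulated_category_axioms,
    rule contravariant_connected_sequence.intro, rule linear_category_axioms,
    rule contravariant_connected_sequence_axioms.intro)
  show "bilinear_functor R \<C> (EII R \<C> k) (EII_act R \<C> k)" for k by (rule EII_bilinear)
next
  fix k A C d Y
  assume a: "A \<in> obj \<C>" "C \<in> obj \<C>" "d \<in> carrier (Ext \<C> C A)" "Y \<in> obj \<C>"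
  show "EII_delta R \<C> k C A d Y \<in> linear_maps R (EII R \<C> k A Y) (EII R \<C> (k + 1) C Y)"
  proof (cases k rule: degree_cases)
    case (nonnegative n)
    then have k1: "k + 1 = int (Suc n)" by simp
    have "Inl \<in> linear_maps R (E (Suc n) C Y) (EII R \<C> (k + 1) C Y)"
      unfolding EII_positive(1)[OF k1] by (rule transport_linear) (simp add: inj_on_def)
    from linear_comp[OF linear_comp[OF plain_linear[OF a(1,4)] du_linear[OF a(2,4,1,3)]] this]
    show ?thesis unfolding nonnegative by (simp add: plain_delta[abs_def])
  next
    case (negative n)
    then have k1: "k + 1 = - int n" by simp
    show ?thesis unfolding EII_nonpositive(1)[OF negative] EII_nonpositive(1)[OF k1]
      by (rule transport_linear_map[OF NE_module[OF a(1,4)] nconn_linear[OF a]])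
        (simp_all add: EII_delta_negative[OF negative])
  qed
next
  fix k A C d Y Y' g u
  assume a: "A \<in> obj \<C>" "C \<in> obj \<C>" "d \<in> carrier (Ext \<C> C A)" "Y \<in> obj \<C>" "Y' \<in> obj \<C>" "g \<in> mor \<C> Y Y'"
    "u \<in> carrier (EII R \<C> k A Y)"
  show "EII_delta R \<C> k C A d Y' (cov \<C> (EII_act R \<C> k) A Y Y' g u)
      = cov \<C> (EII_act R \<C> (k + 1)) C Y Y' g (EII_delta R \<C> k C A d Y u)"
  proof (cases k rule: degree_cases)
    case (nonnegative n)
    then have k1: "k + 1 = int (Suc n)" by simp
    note u = a(7)[unfolded nonnegative]
    have p: "plain n A u \<in> carrier (E n A Y)" by (rule linear_closed[OF plain_linear[OF a(1,4)] u])
    show ?thesis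
      unfolding k1 unfolding nonnegative plain_delta plain_cov[OF a(1,4-6) u] EII_positive(5)[OF refl]
      using du_cov[OF a(2,4-6,1) p a(3)] by simp
  next
    case (negative n)
    then have k1: "k + 1 = - int n" by simp
    obtain v where v: "v \<in> carrier (NE (Suc n) A Y)" "u = Inr v" using a(7) by (auto simp: EII_nonpositive(3)[OF negative])
    show ?thesis using nconn_natural[OF a(1-6) v(1)] v(2)
      by (simp add: EII_nonpositive(5)[OF negative] EII_nonpositive(5)[OF k1] EII_delta_negative[OF negative])
  qed
next
  fix k A C d C' A' d' a c Y u
  assume m: "ext_morphism \<C> C A d C' A' d' a c" and Y: "Y \<in> obj \<C>" and u: "u \<in> carrier (EII R \<C> k A' Y)"
  have T: "A \<in> obj \<C>" "C \<in> obj \<C>" "A' \<in> obj \<C>" "C' \<in> obj \<C>" "d \<in> carrier (Ext \<C> C A)"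
    "d' \<in> carrier (Ext \<C> C' A')" and M: "a \<in> mor \<C> A A'" "c \<in> mor \<C> C C'"
    "xcov C A A' a d = xcon A' C' C c d'"
    using m by (auto simp: ext_morphism_def push_def pull_def)
  show "EII_delta R \<C> k C A d Y (contrav \<C> (EII_act R \<C> k) Y A' A a u)
      = contrav \<C> (EII_act R \<C> (k + 1)) Y C' C c (EII_delta R \<C> k C' A' d' Y u)"
  proof (cases k rule: degree_cases)
    case (nonnegative n)
    then have k1: "k + 1 = int (Suc n)" by simp
    note u = u[unfolded nonnegative]
    have p: "plain n A' u \<in> carrier (E n A' Y)" by (rule linear_closed[OF plain_linear[OF T(3) Y] u])
    show ?thesis
      unfolding k1 unfolding nonnegative plain_delta plain_contrav[OF T(3,1) Y M(1) u] EII_positive(6)[OF refl]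
      using du_ext_morphism[OF m Y p] by simp
  next
    case (negative n)
    then have k1: "k + 1 = - int n" by simp
    obtain v where v: "v \<in> carrier (NE (Suc n) A' Y)" "u = Inr v" using u by (auto simp: EII_nonpositive(3)[OF negative])
    show ?thesis using nconn_ext_morphism[OF T M Y v(1)] v(2)
      by (simp add: EII_nonpositive(6)[OF negative] EII_nonpositive(6)[OF k1] EII_delta_negative[OF negative])
  qed
qed

text \<open>Injectivity holds because \<open>\<epsilon>\<^sub>\<sharp>\<close> is an epimorphism.\<close>

lemma nconn_inj:
  assumes t: "inj_triangle A J B i q e" and Y: "Y \<in> obj \<C>"
  shows "inj_on (nconn n B A e) (carrier (NE (Suc n) A Y))"
proof (rule inj_onI)
  have s: "s_triangle \<C> A J B i q e" using t by (simp add: inj_triangle_def)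
  note T = triD[OF s]
  fix \<tau> \<sigma> assume c: "\<tau> \<in> carrier (NE (Suc n) A Y)" "\<sigma> \<in> carrier (NE (Suc n) A Y)"
    and eq: "nconn n B A e \<tau> = nconn n B A e \<sigma>"
  show "\<tau> = \<sigma>"
  proof (rule NE_eqI[OF T(1) Y c])
    fix W u assume W: "W \<in> obj \<C>" "u \<in> carrier (E (Suc n) W A)"
    then obtain w where "w \<in> carrier (E n W B)" "dl n B A e W w = u" using inj_dl_surj[OF t] by blast
    then show "\<tau> W u = \<sigma> W u" using fun_cong[OF fun_cong[OF eq, of W], of w] W(1) by (simp add: nconn_val)
  qed
qed

text \<open>
  A transformation of \<open>\<bbbE>\<^sup>n(-, B)\<close> that vanishes on the image of \<open>\<bbbE>\<^sup>n(-, J)\<close> descends to the cokernel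
  \<open>\<bbbE>\<^sup>n\<^sup>+\<^sup>1(-, A)\<close>.
\<close>

lemma nconn_lift:
  assumes t: "inj_triangle A J B i q e" and Y: "Y \<in> obj \<C>" and \<sigma>: "\<sigma> \<in> carrier (NE n B Y)"
    and 0: "contrav \<C> (NEm n) Y B J q \<sigma> = \<zero>\<^bsub>NE n J Y\<^esub>"
  shows "\<exists>\<tau>\<in>carrier (NE (Suc n) A Y). nconn n B A e \<tau> = \<sigma>"
proof -
  have s: "s_triangle \<C> A J B i q e" using t by (simp add: inj_triangle_def)
  note T = triD[OF s]
  define lft where "lft W u = (SOME w. w \<in> carrier (E n W B) \<and> dl n B A e W w = u)" for W u
  have lft: "lft W u \<in> carrier (E n W B)" "dl n B A e W (lft W u) = u"
    if "W \<in> obj \<C>" "u \<in> carrier (E (Suc n) W A)" for W u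
    using someI_ex[of "\<lambda>w. w \<in> carrier (E n W B) \<and> dl n B A e W w = u"] inj_dl_surj[OF t that]
    unfolding lft_def by blast+
  \<comment> \<open>Two lifts differ by an element that comes from \<open>J\<close>, where \<open>\<sigma>\<close> is zero.\<close>
  have key: "\<sigma> W (lft W (dl n B A e W w)) = \<sigma> W w" if W: "W \<in> obj \<C>" and w: "w \<in> carrier (E n W B)" for W w
  proof -
    note l = lft[OF W dl_closed[OF T(1,3,6) W w]]
    note EB = E_module[OF W T(3), of n] and HY = Hom_module[OF W Y] and ls = NE_linear[OF T(3) Y \<sigma> W]
    let ?w' = "lft W (dl n B A e W w)"
    have "dl n B A e W (?w' \<ominus>\<^bsub>E n W B\<^esub> w) = \<zero>\<^bsub>E (Suc n) W A\<^esub>"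
      by (rule linear_minus_eq_zero[OF EB E_module[OF W T(1)] dl_linear[OF T(1,3,6) W] l(1) w l(2)])
    then obtain b where b: "b \<in> carrier (E n W J)" "ecov n W J B q b = ?w' \<ominus>\<^bsub>E n W B\<^esub> w"
      using inj_dl_kernel[OF t W mminus_closed[OF EB l(1) w]] by blast
    have "\<sigma> W ?w' \<ominus>\<^bsub>Hom \<C> W Y\<^esub> \<sigma> W w = \<sigma> W (ecov n W J B q b)"
      using linear_minus[OF EB HY ls l(1) w] b(2) by simp
    also have "\<dots> = \<zero>\<^bsub>NE n J Y\<^esub> W b"
      using ncon_val[OF T(3,2) Y T(5) \<sigma> W b(1)] 0 by simp
    also have "\<dots> = \<zero>\<^bsub>Hom \<C> W Y\<^esub>" by (rule NE_val(1)[OF T(2) Y W b(1)])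
    finally show ?thesis
      using mminus_eq_zero[OF HY linear_closed[OF ls l(1)] linear_closed[OF ls w]] by simp
  qed
  define \<tau> where "\<tau> = (\<lambda>W\<in>obj \<C>. \<lambda>u\<in>carrier (E (Suc n) W A). \<sigma> W (lft W u))"
  have "\<tau> \<in> carrier (NE (Suc n) A Y)"
    unfolding \<tau>_def
  proof (rule NE_I[OF T(1) Y])
    fix W assume W: "W \<in> obj \<C>"
    note ls = NE_linear[OF T(3) Y \<sigma> W] and ld = dl_linear[OF T(1,3,6) W, of n] and EB = E_module[OF W T(3), of n]
    show "(\<lambda>u. \<sigma> W (lft W u)) \<in> linear_maps R (E (Suc n) W A) (Hom \<C> W Y)"
    proof (rule linearI)
      fix u assume u: "u \<in> carrier (E (Suc n) W A)"
      show "\<sigma> W (lft W u) \<in> mor \<C> W Y" by (rule linear_closed[OF ls lft(1)[OF W u]])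
      fix v assume v: "v \<in> carrier (E (Suc n) W A)"
      note lu = lft[OF W u] and lv = lft[OF W v]
      show "\<sigma> W (lft W (u \<oplus>\<^bsub>E (Suc n) W A\<^esub> v)) = \<sigma> W (lft W u) \<oplus>\<^bsub>Hom \<C> W Y\<^esub> \<sigma> W (lft W v)"
        using key[OF W madd_closed[OF EB lu(1) lv(1)]] linear_add[OF ld lu(1) lv(1)]
          linear_add[OF ls lu(1) lv(1)] lu(2) lv(2) by simp
    next
      fix r u assume r: "r \<in> carrier R" and u: "u \<in> carrier (E (Suc n) W A)"
      note lu = lft[OF W u]
      show "\<sigma> W (lft W (r \<odot>\<^bsub>E (Suc n) W A\<^esub> u)) = r \<odot>\<^bsub>Hom \<C> W Y\<^esub> \<sigma> W (lft W u)"
        using key[OF W msmult_closed[OF EB r lu(1)]] linear_smult[OF ld r lu(1)]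
          linear_smult[OF ls r lu(1)] lu(2) by simp
    qed
  next
    fix W W' f u assume a: "W \<in> obj \<C>" "W' \<in> obj \<C>" "f \<in> mor \<C> W' W" "u \<in> carrier (E (Suc n) W A)"
    note lu = lft[OF a(1,4)]
    show "\<sigma> W' (lft W' (econ (Suc n) A W W' f u)) = \<sigma> W (lft W u) \<cdot>\<^bsub>\<C>\<^esub> f"
      using key[OF a(2) E_contrav_closed[OF a(1,2) T(3) a(3) lu(1)]] dl_natural[OF T(1,3,6) a(1-3) lu(1)]
        NE_natural[OF T(3) Y \<sigma> a(1-3) lu(1)] lu(2) by simp
  qed
  moreover from this have "nconn n B A e \<tau> = \<sigma>"
  proof (intro NE_eqI[OF T(3) Y nconn_closed[OF T(1,3,6) Y] \<sigma>])
    fix W u assume W: "W \<in> obj \<C>" "u \<in> carrier (E n W B)"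
    then show "nconn n B A e \<tau> W u = \<sigma> W u"
      using key[OF W] dl_closed[OF T(1,3,6) W] by (simp add: nconn_val \<tau>_def)
  qed
  ultimately show ?thesis by blast
qed

lemma EII_delta_functor:
  assumes enough: "enough_injective_morphisms \<C>"
  shows "contravariant_delta_functor R \<C> (EII R \<C>) (EII_act R \<C>) (EII_delta R \<C>)"
proof -
  interpret S: extriangulated_connected_sequence R \<C> "EII R \<C>" "EII_act R \<C>" "EII_delta R \<C>"
    by (rule EII_connected)
  note ex = con_exact[OF enough]
  have nonneg: "S.middle_exact (int n) \<and> S.left_exact (int n) \<and> S.right_exact (int n)" for n
  proof -
    have k1: "int n + 1 = int (Suc n)" by simp
    note P1 = EII_positive(3,4,6)[OF k1]
    have surj: "\<exists>r\<in>carrier (EII R \<C> (int n) X Y). plain n X r = w"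
      if "X \<in> obj \<C>" "Y \<in> obj \<C>" "w \<in> carrier (E n X Y)" for X Y w
    proof -
      have "w \<in> plain n X ` carrier (EII R \<C> (int n) X Y)"
        using bij_betw_imp_surj_on[OF plain_bij[OF that(1,2)]] that(3) by simp
      then show ?thesis by blast
    qed
    have inj: "r = r'"
      if "X \<in> obj \<C>" "Y \<in> obj \<C>" "r \<in> carrier (EII R \<C> (int n) X Y)" "r' \<in> carrier (EII R \<C> (int n) X Y)"
        "plain n X r = plain n X r'" for X Y r r'
      by (rule inj_onD[OF bij_betw_imp_inj_on[OF plain_bij[OF that(1,2)]] that(5,3,4)])
    note pc = linear_closed[OF plain_linear]
    have "S.middle_exact (int n)"
      unfolding S.middle_exact_def
    proof (intro allI impI)
      fix A B C x y d Y u
      assume s: "s_triangle \<C> A B C x y d" and Y: "Y \<in> obj \<C>" and u: "u \<in> carrier (EII R \<C> (int n) B Y)"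
        and 0: "S.fcon (int n) Y B A x u = \<zero>\<^bsub>EII R \<C> (int n) A Y\<^esub>"
      note T = triD[OF s]
      have "econ n Y B A x (plain n B u) = \<zero>\<^bsub>E n A Y\<^esub>"
        using plain_contrav[OF T(2,1) Y T(4) u] 0
          linear_zero[OF EII_module[OF T(1) Y] E_module[OF T(1) Y] plain_linear[OF T(1) Y]] by simp
      then obtain w where w: "w \<in> carrier (E n C Y)" "econ n Y C B y w = plain n B u"
        using ex[of n] s Y pc[OF T(2) Y u] unfolding con_middle_def by blast
      obtain r where r: "r \<in> carrier (EII R \<C> (int n) C Y)" "plain n C r = w" using surj[OF T(3) Y w(1)] by blast
      have "S.fcon (int n) Y C B y r = u"
        by (rule inj[OF T(2) Y S.fcon_closed[OF T(3,2) Y T(5) r(1)] u])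
          (simp add: plain_contrav[OF T(3,2) Y T(5) r(1)] r(2) w(2))
      then show "\<exists>w\<in>carrier (EII R \<C> (int n) C Y). S.fcon (int n) Y C B y w = u" using r(1) by blast
    qed
    moreover have "S.left_exact (int n)"
      unfolding S.left_exact_def P1
    proof (intro allI impI)
      fix A B C x y d Y u
      assume s: "s_triangle \<C> A B C x y d" and Y: "Y \<in> obj \<C>" and u: "u \<in> carrier (EII R \<C> (int n) A Y)"
        and 0: "EII_delta R \<C> (int n) C A d Y u = Inl \<zero>\<^bsub>E (Suc n) C Y\<^esub>"
      note T = triD[OF s]
      have "du n C A d Y (plain n A u) = \<zero>\<^bsub>E (Suc n) C Y\<^esub>" using 0 by (simp add: plain_delta)
      then obtain w where w: "w \<in> carrier (E n B Y)" "econ n Y B A x w = plain n A u"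
        using ex[of n] s Y pc[OF T(1) Y u] unfolding con_left_def by blast
      obtain r where r: "r \<in> carrier (EII R \<C> (int n) B Y)" "plain n B r = w" using surj[OF T(2) Y w(1)] by blast
      have "S.fcon (int n) Y B A x r = u"
        by (rule inj[OF T(1) Y S.fcon_closed[OF T(2,1) Y T(4) r(1)] u])
          (simp add: plain_contrav[OF T(2,1) Y T(4) r(1)] r(2) w(2))
      then show "\<exists>w\<in>carrier (EII R \<C> (int n) B Y). S.fcon (int n) Y B A x w = u" using r(1) by blast
    qed
    moreover have "S.right_exact (int n)"
      unfolding S.right_exact_def P1
    proof (intro allI impI)
      fix A B C x y d Y u
      assume s: "s_triangle \<C> A B C x y d" and Y: "Y \<in> obj \<C>" and u: "u \<in> Inl ` carrier (E (Suc n) C Y)"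
        and 0: "S.fcon (int n + 1) Y C B y u = Inl \<zero>\<^bsub>E (Suc n) B Y\<^esub>"
      note T = triD[OF s]
      obtain t where t: "t \<in> carrier (E (Suc n) C Y)" "u = Inl t" using u by blast
      have "econ (Suc n) Y C B y t = \<zero>\<^bsub>E (Suc n) B Y\<^esub>" using 0 unfolding t(2) P1(3) by simp
      then obtain w where w: "w \<in> carrier (E n A Y)" "du n C A d Y w = t"
        using ex[of n] s Y t(1) unfolding con_right_def by blast
      obtain r where r: "r \<in> carrier (EII R \<C> (int n) A Y)" "plain n A r = w" using surj[OF T(1) Y w(1)] by blast
      then show "\<exists>w\<in>carrier (EII R \<C> (int n) A Y). EII_delta R \<C> (int n) C A d Y w = u"
        using w(2) t(2) by (auto simp: plain_delta)
    qed
    ultimately show ?thesis by simp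
  qed
  have dimension_shift: "S.dimension_shift k" if k: "k = - int (Suc n)" for k n
  proof -
    have k1: "k + 1 = - int n" using k by simp
    note N = EII_nonpositive(3,4)[OF k] and N1 = EII_nonpositive(3,4,6)[OF k1]
    show ?thesis
      unfolding S.dimension_shift_def N N1
    proof (intro allI impI conjI ballI)
      fix A J B i q e Y
      assume t: "inj_triangle A J B i q e" and Y: "Y \<in> obj \<C>"
      show "inj_on (EII_delta R \<C> k B A e Y) (Inr ` carrier (NE (Suc n) A Y))"
        using nconn_inj[OF t Y, of n] by (auto simp: inj_on_def EII_delta_negative[OF k])
      fix u assume u: "u \<in> Inr ` carrier (NE n B Y)"
        and 0: "contrav \<C> (EII_act R \<C> (k + 1)) Y B J q u = Inr \<zero>\<^bsub>NE n J Y\<^esub>"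
      obtain v where v: "v \<in> carrier (NE n B Y)" "u = Inr v" using u by blast
      have "contrav \<C> (NEm n) Y B J q v = \<zero>\<^bsub>NE n J Y\<^esub>" using 0 unfolding v(2) N1(3) by simp
      then show "\<exists>w\<in>Inr ` carrier (NE (Suc n) A Y). EII_delta R \<C> k B A e Y w = u"
        using nconn_lift[OF t Y v(1)] v(2) by (auto simp: EII_delta_negative[OF k])
    qed
  qed
  have nonpos: "S.middle_exact (- int n) \<and> S.left_exact (- int n) \<and> S.right_exact (- int n)" for n
  proof (induction n)
    case 0
    show ?case using nonneg[of 0] by simp
  next
    case (Suc n)
    let ?k = "- int (Suc n)"
    have k1: "?k + 1 = - int n" by simp
    note sh = dimension_shift[OF refl, of n]
    have M: "S.middle_exact (?k + 1)" and L: "S.left_exact (?k + 1)" using Suc unfolding k1 by simp_all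
    note r = S.shift_right[OF enough M L sh]
    show ?case using r S.shift_left[OF enough M sh] S.shift_middle[OF enough r sh] by blast
  qed
  have "S.middle_exact k \<and> S.left_exact k \<and> S.right_exact k" for k
  proof (cases k rule: degree_cases)
    case (nonnegative n)
    then show ?thesis using nonneg by simp
  next
    case (negative n)
    then show ?thesis using nonpos[of "Suc n"] by simp
  qed
  then show ?thesis by (intro S.delta_functorI) auto
qed

end

theorem theorem5p10:
  fixes R :: "('r, 'q) ring_scheme"
    and \<C> :: "('r, 'o, 'm, 'e, 'z) excat_scheme"
  assumes "extriangulated_category R \<C>"
    and "enough_injective_morphisms \<C>"
  shows "contravariant_delta_functor R \<C> (EII R \<C>) (EII_act R \<C>) (EII_delta R \<C>)"
  by (rule extriangulated_category.EII_delta_functor[OF assms])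


end
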